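(* Let $\kappa\in\{0,1,-1\}$, let $F$ be a curvature function satisfying conditions (i)--(iv) listed in the context, and let $M_t$ $(0\le t<T)$ be a family of smooth, closed, strictly convex surfaces in the space form $\mathbb{R}^3(\kappa)$ moving according to $$\frac{\partial}{\partial t}X(x,t)=F^{-\alpha}(x,t)\,\nu(x,t).$$ Assume that $\alpha\in(0,1]$ in the cases $\kappa=0,-1$, and that $\alpha=1$ in the case $\kappa=1$. Then the supremum over $M_t$ of the quantity $$G=\frac{(\lambda_1-\lambda_2)^2}{(\lambda_1+\lambda_2)^2}$$ is non-increasing in time, where $\lambda_1,\lambda_2$ are the principal curvatures of $M_t$.
   Context: $\mathbb{R}^3(0)=\mathbb{R}^3$, $\mathbb{R}^3(1)=\mathbb{S}^3$, $\mathbb{R}^3(-1)=\mathbb{H}^3$. Let $\Gamma_+=\{(\lambda_1,\lambda_2)\in\mathbb{R}^2:\lambda_1>0,\lambda_2>0\}$. The function $F$ satisfies: (i) $F$ is smooth, symmetric and positive on $\Gamma_+$; (ii) $\partial F/\partial\lambda_i>0$ on $\Gamma_+$ for $i=1,2$; (iii) $F(k\lambda)=kF(\lambda)$ for all $k>0$, $\lambda\in\Gamma_+$; (iv) $F(1,1)=2$. In the flow, $M_t=X(M,t)$, $F(x,t)=F(\lambda_1(x,t),\lambda_2(x,t))$ is evaluated at the principal curvatures of $M_t$, and $\nu$ is the outer unit normal; the sign convention is $h_{ij}=-\bar g(\bar\nabla_{\partial_i X}\partial_j X,\nu)$. Strictly convex means that all principal curvatures are positive. *)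

theory Defs
  imports "HOL-Analysis.Analysis"
begin

section \<open>Smooth maps\<close>

text \<open>
  Derivatives are taken within \<open>S\<close>, so that \<open>S\<close> may also be a product \<open>U \<times> I\<close> of an open
  set with a half-open time interval \<open>[0,T)\<close>; at time \<open>0\<close> the time derivatives are one-sided.
  On an open set this is the usual notion.
\<close>

primrec Ck_on :: "nat \<Rightarrow> 'a::euclidean_space set \<Rightarrow> ('a \<Rightarrow> 'b::real_normed_vector) \<Rightarrow> bool" where
  "Ck_on 0 S f \<longleftrightarrow> continuous_on S f"
| "Ck_on (Suc k) S f \<longleftrightarrow>
     (\<exists>f'. (\<forall>x\<in>S. (f has_derivative f' x) (at x within S)) \<and> (\<forall>v. Ck_on k S (\<lambda>x. f' x v)))"

definition smooth_on :: "'a::euclidean_space set \<Rightarrow> ('a \<Rightarrow> 'b::real_normed_vector) \<Rightarrow> bool" where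
  "smooth_on S f \<longleftrightarrow> (\<forall>k. Ck_on k S f)"

definition pd :: "2 \<Rightarrow> (real^2 \<Rightarrow> 'b::real_normed_vector) \<Rightarrow> real^2 \<Rightarrow> 'b" where
  "pd i f u = frechet_derivative f (at u) (axis i 1)"


section \<open>Curvature functions\<close>

definition Gamma_plus :: "(real \<times> real) set" where
  "Gamma_plus = {(a, b). a > 0 \<and> b > 0}"

definition curvature_function :: "(real \<times> real \<Rightarrow> real) \<Rightarrow> bool" where
  "curvature_function F \<longleftrightarrow>
     smooth_on Gamma_plus F \<and>
     (\<forall>(a, b)\<in>Gamma_plus. F (a, b) = F (b, a)) \<and>
     (\<forall>l\<in>Gamma_plus. F l > 0) \<and>
     (\<forall>(a, b)\<in>Gamma_plus. deriv (\<lambda>s. F (s, b)) a > 0 \<and> deriv (\<lambda>s. F (a, s)) b > 0) \<and>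
     (\<forall>l\<in>Gamma_plus. \<forall>k>0. F (k *\<^sub>R l) = k * F l) \<and>
     F (1, 1) = 2"


section \<open>The space forms\<close>

text \<open>
  The three space forms are realised in \<open>\<real> \<times> \<real>\<^sup>3\<close> with the bilinear form
  \<open>\<kappa> a b + v \<bullet> w\<close>: for \<open>\<kappa> = 1\<close> this is the unit sphere of Euclidean 4-space, for
  \<open>\<kappa> = -1\<close> the upper sheet of the hyperboloid \<open>\<langle>p,p\<rangle> = -1\<close> in Minkowski space, and for
  \<open>\<kappa> = 0\<close> the affine hyperplane \<open>{1} \<times> \<real>\<^sup>3\<close>, whose tangent vectors have first component 0,
  so that the form restricts to the Euclidean inner product on them.  In all three cases the form
  is positive definite on the tangent spaces and is there the Riemannian metric of the space form.
\<close>

type_synonym ambient = "real \<times> (real^3)"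

definition bform :: "real \<Rightarrow> ambient \<Rightarrow> ambient \<Rightarrow> real" where
  "bform \<kappa> p q = \<kappa> * fst p * fst q + snd p \<bullet> snd q"

definition space_form :: "real \<Rightarrow> ambient set" where
  "space_form \<kappa> = {(a, v). a\<^sup>2 + \<kappa> * (v \<bullet> v) = 1 \<and> (\<kappa> \<noteq> 1 \<longrightarrow> a > 0)}"

definition tangent_at :: "real \<Rightarrow> ambient \<Rightarrow> ambient set" where
  "tangent_at \<kappa> p = {w. fst p * fst w + \<kappa> * (snd p \<bullet> snd w) = 0}"

text \<open>
  Projection of the ambient space onto the tangent space at \<open>p\<close>, orthogonal with respect to
  the form; for \<open>\<kappa> = \<plusminus>1\<close> the normal direction is \<open>p\<close>, and \<open>\<langle>p,p\<rangle> = \<kappa>\<close>.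
  For \<open>\<kappa> = 0\<close> it is only ever applied to vectors that are tangent already.
\<close>

definition tangent_proj :: "real \<Rightarrow> ambient \<Rightarrow> ambient \<Rightarrow> ambient" where
  "tangent_proj \<kappa> p w = w - (\<kappa> * bform \<kappa> w p) *\<^sub>R p"

text \<open>The unit speed geodesic starting at \<open>p\<close> in the unit tangent direction \<open>n\<close>.\<close>

definition geodesic :: "real \<Rightarrow> ambient \<Rightarrow> ambient \<Rightarrow> real \<Rightarrow> ambient" where
  "geodesic \<kappa> p n s =
     (if \<kappa> = 1 then cos s *\<^sub>R p + sin s *\<^sub>R n
      else if \<kappa> = -1 then cosh s *\<^sub>R p + sinh s *\<^sub>R n
      else p + s *\<^sub>R n)"


section \<open>Closed surfaces\<close>

text \<open>
  A chart is given by its inverse, a parametrisation \<open>\<phi>\<close> defined on an open subset \<open>U\<close> of the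
  plane.
\<close>

type_synonym 'm parametrisation = "(real^2) set \<times> (real^2 \<Rightarrow> 'm)"

definition smooth_atlas :: "'m::topological_space set \<Rightarrow> 'm parametrisation set \<Rightarrow> bool" where
  "smooth_atlas M A \<longleftrightarrow>
     (\<forall>(U, \<phi>)\<in>A. open U \<and> openin (top_of_set M) (\<phi> ` U) \<and>
        (\<exists>\<psi>. homeomorphism U (\<phi> ` U) \<phi> \<psi>)) \<and>
     (\<Union>(U, \<phi>)\<in>A. \<phi> ` U) = M \<and>
     (\<forall>(U, \<phi>)\<in>A. \<forall>(V, \<psi>)\<in>A. smooth_on {u \<in> U. \<phi> u \<in> \<psi> ` V} (\<lambda>u. inv_into V \<psi> (\<phi> u)))"

text \<open>Second countability is automatic, since \<open>M\<close> is compact.\<close>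

definition closed_surface :: "'m::t2_space set \<Rightarrow> 'm parametrisation set \<Rightarrow> bool" where
  "closed_surface M A \<longleftrightarrow> M \<noteq> {} \<and> compact M \<and> connected M \<and> smooth_atlas M A"

definition time_interval :: "ereal \<Rightarrow> real set" where
  "time_interval T = {t. 0 \<le> t \<and> ereal t < T}"

text \<open>
  \<open>X t\<close> is the embedding of \<open>M\<close> at time \<open>t\<close>, with image \<open>M\<^sub>t\<close>; \<open>X\<close> is smooth jointly in
  space and time.  As \<open>M\<close> is compact, an injective immersion is an embedding.
\<close>

definition smooth_surface_family ::
  "real \<Rightarrow> 'm::t2_space set \<Rightarrow> 'm parametrisation set \<Rightarrow> ereal \<Rightarrow> (real \<Rightarrow> 'm \<Rightarrow> ambient) \<Rightarrow> bool" where
  "smooth_surface_family \<kappa> M A T X \<longleftrightarrow>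
     (\<forall>(U, \<phi>)\<in>A. smooth_on (U \<times> time_interval T) (\<lambda>(u, t). X t (\<phi> u))) \<and>
     (\<forall>t\<in>time_interval T.
        X t ` M \<subseteq> space_form \<kappa> \<and> inj_on (X t) M \<and>
        (\<forall>(U, \<phi>)\<in>A. \<forall>u\<in>U. inj (frechet_derivative (X t \<circ> \<phi>) (at u))))"


section \<open>The outer unit normal\<close>

text \<open>
  The region enclosed by a closed surface \<open>S\<close>: in Euclidean and hyperbolic space it is the
  bounded component of the complement of \<open>S\<close>.  In the sphere both components are bounded;
  a strictly convex closed surface lies in an open hemisphere, and the enclosed region is the
  component that is contained in an open hemisphere.
\<close>

definition enclosed_region :: "real \<Rightarrow> ambient set \<Rightarrow> ambient set \<Rightarrow> bool" where
  "enclosed_region \<kappa> S \<Omega> \<longleftrightarrow>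
     \<Omega> \<in> components (space_form \<kappa> - S) \<and>
     (if \<kappa> = 1 then \<exists>w. \<forall>p\<in>\<Omega>. w \<bullet> p > 0 else bounded \<Omega>)"

definition outer_unit_normal ::
  "real \<Rightarrow> 'm set \<Rightarrow> 'm parametrisation set \<Rightarrow> ('m \<Rightarrow> ambient) \<Rightarrow> ('m \<Rightarrow> ambient) \<Rightarrow> bool" where
  "outer_unit_normal \<kappa> M A Y \<nu> \<longleftrightarrow>
     (\<forall>x\<in>M. \<nu> x \<in> tangent_at \<kappa> (Y x) \<and> bform \<kappa> (\<nu> x) (\<nu> x) = 1) \<and>
     (\<forall>(U, \<phi>)\<in>A. \<forall>u\<in>U. \<forall>i. bform \<kappa> (\<nu> (\<phi> u)) (pd i (Y \<circ> \<phi>) u) = 0) \<and>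
     (\<exists>\<Omega>. enclosed_region \<kappa> (Y ` M) \<Omega> \<and>
        (\<forall>x\<in>M. \<forall>\<^sub>F s in at_right 0.
           geodesic \<kappa> (Y x) (\<nu> x) (- s) \<in> \<Omega> \<and> geodesic \<kappa> (Y x) (\<nu> x) s \<notin> \<Omega>))"


section \<open>Principal curvatures\<close>

text \<open>Below, \<open>Z\<close> is a local parametrisation of a surface in the space form.\<close>

definition first_fundamental :: "real \<Rightarrow> (real^2 \<Rightarrow> ambient) \<Rightarrow> real^2 \<Rightarrow> real^2^2" where
  "first_fundamental \<kappa> Z u = (\<chi> i j. bform \<kappa> (pd i Z u) (pd j Z u))"

text \<open>
  The Levi-Civita connection of the space form, along \<open>Z\<close>, is the tangential part of the flat
  ambient connection.
\<close>

definition covariant_deriv :: "real \<Rightarrow> 2 \<Rightarrow> 2 \<Rightarrow> (real^2 \<Rightarrow> ambient) \<Rightarrow> real^2 \<Rightarrow> ambient" where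
  "covariant_deriv \<kappa> i j Z u = tangent_proj \<kappa> (Z u) (pd i (pd j Z) u)"

definition second_fundamental :: "real \<Rightarrow> (real^2 \<Rightarrow> ambient) \<Rightarrow> ambient \<Rightarrow> real^2 \<Rightarrow> real^2^2" where
  "second_fundamental \<kappa> Z n u = (\<chi> i j. - bform \<kappa> (covariant_deriv \<kappa> i j Z u) n)"

definition weingarten :: "real \<Rightarrow> (real^2 \<Rightarrow> ambient) \<Rightarrow> ambient \<Rightarrow> real^2 \<Rightarrow> real^2^2" where
  "weingarten \<kappa> Z n u = matrix_inv (first_fundamental \<kappa> Z u) ** second_fundamental \<kappa> Z n u"

text \<open>
  \<open>lam1 x\<close> and \<open>lam2 x\<close> are the two eigenvalues of the Weingarten map at \<open>x\<close>, in either order.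
  The Weingarten map is self-adjoint, so a single eigenvalue necessarily has multiplicity two,
  and equality of sets determines the unordered pair.
\<close>

definition principal_curvatures ::
  "real \<Rightarrow> 'm parametrisation set \<Rightarrow> ('m \<Rightarrow> ambient) \<Rightarrow> ('m \<Rightarrow> ambient)
     \<Rightarrow> ('m \<Rightarrow> real) \<Rightarrow> ('m \<Rightarrow> real) \<Rightarrow> bool" where
  "principal_curvatures \<kappa> A Y \<nu> lam1 lam2 \<longleftrightarrow>
     (\<forall>(U, \<phi>)\<in>A. \<forall>u\<in>U.
        {l. \<exists>v. v \<noteq> 0 \<and> weingarten \<kappa> (Y \<circ> \<phi>) (\<nu> (\<phi> u)) u *v v = l *\<^sub>R v}
          = {lam1 (\<phi> u), lam2 (\<phi> u)})"

definition strictly_convex :: "'m set \<Rightarrow> ('m \<Rightarrow> real) \<Rightarrow> ('m \<Rightarrow> real) \<Rightarrow> bool" where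
  "strictly_convex M lam1 lam2 \<longleftrightarrow> (\<forall>x\<in>M. lam1 x > 0 \<and> lam2 x > 0)"

end

theory Submission
  imports Defs
begin

text \<open>
  Apply the maximum principle to \<open>G - \<epsilon> t\<close> on \<open>M \<times> [s, r]\<close>. A maximum at a time after \<open>s\<close> would be a
  spatial maximum of \<open>G\<close> at a non-umbilic point with \<open>\<partial>\<^sub>t G \<ge> \<epsilon>\<close>, so it suffices to show
  \<open>\<partial>\<^sub>t G \<le> 0\<close> at such a point. Write \<open>\<Phi> = F\<^sup>-\<^sup>\<alpha>\<close> and take coordinates that are normal at the point
  and diagonalise the second fundamental form, with \<open>\<lambda>\<^sub>1 > \<lambda>\<^sub>2\<close>. Then \<open>\<partial>\<^sub>t \<lambda>\<^sub>i = - \<Phi>\<^sub>;\<^sub>i\<^sub>i - \<Phi> \<lambda>\<^sub>i\<^sup>2 - \<kappa> \<Phi>\<close>.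
  In dimension two \<open>\<nabla> G = 0\<close> and homogeneity force \<open>\<nabla>\<^sub>i \<lambda>\<^sub>j = \<lambda>\<^sub>j \<mu>\<^sub>i\<close>, and \<open>F\<close> is \<open>H\<close> times a function
  of \<open>G\<close>. With the Codazzi equations and the exchange rule
  \<open>h\<^sub>1\<^sub>1\<^sub>;\<^sub>2\<^sub>2 - h\<^sub>2\<^sub>2\<^sub>;\<^sub>1\<^sub>1 = (\<lambda>\<^sub>1 - \<lambda>\<^sub>2) (\<lambda>\<^sub>1 \<lambda>\<^sub>2 + \<kappa>)\<close> the derivative \<open>\<partial>\<^sub>t G\<close> becomes a sum of
  \<open>- (\<partial>\<Phi>/\<partial>\<lambda>\<^sub>i) G\<^sub>;\<^sub>i\<^sub>i\<close>, a quadratic form in \<open>\<mu>\<close>, and a negative multiple of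
  \<open>(1 + \<alpha>) \<lambda>\<^sub>1 \<lambda>\<^sub>2 - (1 - \<alpha>) \<kappa>\<close>; each is \<open>\<le> 0\<close> under the hypotheses on \<open>\<alpha>\<close> and \<open>\<kappa>\<close>.
\<close>

section \<open>Directional derivatives of smooth maps\<close>

text \<open>The coefficient \<open>(1 + \<alpha>) * K - (1 - \<alpha>) * \<kappa>\<close> has two
  sources: the zeroth order terms in the evolution of the principal curvatures give
  \<open>K - \<kappa>\<close>, and exchanging covariant derivatives gives
  \<open>\<alpha> * (K + \<kappa>)\<close>. For \<kappa> = 1 its sign is controlled for every
  positive \<open>K\<close> by taking \<alpha> = 1. Regularity shapes the rest. The principal
  curvatures are pointwise choices from an unordered pair and may switch, so derivatives are taken
  of their symmetric functions, which are rational in the two fundamental forms. The derivative of F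
  / H with respect to G is computed by a formula that divides by the square root of G; the
  correction by \<epsilon> t is what makes G positive at a late maximum, so this formula is met only
  away from umbilic points. At time 0 derivatives are one-sided. The differential inequality is
  therefore proved on the open set of positive times, and continuity of G carries the comparison
  down to time 0.\<close>

lemma Ck_on_subset: "Ck_on k S f \<Longrightarrow> T \<subseteq> S \<Longrightarrow> Ck_on k T f"
proof (induction k arbitrary: f)
  case 0
  then show ?case using continuous_on_subset by (metis Ck_on.simps(1))
next
  case (Suc k)
  then obtain f' where f': "\<forall>x\<in>S. (f has_derivative f' x) (at x within S)" "\<forall>v. Ck_on k S (\<lambda>x. f' x v)"
    by auto
  have "\<forall>x\<in>T. (f has_derivative f' x) (at x within T)"
    using f'(1) \<open>T \<subseteq> S\<close> has_derivative_subset by blast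
  with Suc f'(2) show ?case by auto
qed

lemma Ck_on_cong: "Ck_on k S f \<Longrightarrow> (\<And>x. x \<in> S \<Longrightarrow> f x = g x) \<Longrightarrow> Ck_on k S g"
proof (induction k)
  case 0
  then show ?case using continuous_on_cong[of S S f g] by simp
next
  case (Suc k)
  then obtain f' where "\<forall>x\<in>S. (f has_derivative f' x) (at x within S)" "\<forall>v. Ck_on k S (\<lambda>x. f' x v)"
    by auto
  with Suc.prems(2) show ?case
    by (auto intro!: exI[of _ f'] intro: has_derivative_transform[where f = f])
qed

lemma Ck_on_Suc_imp: "Ck_on (Suc k) S f \<Longrightarrow> Ck_on k S f"
proof (induction k arbitrary: f)
  case 0
  then obtain f' where "\<forall>x\<in>S. (f has_derivative f' x) (at x within S)" by auto
  then have "\<forall>x\<in>S. continuous (at x within S) f"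
    using has_derivative_continuous by blast
  then show ?case by (simp add: continuous_on_eq_continuous_within)
next
  case (Suc k)
  then obtain f' where "\<forall>x\<in>S. (f has_derivative f' x) (at x within S)" "\<forall>v. Ck_on (Suc k) S (\<lambda>x. f' x v)"
    by auto
  with Suc.IH show ?case by auto
qed

lemma Ck_on_const: "Ck_on k S (\<lambda>x. c)"
proof (induction k arbitrary: c)
  case (Suc k)
  show ?case unfolding Ck_on.simps
    by (rule exI[of _ "\<lambda>_ _. 0"]) (simp add: Suc)
qed simp

lemma Ck_on_bounded_linear: "bounded_linear f \<Longrightarrow> Ck_on k S f"
proof (induction k)
  case 0
  then show ?case by (simp add: linear_continuous_on)
next
  case (Suc k)
  then show ?case unfolding Ck_on.simps
    by (intro exI[of _ "\<lambda>_. f"]) (simp add: bounded_linear_imp_has_derivative Ck_on_const)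
qed

lemma Ck_on_add: "Ck_on k S f \<Longrightarrow> Ck_on k S g \<Longrightarrow> Ck_on k S (\<lambda>x. f x + g x)"
proof (induction k arbitrary: f g)
  case 0
  then show ?case by (simp add: continuous_on_add)
next
  case (Suc k)
  then obtain f' g' where
    "\<forall>x\<in>S. (f has_derivative f' x) (at x within S)" "\<forall>v. Ck_on k S (\<lambda>x. f' x v)"
    "\<forall>x\<in>S. (g has_derivative g' x) (at x within S)" "\<forall>v. Ck_on k S (\<lambda>x. g' x v)"
    by auto
  with Suc.IH show ?case
    by (auto intro!: exI[of _ "\<lambda>x v. f' x v + g' x v"] has_derivative_add)
qed

lemma Ck_on_sum: "(\<And>i. i \<in> I \<Longrightarrow> Ck_on k S (f i)) \<Longrightarrow> Ck_on k S (\<lambda>x. \<Sum>i\<in>I. f i x)"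
  by (induction I rule: infinite_finite_induct) (auto intro: Ck_on_const Ck_on_add)

lemma Ck_on_bilinear:
  assumes "bounded_bilinear pr"
  shows "Ck_on k S f \<Longrightarrow> Ck_on k S g \<Longrightarrow> Ck_on k S (\<lambda>x. pr (f x) (g x))"
proof (induction k arbitrary: f g)
  case 0
  then show ?case by (simp add: bounded_bilinear.continuous_on[OF assms])
next
  case (Suc k)
  then obtain f' g' where
    "\<forall>x\<in>S. (f has_derivative f' x) (at x within S)" "\<forall>v. Ck_on k S (\<lambda>x. f' x v)"
    "\<forall>x\<in>S. (g has_derivative g' x) (at x within S)" "\<forall>v. Ck_on k S (\<lambda>x. g' x v)"
    by auto
  moreover have "Ck_on k S f" "Ck_on k S g" using Suc.prems Ck_on_Suc_imp by blast+
  ultimately show ?case using Suc.IH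
    by (auto intro!: exI[of _ "\<lambda>x v. pr (f x) (g' x v) + pr (f' x v) (g x)"]
        bounded_bilinear.FDERIV[OF assms] Ck_on_add)
qed

lemma Ck_on_compose:
  fixes f :: "'a::euclidean_space \<Rightarrow> 'b::euclidean_space" and g :: "'b \<Rightarrow> 'c::real_normed_vector"
  shows "Ck_on k T g \<Longrightarrow> Ck_on k S f \<Longrightarrow> f ` S \<subseteq> T \<Longrightarrow> Ck_on k S (\<lambda>x. g (f x))"
proof (induction k arbitrary: f g)
  case 0
  then show ?case unfolding Ck_on.simps by (rule continuous_on_compose2)
next
  case (Suc k)
  then obtain f' g' where
    f': "\<forall>x\<in>S. (f has_derivative f' x) (at x within S)" "\<forall>v. Ck_on k S (\<lambda>x. f' x v)" and
    g': "\<forall>x\<in>T. (g has_derivative g' x) (at x within T)" "\<forall>v. Ck_on k T (\<lambda>x. g' x v)"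
    by auto
  have "Ck_on k S f" using Suc.prems Ck_on_Suc_imp by blast
  have der: "((\<lambda>x. g (f x)) has_derivative (\<lambda>v. g' (f x) (f' x v))) (at x within S)" if "x \<in> S" for x
    using has_derivative_in_compose[of f "f' x" x S g "g' (f x)"] f'(1) g'(1) that Suc.prems(3)
    by (meson has_derivative_subset image_subset_iff)
  \<comment> \<open>The induction hypothesis covers \<open>g' (f x) b\<close> only for a fixed
    vector \<open>b\<close>; expanding the moving direction \<open>f' x v\<close> in the basis
    reduces to that case.\<close>
  have exp: "g' (f x) (f' x v) = (\<Sum>b\<in>Basis. (f' x v \<bullet> b) *\<^sub>R g' (f x) b)" if "x \<in> S" for x v
  proof -
    have lin: "linear (g' (f x))"
      using g'(1) that Suc.prems(3) has_derivative_linear by blast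
    have "g' (f x) (f' x v) = g' (f x) (\<Sum>b\<in>Basis. (f' x v \<bullet> b) *\<^sub>R b)"
      by (simp add: euclidean_representation)
    then show ?thesis using lin by (simp add: linear_sum linear_cmul)
  qed
  have "Ck_on k S (\<lambda>x. g' (f x) (f' x v))" for v
  proof (rule Ck_on_cong)
    show "Ck_on k S (\<lambda>x. \<Sum>b\<in>Basis. (f' x v \<bullet> b) *\<^sub>R g' (f x) b)"
      using Suc.IH[of _ f] g'(2) \<open>Ck_on k S f\<close> Suc.prems(3) f'(2)
      by (intro Ck_on_sum Ck_on_bilinear[OF bounded_bilinear_scaleR]
          Ck_on_bilinear[OF bounded_bilinear_inner] Ck_on_const) auto
  qed (simp add: exp)
  with der show ?case by (auto intro!: exI[of _ "\<lambda>x v. g' (f x) (f' x v)"])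
qed

lemma Ck_on_powr: "Ck_on k {0<..} (\<lambda>x::real. x powr a)"
proof (induction k arbitrary: a)
  case 0
  show ?case unfolding Ck_on.simps
    by (rule continuous_on_powr[OF continuous_on_id continuous_on_const]) simp
next
  case (Suc k)
  have "\<forall>x\<in>{0<..}. ((\<lambda>x. x powr a) has_derivative (*) (a * x powr (a - 1))) (at x within {0<..})"
    using has_real_derivative_powr[of _ a]
    by (auto simp: has_field_derivative_def intro: has_derivative_at_withinI)
  moreover have "Ck_on k {0<..} (\<lambda>x::real. a * x powr (a - 1) * v)" for v
    by (intro Ck_on_bilinear[OF bounded_bilinear_mult] Ck_on_const Suc)
  ultimately show ?case unfolding Ck_on.simps
    by (intro exI[of _ "\<lambda>x. (*) (a * x powr (a - 1))"]) simp
qed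

section \<open>Closure properties of smooth maps\<close>

named_theorems smooth_intros

lemma smooth_on_subset: "smooth_on S f \<Longrightarrow> T \<subseteq> S \<Longrightarrow> smooth_on T f"
  by (auto simp: smooth_on_def intro: Ck_on_subset)

lemma smooth_on_cong: "smooth_on S f \<Longrightarrow> (\<And>x. x \<in> S \<Longrightarrow> f x = g x) \<Longrightarrow> smooth_on S g"
  unfolding smooth_on_def using Ck_on_cong by blast

lemma smooth_on_const [smooth_intros]: "smooth_on S (\<lambda>x. c)"
  by (simp add: smooth_on_def Ck_on_const)

lemma smooth_on_bounded_linear: "bounded_linear f \<Longrightarrow> smooth_on S f"
  by (simp add: smooth_on_def Ck_on_bounded_linear)

lemma smooth_on_add [smooth_intros]:
  "smooth_on S f \<Longrightarrow> smooth_on S g \<Longrightarrow> smooth_on S (\<lambda>x. f x + g x)"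
  by (simp add: smooth_on_def Ck_on_add)

lemma smooth_on_bilinear:
  "bounded_bilinear pr \<Longrightarrow> smooth_on S f \<Longrightarrow> smooth_on S g \<Longrightarrow> smooth_on S (\<lambda>x. pr (f x) (g x))"
  by (simp add: smooth_on_def Ck_on_bilinear)

lemmas smooth_on_mult [smooth_intros] = smooth_on_bilinear[OF bounded_bilinear_mult]
lemmas smooth_on_scaleR [smooth_intros] = smooth_on_bilinear[OF bounded_bilinear_scaleR]

lemma smooth_on_minus [smooth_intros]:
  fixes f :: "'a::euclidean_space \<Rightarrow> 'b::real_normed_vector"
  shows "smooth_on S f \<Longrightarrow> smooth_on S (\<lambda>x. - f x)"
  using smooth_on_scaleR[OF smooth_on_const[of S "-1"], of f] by simp

lemma smooth_on_diff [smooth_intros]: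
  fixes f :: "'a::euclidean_space \<Rightarrow> 'b::real_normed_vector"
  shows "smooth_on S f \<Longrightarrow> smooth_on S g \<Longrightarrow> smooth_on S (\<lambda>x. f x - g x)"
  using smooth_on_add[OF _ smooth_on_minus, of S f g] by simp

lemma smooth_on_power [smooth_intros]:
  fixes f :: "'a::euclidean_space \<Rightarrow> real"
  shows "smooth_on S f \<Longrightarrow> smooth_on S (\<lambda>x. f x ^ n)"
  by (induction n) (simp_all add: smooth_on_const smooth_on_mult)

lemma smooth_on_compose:
  fixes f :: "'a::euclidean_space \<Rightarrow> 'b::euclidean_space" and g :: "'b \<Rightarrow> 'c::real_normed_vector"
  shows "smooth_on T g \<Longrightarrow> smooth_on S f \<Longrightarrow> f ` S \<subseteq> T \<Longrightarrow> smooth_on S (\<lambda>x. g (f x))"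
  unfolding smooth_on_def using Ck_on_compose by blast

lemma smooth_on_powr [smooth_intros]:
  fixes f :: "'a::euclidean_space \<Rightarrow> real"
  assumes "smooth_on S f" "\<And>x. x \<in> S \<Longrightarrow> f x > 0"
  shows "smooth_on S (\<lambda>x. f x powr a)"
proof -
  have "smooth_on {0<..} (\<lambda>x::real. x powr a)" by (simp add: smooth_on_def Ck_on_powr)
  from smooth_on_compose[OF this assms(1)] show ?thesis using assms(2) by auto
qed

text \<open>Division becomes the power -1 of the denominator; all denominators that occur later are
  positive.\<close>

lemma smooth_on_divide [smooth_intros]:
  fixes f g :: "'a::euclidean_space \<Rightarrow> real"
  assumes "smooth_on S f" "smooth_on S g" "\<And>x. x \<in> S \<Longrightarrow> g x > 0"
  shows "smooth_on S (\<lambda>x. f x / g x)"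
proof (rule smooth_on_cong)
  show "smooth_on S (\<lambda>x. f x * g x powr (-1))" by (intro smooth_intros assms)
next
  fix x assume "x \<in> S"
  then have "g x > 0" by (rule assms(3))
  then show "f x * g x powr (-1) = f x / g x" by (simp add: powr_minus_divide)
qed

section \<open>Iterated directional derivatives and their symmetry\<close>

definition dd :: "'a::euclidean_space \<Rightarrow> ('a \<Rightarrow> 'b::real_normed_vector) \<Rightarrow> 'a \<Rightarrow> 'b" where
  "dd v f x = frechet_derivative f (at x) v"

lemma dd_eq: "(f has_derivative f') (at x) \<Longrightarrow> dd v f x = f' v"
  unfolding dd_def using frechet_derivative_at by metis

lemma smooth_on_has_derivative:
  assumes "smooth_on S f" "open S" "x \<in> S"
  shows "(f has_derivative (\<lambda>v. dd v f x)) (at x)"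
proof -
  have "Ck_on (Suc 0) S f" using assms by (simp add: smooth_on_def)
  then obtain f' where "(f has_derivative f') (at x)"
    using assms at_within_open[of x S] by auto
  then show ?thesis unfolding dd_def using frechet_derivative_at by metis
qed

lemma smooth_on_dd [smooth_intros]:
  assumes "smooth_on S f" "open S"
  shows "smooth_on S (dd v f)"
  unfolding smooth_on_def
proof
  fix k
  have "Ck_on (Suc k) S f" using assms by (simp add: smooth_on_def)
  then obtain f' where f': "\<forall>x\<in>S. (f has_derivative f' x) (at x within S)" "\<forall>v. Ck_on k S (\<lambda>x. f' x v)"
    by auto
  have "f' x v = dd v f x" if "x \<in> S" for x
    using f'(1) that assms(2) at_within_open[of x S] dd_eq by metis
  then show "Ck_on k S (dd v f)" using f'(2) Ck_on_cong by blast
qed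

lemma smooth_on_imp_continuous_on: "smooth_on S f \<Longrightarrow> continuous_on S f"
  unfolding smooth_on_def by (metis Ck_on.simps(1))

lemma dd_cong:
  assumes "open S" "x \<in> S" "\<And>y. y \<in> S \<Longrightarrow> f y = g y"
  shows "dd v f x = dd v g x"
proof -
  have "(f has_derivative f') (at x) \<longleftrightarrow> (g has_derivative f') (at x)" for f'
    using assms has_derivative_transform_within_open[of f f' x UNIV S g]
      has_derivative_transform_within_open[of g f' x UNIV S f] by metis
  then show ?thesis by (simp add: dd_def frechet_derivative_def)
qed

lemma dd_const: "dd v (\<lambda>x. c) = (\<lambda>x. 0)"
  by (rule ext, rule dd_eq[OF has_derivative_const])

lemma dd_add:
  assumes "open S" "x \<in> S" "smooth_on S f" "smooth_on S g"
  shows "dd v (\<lambda>x. f x + g x) x = dd v f x + dd v g x"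
  by (rule dd_eq, intro has_derivative_add smooth_on_has_derivative[where S = S] assms)

text \<open>An arbitrary bilinear product is allowed, so that one rule serves multiplication,
  scaling, the inner product and the ambient form.\<close>

lemma dd_bilinear:
  assumes "bounded_bilinear pr" "open S" "x \<in> S" "smooth_on S f" "smooth_on S g"
  shows "dd v (\<lambda>x. pr (f x) (g x)) x = pr (f x) (dd v g x) + pr (dd v f x) (g x)"
  by (rule dd_eq, intro bounded_bilinear.FDERIV[OF assms(1)] smooth_on_has_derivative[where S = S] assms)

lemma dd_dd_bilinear:
  assumes "bounded_bilinear pr" "open S" "x \<in> S" "smooth_on S f" "smooth_on S g"
  shows "dd w (dd v (\<lambda>x. pr (f x) (g x))) x =
    pr (f x) (dd w (dd v g) x) + pr (dd w f x) (dd v g x)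
    + pr (dd v f x) (dd w g x) + pr (dd w (dd v f) x) (g x)"
proof -
  note sm = smooth_on_bilinear[OF assms(1)] smooth_on_dd[OF _ assms(2)] assms(4,5)
  have "dd w (dd v (\<lambda>x. pr (f x) (g x))) x
      = dd w (\<lambda>x. pr (f x) (dd v g x) + pr (dd v f x) (g x)) x"
    by (rule dd_cong[OF assms(2,3)], rule dd_bilinear[OF assms(1,2) _ assms(4,5)])
  also have "\<dots> = dd w (\<lambda>x. pr (f x) (dd v g x)) x + dd w (\<lambda>x. pr (dd v f x) (g x)) x"
    by (rule dd_add[OF assms(2,3)]; rule sm(1); rule sm(3,4) sm(2)[OF sm(3)] sm(2)[OF sm(4)])
  also have "dd w (\<lambda>x. pr (f x) (dd v g x)) x = pr (f x) (dd w (dd v g) x) + pr (dd w f x) (dd v g x)"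
    by (rule dd_bilinear[OF assms(1-3) sm(3) sm(2)[OF sm(4)]])
  also have "dd w (\<lambda>x. pr (dd v f x) (g x)) x = pr (dd v f x) (dd w g x) + pr (dd w (dd v f) x) (g x)"
    by (rule dd_bilinear[OF assms(1-3) sm(2)[OF sm(3)] sm(4)])
  finally show ?thesis by (simp add: add.assoc)
qed

lemma linear_dd:
  assumes "smooth_on S f" "open S" "x \<in> S"
  shows "linear (\<lambda>v. dd v f x)"
  using smooth_on_has_derivative[OF assms] has_derivative_linear by blast

lemma has_derivative_along_line:
  assumes "smooth_on S f" "open S" "x + r *\<^sub>R v \<in> S"
  shows "((\<lambda>r. f (x + r *\<^sub>R v)) has_vector_derivative dd v f (x + r *\<^sub>R v)) (at r)"
proof -
  have "((\<lambda>r. x + r *\<^sub>R v) has_derivative (\<lambda>h. h *\<^sub>R v)) (at r)"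
    by (auto intro!: derivative_eq_intros)
  from has_derivative_compose[OF this smooth_on_has_derivative[OF assms]]
  have "((\<lambda>r. f (x + r *\<^sub>R v)) has_derivative (\<lambda>h. dd (h *\<^sub>R v) f (x + r *\<^sub>R v))) (at r)"
    by simp
  then show ?thesis
    using linear_cmul[OF linear_dd[OF assms]] by (simp add: has_vector_derivative_def)
qed

lemma eventually_square_in_open:
  fixes x v w :: "'a::real_normed_vector"
  assumes "open S" "x \<in> S"
  shows "\<exists>d>0. \<forall>r s. 0 \<le> r \<longrightarrow> r \<le> d \<longrightarrow> 0 \<le> s \<longrightarrow> s \<le> d \<longrightarrow> x + r *\<^sub>R v + s *\<^sub>R w \<in> S"
proof -
  obtain e where e: "e > 0" "ball x e \<subseteq> S" using assms openE by blast
  \<comment> \<open>The summand 1 keeps the denominator positive when both directions vanish; the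
    factor 2 leaves room for a strict inequality.\<close>
  define d where "d = e / (2 * (norm v + norm w + 1))"
  have pos: "norm v + norm w + 1 > 0" using norm_ge_zero[of v] norm_ge_zero[of w] by linarith
  have d: "d > 0" using e pos by (simp add: d_def)
  have "x + r *\<^sub>R v + s *\<^sub>R w \<in> S" if "0 \<le> r" "r \<le> d" "0 \<le> s" "s \<le> d" for r s
  proof -
    have "norm (r *\<^sub>R v + s *\<^sub>R w) \<le> r * norm v + s * norm w"
      using norm_triangle_ineq[of "r *\<^sub>R v" "s *\<^sub>R w"] that by simp
    also have "\<dots> \<le> d * norm v + d * norm w" using that by (intro add_mono mult_right_mono) auto
    also have "\<dots> \<le> d * (norm v + norm w + 1)" using d by (simp add: algebra_simps)
    also have "\<dots> = e / 2"
      unfolding d_def using pos by (metis divide_divide_eq_left nonzero_divide_eq_eq mult.commute less_irrefl)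
    also have "\<dots> < e" using e by simp
    finally have "dist (x + r *\<^sub>R v + s *\<^sub>R w) x < e" by (simp add: dist_norm add.assoc)
    then have "dist x (x + r *\<^sub>R v + s *\<^sub>R w) < e" by (simp only: dist_commute)
    then show ?thesis using e by auto
  qed
  with d show ?thesis by blast
qed

text \<open>Both iterated derivatives are limits of the same second difference quotient.\<close>

lemma dd_commute_real:
  fixes f :: "'a::euclidean_space \<Rightarrow> real"
  assumes "smooth_on S f" "open S" "x \<in> S"
  shows "dd w (dd v f) x = dd v (dd w f) x"
proof -
  define \<Delta> where "\<Delta> s = f (x + s *\<^sub>R v + s *\<^sub>R w) - f (x + s *\<^sub>R v) - f (x + s *\<^sub>R w) + f x" for s
  \<comment> \<open>Directions and difference are rebound here: the second difference is symmetric
    in \<open>v\<close> and \<open>w\<close>, so \<open>key\<close> is used once for each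
    order.\<close>
  have key: "\<exists>d>0. \<forall>s. 0 < s \<longrightarrow> s < d \<longrightarrow> \<bar>\<Delta> s / s\<^sup>2 - dd w (dd v f) x\<bar> < e"
    if "\<And>s. \<Delta> s = f (x + s *\<^sub>R v + s *\<^sub>R w) - f (x + s *\<^sub>R v) - f (x + s *\<^sub>R w) + f x"
    and "e > 0" for e v w \<Delta>
  proof -
    have "continuous_on S (dd w (dd v f))"
      by (intro smooth_on_imp_continuous_on smooth_intros assms)
    then have "open (S \<inter> (\<lambda>y. dd w (dd v f) y) -` ball (dd w (dd v f) x) e)"
      using assms(2) continuous_on_open_vimage[of S] by (metis Int_commute open_ball)
    moreover have "x \<in> S \<inter> (\<lambda>y. dd w (dd v f) y) -` ball (dd w (dd v f) x) e"
      using assms that by auto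
    ultimately obtain d where d: "d > 0" "\<And>r s. 0 \<le> r \<Longrightarrow> r \<le> d \<Longrightarrow> 0 \<le> s \<Longrightarrow> s \<le> d \<Longrightarrow>
        x + r *\<^sub>R v + s *\<^sub>R w \<in> S \<inter> (\<lambda>y. dd w (dd v f) y) -` ball (dd w (dd v f) x) e"
      using eventually_square_in_open[of _ x v w] by (metis (no_types, lifting))
    have "\<bar>\<Delta> s / s\<^sup>2 - dd w (dd v f) x\<bar> < e" if s: "0 < s" "s < d" for s
    proof -
      \<comment> \<open>The mean value theorem along \<open>v\<close>, for the increment of
        \<open>f\<close> in direction \<open>w\<close>; a second one along \<open>w\<close> turns
        the quotient into the mixed derivative at an intermediate point.\<close>
      have "\<exists>z>0. z < s \<and>
        (f (x + s *\<^sub>R v + s *\<^sub>R w) - f (x + s *\<^sub>R v)) - (f (x + 0 *\<^sub>R v + s *\<^sub>R w) - f (x + 0 *\<^sub>R v))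
          = (s - 0) * (dd v f (x + z *\<^sub>R v + s *\<^sub>R w) - dd v f (x + z *\<^sub>R v))"
      proof (rule MVT2[OF s(1)])
        fix r assume r: "0 \<le> r" "r \<le> s"
        have 1: "x + s *\<^sub>R w + r *\<^sub>R v \<in> S" using d(2)[of r s] r s by (simp add: algebra_simps)
        have 2: "x + r *\<^sub>R v \<in> S" using d(2)[of r 0] r s by (simp add: algebra_simps)
        have "((\<lambda>r. f (x + s *\<^sub>R w + r *\<^sub>R v) - f (x + r *\<^sub>R v)) has_real_derivative
            dd v f (x + s *\<^sub>R w + r *\<^sub>R v) - dd v f (x + r *\<^sub>R v)) (at r)"
          using has_derivative_along_line[OF assms(1,2) 1] has_derivative_along_line[OF assms(1,2) 2]
          by (auto simp flip: has_real_derivative_iff_has_vector_derivative intro!: derivative_intros)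
        moreover have "x + s *\<^sub>R w + r *\<^sub>R v = x + r *\<^sub>R v + s *\<^sub>R w" for r by simp
        ultimately show "((\<lambda>r. f (x + r *\<^sub>R v + s *\<^sub>R w) - f (x + r *\<^sub>R v)) has_real_derivative
            dd v f (x + r *\<^sub>R v + s *\<^sub>R w) - dd v f (x + r *\<^sub>R v)) (at r)"
          by simp
      qed
      then obtain z where z: "z > 0" "z < s"
        "\<Delta> s = s * (dd v f (x + z *\<^sub>R v + s *\<^sub>R w) - dd v f (x + z *\<^sub>R v))"
        using that(1) \<open>\<And>s. \<Delta> s = _\<close> by (auto simp: algebra_simps)
      have "\<exists>y>0. y < s \<and> dd v f (x + z *\<^sub>R v + s *\<^sub>R w) - dd v f (x + z *\<^sub>R v + 0 *\<^sub>R w)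
          = (s - 0) * dd w (dd v f) (x + z *\<^sub>R v + y *\<^sub>R w)"
      proof (rule MVT2[OF s(1)])
        fix r assume r: "0 \<le> r" "r \<le> s"
        have "x + z *\<^sub>R v + r *\<^sub>R w \<in> S" using d(2)[of z r] r s z by auto
        from has_derivative_along_line[OF smooth_on_dd[OF assms(1,2)] assms(2) this]
        show "((\<lambda>r. dd v f (x + z *\<^sub>R v + r *\<^sub>R w)) has_real_derivative
            dd w (dd v f) (x + z *\<^sub>R v + r *\<^sub>R w)) (at r)"
          by (simp add: has_real_derivative_iff_has_vector_derivative)
      qed
      then obtain y where y: "y > 0" "y < s"
        "\<Delta> s = s * (s * dd w (dd v f) (x + z *\<^sub>R v + y *\<^sub>R w))" using z by auto
      then have "\<Delta> s / s\<^sup>2 = dd w (dd v f) (x + z *\<^sub>R v + y *\<^sub>R w)"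
        using s by (simp add: power2_eq_square)
      moreover have "dd w (dd v f) (x + z *\<^sub>R v + y *\<^sub>R w) \<in> ball (dd w (dd v f) x) e"
        using d(2)[of z y] y z s by auto
      ultimately show ?thesis by (simp add: dist_real_def abs_minus_commute)
    qed
    with d show ?thesis by blast
  qed
  show ?thesis
  proof (rule ccontr)
    assume ne: "dd w (dd v f) x \<noteq> dd v (dd w f) x"
    define e where "e = \<bar>dd w (dd v f) x - dd v (dd w f) x\<bar> / 2"
    have e: "e > 0" using ne by (simp add: e_def)
    obtain d1 where d1: "d1 > 0" "\<And>s. 0 < s \<Longrightarrow> s < d1 \<Longrightarrow> \<bar>\<Delta> s / s\<^sup>2 - dd w (dd v f) x\<bar> < e"
      using key[OF \<Delta>_def e] by blast
    have "\<And>s. \<Delta> s = f (x + s *\<^sub>R w + s *\<^sub>R v) - f (x + s *\<^sub>R w) - f (x + s *\<^sub>R v) + f x"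
      by (simp add: \<Delta>_def algebra_simps)
    from key[OF this e]
    obtain d2 where d2: "d2 > 0" "\<And>s. 0 < s \<Longrightarrow> s < d2 \<Longrightarrow> \<bar>\<Delta> s / s\<^sup>2 - dd v (dd w f) x\<bar> < e"
      by blast
    define s where "s = min d1 d2 / 2"
    have "0 < s" "s < d1" "s < d2" using d1(1) d2(1) by (auto simp: s_def)
    with d1(2)[of s] d2(2)[of s] show False unfolding e_def by argo
  qed
qed

lemma dd_commute:
  fixes f :: "'a::euclidean_space \<Rightarrow> 'b::euclidean_space"
  assumes "smooth_on S f" "open S" "x \<in> S"
  shows "dd w (dd v f) x = dd v (dd w f) x"
proof (rule euclidean_eqI)
  fix b :: 'b assume "b \<in> Basis"
  have "dd w (dd v f) x \<bullet> b = dd w (dd v (\<lambda>x. f x \<bullet> b)) x" for v w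
    using assms
    by (simp add: dd_dd_bilinear[OF bounded_bilinear_inner assms(2,3,1) smooth_on_const] dd_const
        bounded_bilinear.zero_right[OF bounded_bilinear_inner])
  moreover have "smooth_on S (\<lambda>x. f x \<bullet> b)"
    by (rule smooth_on_bilinear[OF bounded_bilinear_inner assms(1) smooth_on_const])
  ultimately show "dd w (dd v f) x \<bullet> b = dd v (dd w f) x \<bullet> b"
    using dd_commute_real assms by metis
qed

section \<open>The pinching estimate at a point\<close>

text \<open>
  Here \<open>x\<^sub>i = h\<^sub>1\<^sub>1\<^sub>;\<^sub>i\<close>, \<open>y\<^sub>i = h\<^sub>2\<^sub>2\<^sub>;\<^sub>i\<close>, while \<open>a\<close>, \<open>b\<close>, \<open>b'\<close>, \<open>c\<close> are the second derivatives
  \<open>h\<^sub>1\<^sub>1\<^sub>;\<^sub>1\<^sub>1\<close>, \<open>h\<^sub>2\<^sub>2\<^sub>;\<^sub>1\<^sub>1\<close>, \<open>h\<^sub>1\<^sub>1\<^sub>;\<^sub>2\<^sub>2\<close>, \<open>h\<^sub>2\<^sub>2\<^sub>;\<^sub>2\<^sub>2\<close>; \<open>\<beta>\<close> is the logarithmic derivative of \<open>F / H\<close> as a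
  function of \<open>G\<close>.
\<close>

lemma pinching_algebra:
  fixes l1 l2 H K f \<kappa> \<alpha> \<beta> :: real
  assumes l: "l1 > l2" "l2 > 0" and H: "H = l1 + l2" and K: "K = l1 * l2"
    and f: "f > 0" and \<alpha>: "0 < \<alpha>" "\<alpha> \<le> 1" and \<kappa>: "(1 - \<alpha>) * \<kappa> \<le> (1 + \<alpha>) * K"
    and crit: "l2 * x1 = l1 * y1" "l2 * x2 = l1 * y2"
    and gauss: "b' - b = (l1 - l2) * (K + \<kappa>)"
    and K11: "K11 = l2 * a + l1 * b + 2 * x1 * y1 - 2 * x2\<^sup>2"
    and K22: "K22 = l2 * b' + l1 * c + 2 * x2 * y2 - 2 * y1\<^sup>2"
    and G11: "G11 * H ^ 4 = 8 * K * ((x1 + y1)\<^sup>2 + H * (a + b)) - 4 * K11 * H\<^sup>2"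
    and G22: "G22 * H ^ 4 = 8 * K * ((x2 + y2)\<^sup>2 + H * (b' + c)) - 4 * K22 * H\<^sup>2"
    and f11: "f11 * H\<^sup>2 = \<alpha> * f * ((\<alpha> + 1) * (x1 + y1)\<^sup>2 - H * (a + b) - \<beta> * G11 * H\<^sup>2)"
    and f22: "f22 * H\<^sup>2 = \<alpha> * f * ((\<alpha> + 1) * (x2 + y2)\<^sup>2 - H * (b' + c) - \<beta> * G22 * H\<^sup>2)"
    and t1: "t1 = - f11 - f * l1\<^sup>2 - \<kappa> * f" and t2: "t2 = - f22 - f * l2\<^sup>2 - \<kappa> * f"
    and Gt: "Gt * H ^ 3 = 8 * K * (t1 + t2) - 4 * (l1 * t2 + l2 * t1) * H"
    and ell: "0 \<le> H\<^sup>2 + 4 * (l1 - l2) * \<beta> * l2" "0 \<le> H\<^sup>2 - 4 * (l1 - l2) * \<beta> * l1"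
    and max: "G11 \<le> 0" "G22 \<le> 0"
  shows "Gt \<le> 0"
proof -
  define m1 where "m1 = x1 / l1"
  define m2 where "m2 = x2 / l1"
  have x: "x1 = l1 * m1" "y1 = l2 * m1" "x2 = l1 * m2" "y2 = l2 * m2"
    using l crit by (auto simp: m1_def m2_def field_simps)
  have Hpos: "H > 0" using l H by simp
  have s: "x1 + y1 = H * m1" "x2 + y2 = H * m2" unfolding x H by algebra+
  \<comment> \<open>The part of \<open>G11\<close> and \<open>G22\<close> that is linear in the
    second derivatives is \<open>4 * (l1 - l2) / H ^ 3\<close> times \<open>P1\<close> and
    \<open>P2\<close>.\<close>
  define P1 where "P1 = l2 * a - l1 * b"
  define P2 where "P2 = l2 * b' - l1 * c"
  have "H * (4 * (l1 - l2) * P1) = H * (G11 * H ^ 3 - 8 * H * l1\<^sup>2 * m2\<^sup>2)"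
  proof -
    have "G11 * H ^ 4 = 8 * (l1 * l2) * ((l1 * m1 + l2 * m1)\<^sup>2 + H * (a + b)) - 4 * K11 * H\<^sup>2"
      using G11 unfolding x K .
    moreover note K11[unfolded x]
    ultimately show ?thesis unfolding P1_def H by algebra
  qed
  then have P1: "4 * (l1 - l2) * P1 = G11 * H ^ 3 - 8 * H * l1\<^sup>2 * m2\<^sup>2" using Hpos by simp
  have "H * (4 * (l1 - l2) * P2) = H * (G22 * H ^ 3 - 8 * H * l2\<^sup>2 * m1\<^sup>2)"
  proof -
    have "G22 * H ^ 4 = 8 * (l1 * l2) * ((l1 * m2 + l2 * m2)\<^sup>2 + H * (b' + c)) - 4 * K22 * H\<^sup>2"
      using G22 unfolding x K .
    moreover note K22[unfolded x]
    ultimately show ?thesis unfolding P2_def H by algebra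
  qed
  then have P2: "4 * (l1 - l2) * P2 = G22 * H ^ 3 - 8 * H * l2\<^sup>2 * m1\<^sup>2" using Hpos by simp
  \<comment> \<open>The speed terms contain the mixed derivatives \<open>b\<close> and
    \<open>b'\<close> in interchanged places compared with \<open>P1 + P2\<close>; swapping them
    brings in the exchange rule, multiplied by \<open>H\<close>.\<close>
  have P12: "l2 * (a + b) - l1 * (b' + c) = P1 + P2 - H * ((l1 - l2) * (K + \<kappa>))"
    unfolding gauss[symmetric] P1_def P2_def H by algebra
  \<comment> \<open>The closed form of \<open>Gt * H ^ 3\<close> after elimination of all second
    derivatives. In the coefficient of \<open>m2\<^sup>2\<close> the speed contributes a positive
    term, which the gradient term of \<open>P1\<close> outweighs because \<alpha> \<le> 1.\<close>
  define R where "R = \<alpha> * f * ((H\<^sup>2 + 4 * (l1 - l2) * \<beta> * l2) * G11 + (H\<^sup>2 - 4 * (l1 - l2) * \<beta> * l1) * G22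
      - 4 * l2 * ((1 + \<alpha>) * l1 + (1 - \<alpha>) * l2) * m1\<^sup>2
      - 4 * l1 * ((1 - \<alpha>) * l1 + (1 + \<alpha>) * l2) * m2\<^sup>2)
      - 4 * f * (l1 - l2)\<^sup>2 * ((1 + \<alpha>) * K - (1 - \<alpha>) * \<kappa>)"
  have 1: "Gt * H ^ 3 = 4 * (l1 - l2) * (l1 * f22 - l2 * f11) - 4 * f * (l1 - l2)\<^sup>2 * (K - \<kappa>)"
    using Gt unfolding t1 t2 H K by algebra
  have 2: "H\<^sup>2 * (l1 * f22 - l2 * f11) = \<alpha> * f * ((\<alpha> + 1) * H\<^sup>2 * (l1 * m2\<^sup>2 - l2 * m1\<^sup>2)
      + H * (l2 * (a + b) - l1 * (b' + c)) + \<beta> * H\<^sup>2 * (l2 * G11 - l1 * G22))"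
  proof -
    have "H\<^sup>2 * (l1 * f22 - l2 * f11) = l1 * (f22 * H\<^sup>2) - l2 * (f11 * H\<^sup>2)" by algebra
    also have "\<dots> = \<alpha> * f * ((\<alpha> + 1) * H\<^sup>2 * (l1 * m2\<^sup>2 - l2 * m1\<^sup>2)
      + H * (l2 * (a + b) - l1 * (b' + c)) + \<beta> * H\<^sup>2 * (l2 * G11 - l1 * G22))"
      unfolding f11 f22 s by algebra
    finally show ?thesis .
  qed
  have "H\<^sup>2 * (Gt * H ^ 3) = 4 * (l1 - l2) * (H\<^sup>2 * (l1 * f22 - l2 * f11)) - H\<^sup>2 * (4 * f * (l1 - l2)\<^sup>2 * (K - \<kappa>))"
    unfolding 1 by algebra
  also have "4 * (l1 - l2) * (H\<^sup>2 * (l1 * f22 - l2 * f11)) = \<alpha> * f * ((\<alpha> + 1) * H\<^sup>2 * 4 * (l1 - l2) * (l1 * m2\<^sup>2 - l2 * m1\<^sup>2)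
      + H * (4 * (l1 - l2) * P1 + 4 * (l1 - l2) * P2 - 4 * (l1 - l2) * H * ((l1 - l2) * (K + \<kappa>)))
      + \<beta> * H\<^sup>2 * 4 * (l1 - l2) * (l2 * G11 - l1 * G22))"
    unfolding 2 P12 by algebra
  also have "\<dots> - H\<^sup>2 * (4 * f * (l1 - l2)\<^sup>2 * (K - \<kappa>)) = H\<^sup>2 * R"
    unfolding P1 P2 R_def H by algebra
  finally have "Gt * H ^ 3 = R" using Hpos by simp
  moreover have "R \<le> 0"
  proof -
    have "(H\<^sup>2 + 4 * (l1 - l2) * \<beta> * l2) * G11 \<le> 0" "(H\<^sup>2 - 4 * (l1 - l2) * \<beta> * l1) * G22 \<le> 0"
      using ell max by (simp_all add: mult_nonneg_nonpos)
    moreover have "0 \<le> 4 * l2 * ((1 + \<alpha>) * l1 + (1 - \<alpha>) * l2) * m1\<^sup>2"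
      "0 \<le> 4 * l1 * ((1 - \<alpha>) * l1 + (1 + \<alpha>) * l2) * m2\<^sup>2"
      using l \<alpha> by simp_all
    moreover have "0 \<le> \<alpha> * f" using \<alpha> f by simp
    ultimately have "\<alpha> * f * ((H\<^sup>2 + 4 * (l1 - l2) * \<beta> * l2) * G11 + (H\<^sup>2 - 4 * (l1 - l2) * \<beta> * l1) * G22
      - 4 * l2 * ((1 + \<alpha>) * l1 + (1 - \<alpha>) * l2) * m1\<^sup>2
      - 4 * l1 * ((1 - \<alpha>) * l1 + (1 + \<alpha>) * l2) * m2\<^sup>2) \<le> 0"
      by (intro mult_nonneg_nonpos) linarith+
    moreover have "0 \<le> 4 * f * (l1 - l2)\<^sup>2 * ((1 + \<alpha>) * K - (1 - \<alpha>) * \<kappa>)"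
      using f \<kappa> by simp
    ultimately show ?thesis unfolding R_def by linarith
  qed
  ultimately have "Gt * H ^ 3 \<le> 0" by simp
  then show ?thesis using Hpos by (simp add: mult_le_0_iff)
qed

text \<open>As \<open>b\<close> vanishes at 0, the difference quotient is
  \<open>c h * (b h / h)\<close>, and continuity of \<open>c\<close> takes the place of
  differentiability.\<close>

lemma DERIV_mult_zero:
  fixes b c :: "real \<Rightarrow> real"
  assumes "(b has_real_derivative b') (at 0)" "b 0 = 0" "isCont c 0"
  shows "((\<lambda>r. c r * b r) has_real_derivative c 0 * b') (at 0)"
proof -
  have "((\<lambda>h. c h * (b h / h)) \<longlongrightarrow> c 0 * b') (at 0)"
    using assms by (intro tendsto_mult) (auto simp: DERIV_def isCont_def)
  then show ?thesis using assms(2) by (simp add: DERIV_def)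
qed

lemma eventually_line_in_open:
  fixes x v :: "'a::real_normed_vector"
  assumes "open S" "x \<in> S"
  shows "\<forall>\<^sub>F r in nhds 0. x + r *\<^sub>R v \<in> S"
proof -
  have "open ((\<lambda>r. x + r *\<^sub>R v) -` S)"
    by (intro open_vimage assms(1) continuous_intros)
  then show ?thesis using assms(2) by (auto simp: eventually_nhds)
qed

text \<open>Since \<open>dd v G p = 0\<close>, continuity of \<open>B'\<close> suffices for the second derivative.\<close>

lemma dd_dd_speed:
  fixes f H G :: "'a::euclidean_space \<Rightarrow> real"
  assumes S: "open S" "p \<in> S" and sm: "smooth_on S f" "smooth_on S H" "smooth_on S G"
    and pos: "\<And>x. x \<in> S \<Longrightarrow> H x > 0 \<and> B (G x) > 0"
    and B: "\<And>x. x \<in> S \<Longrightarrow> (B has_real_derivative B' (G x)) (at (G x))" "isCont B' (G p)"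
    and f: "\<And>x. x \<in> S \<Longrightarrow> f x = (H x * B (G x)) powr (- \<alpha>)"
    and crit: "dd v G p = 0"
  shows "dd v (dd v f) p * (H p)\<^sup>2 = \<alpha> * f p * ((\<alpha> + 1) * (dd v H p)\<^sup>2
    - H p * dd v (dd v H) p - B' (G p) / B (G p) * dd v (dd v G) p * (H p)\<^sup>2)"
proof -
  have line: "((\<lambda>r. k (x + r *\<^sub>R v)) has_real_derivative dd v k x) (at 0)"
    if "smooth_on S k" "x \<in> S" for k x
    using has_derivative_along_line[OF that(1) S(1), of x 0 v] that(2)
    by (simp add: has_real_derivative_iff_has_vector_derivative)
  \<comment> \<open>The logarithmic derivative of the speed, with \<open>H\<close> multiplied out;
    \<open>B' / B\<close> is the logarithmic derivative of \<open>B\<close>.\<close>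
  have first: "dd v f x * H x = - \<alpha> * f x * (dd v H x + H x * (B' (G x) / B (G x)) * dd v G x)"
    if x: "x \<in> S" for x
  proof -
    have BG: "((\<lambda>r. B (G (x + r *\<^sub>R v))) has_real_derivative B' (G x) * dd v G x) (at 0)"
      using DERIV_chain2[OF _ line[OF sm(3) x], of B "B' (G x)"] B(1)[OF x] by simp
    define E where "E r = H (x + r *\<^sub>R v) * B (G (x + r *\<^sub>R v))" for r
    define E' where "E' = dd v H x * B (G x) + B' (G x) * dd v G x * H x"
    have E': "(E has_real_derivative E') (at 0)"
      unfolding E_def[abs_def] E'_def using DERIV_mult[OF line[OF sm(2) x] BG] by simp
    have E0: "E 0 > 0" using pos[OF x] by (simp add: E_def)
    have d1: "((\<lambda>r. E r powr (- \<alpha>)) has_real_derivative (- \<alpha>) * E 0 powr (- \<alpha> - 1) * E') (at 0)"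
      using DERIV_chain2[OF has_real_derivative_powr[OF E0] E'] .
    have ev: "\<forall>\<^sub>F r in nhds 0. E r powr (- \<alpha>) = f (x + r *\<^sub>R v)"
      using eventually_line_in_open[OF S(1) x, of v] by eventually_elim (simp add: f E_def)
    note iffD1[OF DERIV_cong_ev[OF refl ev refl] d1]
    then have d: "dd v f x = (- \<alpha>) * E 0 powr (- \<alpha> - 1) * E'"
      using line[OF sm(1) x] DERIV_unique by blast
    have "E 0 powr (- \<alpha> - 1) * E 0 = E 0 powr (- \<alpha>)"
      using E0 powr_add[of "E 0" "- \<alpha> - 1" 1] by simp
    then have "E 0 powr (- \<alpha> - 1) * E 0 = f x" using f[OF x] by (simp add: E_def)
    then have *: "dd v f x * E 0 = - \<alpha> * f x * E'" unfolding d by (simp add: algebra_simps)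
    define q where "q = B' (G x) / B (G x)"
    have "B' (G x) = q * B (G x)" using pos[OF x] by (simp add: q_def)
    with * have "(dd v f x * H x) * B (G x) = (- \<alpha> * f x * (dd v H x + H x * q * dd v G x)) * B (G x)"
      unfolding E'_def E_def by simp algebra
    moreover have "B (G x) \<noteq> 0" using pos[OF x] by simp
    ultimately show ?thesis unfolding q_def[symmetric] using mult_right_cancel by blast
  qed
  \<comment> \<open>\<open>u\<close> removes from the derivative of the speed the part due to
    \<open>H\<close>. What remains carries the factor \<open>dd v G\<close>, which vanishes at
    \<open>p\<close>, so it can be differentiated there without differentiating
    \<open>B'\<close>.\<close>
  define u where "u x = dd v f x * H x + \<alpha> * f x * dd v H x" for x
  have uS: "u x = - \<alpha> * f x * H x * (B' (G x) / B (G x)) * dd v G x" if "x \<in> S" for x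
  proof -
    define q where "q = B' (G x) / B (G x)"
    show ?thesis using first[OF that] unfolding u_def q_def[symmetric] by algebra
  qed
  have sm': "smooth_on S (dd v f)" "smooth_on S (dd v H)" "smooth_on S (dd v G)"
    using sm S(1) smooth_on_dd by blast+
  have smu: "smooth_on S u" unfolding u_def by (intro smooth_intros sm sm')
  have "((\<lambda>r. u (p + r *\<^sub>R v)) has_real_derivative (- \<alpha> * f p * H p * (B' (G p) / B (G p))) * dd v (dd v G) p) (at 0)"
  proof -
    define c where "c r = - \<alpha> * f (p + r *\<^sub>R v) * H (p + r *\<^sub>R v) * (B' (G (p + r *\<^sub>R v)) / B (G (p + r *\<^sub>R v)))" for r
    have ci: "isCont (\<lambda>r. k (p + r *\<^sub>R v)) 0" if "smooth_on S k" for k :: "'a \<Rightarrow> real"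
      using line[OF that S(2)] DERIV_isCont by blast
    have B'c: "isCont (\<lambda>r. B' (G (p + r *\<^sub>R v))) 0"
      using isCont_o2[OF ci[OF sm(3)], of B'] B(2) by simp
    have Bc: "isCont (\<lambda>r. B (G (p + r *\<^sub>R v))) 0"
      using isCont_o2[OF ci[OF sm(3)], of B] DERIV_isCont[OF B(1)[OF S(2)]] by simp
    have "isCont c 0" unfolding c_def[abs_def]
      using pos[OF S(2)] by (intro continuous_intros ci sm B'c Bc) auto
    from DERIV_mult_zero[OF line[OF sm'(3) S(2)] _ this] crit
    have d1: "((\<lambda>r. c r * dd v G (p + r *\<^sub>R v)) has_real_derivative c 0 * dd v (dd v G) p) (at 0)" by simp
    have ev: "\<forall>\<^sub>F r in nhds 0. c r * dd v G (p + r *\<^sub>R v) = u (p + r *\<^sub>R v)"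
      using eventually_line_in_open[OF S, of v]
      by eventually_elim (simp only: c_def uS)
    from iffD1[OF DERIV_cong_ev[OF refl ev refl] d1] show ?thesis by (simp add: c_def)
  qed
  then have 1: "dd v u p = - \<alpha> * f p * H p * (B' (G p) / B (G p)) * dd v (dd v G) p"
    using line[OF smu S(2)] DERIV_unique by blast
  note bm = bounded_bilinear_mult
  have sm'': "smooth_on S (\<lambda>x. \<alpha> * f x)" "smooth_on S (\<lambda>x. dd v f x * H x)"
    "smooth_on S (\<lambda>x. \<alpha> * f x * dd v H x)"
    by (intro smooth_intros sm sm')+
  have 2: "dd v u p = dd v f p * dd v H p + dd v (dd v f) p * H p
      + \<alpha> * f p * dd v (dd v H) p + \<alpha> * dd v f p * dd v H p"
    unfolding u_def[abs_def]
    using S sm sm' sm''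
    by (simp add: dd_add[of S] dd_bilinear[OF bm, of S] dd_const smooth_on_const)
  have 3: "dd v f p * H p = - \<alpha> * f p * dd v H p" using first[OF S(2)] crit by simp
  define q where "q = B' (G p) / B (G p)"
  have "dd v (dd v f) p * (H p)\<^sup>2 = (dd v (dd v f) p * H p) * H p" by (simp add: power2_eq_square)
  also have "dd v (dd v f) p * H p = - \<alpha> * f p * H p * q * dd v (dd v G) p - (1 + \<alpha>) * dd v f p * dd v H p
      - \<alpha> * f p * dd v (dd v H) p"
    using 1 2 unfolding q_def[symmetric] by algebra
  also have "\<dots> * H p = - \<alpha> * f p * (H p)\<^sup>2 * q * dd v (dd v G) p - (1 + \<alpha>) * (dd v f p * H p) * dd v H p
      - \<alpha> * f p * H p * dd v (dd v H) p"
    by algebra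
  finally show ?thesis unfolding 3 q_def[symmetric] by algebra
qed

section \<open>Derivatives of \<open>H\<close>, \<open>K\<close> and \<open>G\<close> at a
  point\<close>

lemma dd_minus:
  fixes f :: "'a::euclidean_space \<Rightarrow> 'b::real_normed_vector"
  assumes "open S" "x \<in> S" "smooth_on S f"
  shows "dd v (\<lambda>x. - f x) x = - dd v f x"
  by (rule dd_eq, intro has_derivative_minus smooth_on_has_derivative[where S = S] assms)

lemma dd_diff:
  assumes "open S" "x \<in> S" "smooth_on S f" "smooth_on S g"
  shows "dd v (\<lambda>x. f x - g x) x = dd v f x - dd v g x"
  by (rule dd_eq, intro has_derivative_diff smooth_on_has_derivative[where S = S] assms)

lemma dd_dd_minus:
  fixes f :: "'a::euclidean_space \<Rightarrow> 'b::real_normed_vector"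
  assumes "open S" "x \<in> S" "smooth_on S f"
  shows "dd w (dd v (\<lambda>x. - f x)) x = - dd w (dd v f) x"
  by (rule trans[OF dd_cong[OF assms(1,2) dd_minus[OF assms(1) _ assms(3)]] dd_minus[OF assms(1,2) smooth_on_dd[OF assms(3,1)]]])

lemma dd_dd_diff:
  assumes "open S" "x \<in> S" "smooth_on S f" "smooth_on S g"
  shows "dd w (dd v (\<lambda>x. f x - g x)) x = dd w (dd v f) x - dd w (dd v g) x"
  by (rule trans[OF dd_cong[OF assms(1,2) dd_diff[OF assms(1) _ assms(3,4)]] dd_diff[OF assms(1,2) smooth_on_dd[OF assms(3,1)] smooth_on_dd[OF assms(4,1)]]])

lemma dd_dd_add:
  assumes "open S" "x \<in> S" "smooth_on S f" "smooth_on S g"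
  shows "dd w (dd v (\<lambda>x. f x + g x)) x = dd w (dd v f) x + dd w (dd v g) x"
  by (rule trans[OF dd_cong[OF assms(1,2) dd_add[OF assms(1) _ assms(3,4)]] dd_add[OF assms(1,2) smooth_on_dd[OF assms(3,1)] smooth_on_dd[OF assms(4,1)]]])

lemma dd_dd_cong:
  assumes "open S" "x \<in> S" "\<And>y. y \<in> S \<Longrightarrow> f y = g y"
  shows "dd w (dd v f) x = dd w (dd v g) x"
  by (intro dd_cong[OF assms(1,2)] dd_cong[OF assms(1)] assms(3))

lemmas dd_mult = dd_bilinear[OF bounded_bilinear_mult]
lemmas dd_dd_mult = dd_dd_bilinear[OF bounded_bilinear_mult]

text \<open>
  \<open>H\<close>, \<open>K\<close> and \<open>G\<close> are the mean curvature, the Gauss--Kronecker curvature and the pinching quantity;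
  with denominators cleared, their defining relations can be differentiated by the product rule.
\<close>

locale curvature_functions =
  fixes S :: "'a::euclidean_space set" and p :: 'a
    and g11 g12 g22 h11 h12 h22 H K G :: "'a \<Rightarrow> real" and l1 l2 :: real
  assumes S: "open S" "p \<in> S"
    and sm: "smooth_on S g11" "smooth_on S g12" "smooth_on S g22"
      "smooth_on S h11" "smooth_on S h12" "smooth_on S h22"
      "smooth_on S H" "smooth_on S K" "smooth_on S G"
    and H: "\<And>x. x \<in> S \<Longrightarrow> H x * (g11 x * g22 x - g12 x * g12 x)
        = g22 x * h11 x - 2 * (g12 x * h12 x) + g11 x * h22 x"
    and K: "\<And>x. x \<in> S \<Longrightarrow> K x * (g11 x * g22 x - g12 x * g12 x) = h11 x * h22 x - h12 x * h12 x"
    and G: "\<And>x. x \<in> S \<Longrightarrow> (1 - G x) * (H x * H x) = 4 * K x"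
    and at_p: "g11 p = 1" "g12 p = 0" "g22 p = 1" "h11 p = l1" "h12 p = 0" "h22 p = l2"
begin

lemma HKG_at_p: "H p = l1 + l2" "K p = l1 * l2" "(1 - G p) * (l1 + l2)\<^sup>2 = 4 * (l1 * l2)"
  using H[OF S(2)] K[OF S(2)] G[OF S(2)] by (simp_all add: at_p power2_eq_square)

lemmas sms = sm smooth_on_mult smooth_on_add smooth_on_diff smooth_on_const

text \<open>Derivatives of the metric are kept because the same formulas are used in the direction
  of time, where they do not vanish. Those of \<open>g12\<close> and \<open>h12\<close> drop out:
  both functions vanish at \<open>p\<close> and enter quadratically.\<close>

lemma first_derivatives:
  "dd v H p + (l1 + l2) * (dd v g11 p + dd v g22 p)
    = dd v h11 p + dd v h22 p + l1 * dd v g22 p + l2 * dd v g11 p"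
  "dd v K p + l1 * l2 * (dd v g11 p + dd v g22 p) = l1 * dd v h22 p + l2 * dd v h11 p"
  "(1 - G p) * (2 * (l1 + l2) * dd v H p) - dd v G p * (l1 + l2)\<^sup>2 = 4 * dd v K p"
proof -
  have "dd v (\<lambda>x. H x * (g11 x * g22 x - g12 x * g12 x)) p = dd v (\<lambda>x. g22 x * h11 x - 2 * (g12 x * h12 x) + g11 x * h22 x) p"
    by (rule dd_cong[OF S]) (rule H)
  note H' = this[simplified dd_mult[OF S] dd_diff[OF S] dd_add[OF S] sms at_p HKG_at_p dd_const]
  have "dd v (\<lambda>x. K x * (g11 x * g22 x - g12 x * g12 x)) p = dd v (\<lambda>x. h11 x * h22 x - h12 x * h12 x) p"
    by (rule dd_cong[OF S]) (rule K)
  note K' = this[simplified dd_mult[OF S] dd_diff[OF S] dd_add[OF S] sms at_p HKG_at_p dd_const]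
  have "dd v (\<lambda>x. (1 - G x) * (H x * H x)) p = dd v (\<lambda>x. 4 * K x) p"
    by (rule dd_cong[OF S]) (rule G)
  note G' = this[simplified dd_mult[OF S] dd_diff[OF S] dd_add[OF S] sms at_p HKG_at_p dd_const]
  show "dd v H p + (l1 + l2) * (dd v g11 p + dd v g22 p)
    = dd v h11 p + dd v h22 p + l1 * dd v g22 p + l2 * dd v g11 p"
    using H' by (simp add: algebra_simps power2_eq_square)
  show "dd v K p + l1 * l2 * (dd v g11 p + dd v g22 p) = l1 * dd v h22 p + l2 * dd v h11 p"
    using K' by (simp add: algebra_simps power2_eq_square)
  show "(1 - G p) * (2 * (l1 + l2) * dd v H p) - dd v G p * (l1 + l2)\<^sup>2 = 4 * dd v K p"
    using G' by algebra
qed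

text \<open>When the coordinates are normal at \<open>p\<close>, the combination
  \<open>dd v (dd v h11) p - l1 * dd v (dd v g11) p\<close> is a covariant second derivative of the
  second fundamental form: the metric is parallel, so its second derivatives account for the first
  derivatives of the Christoffel symbols.\<close>

lemma second_derivatives:
  assumes "dd v g11 p = 0" "dd v g12 p = 0" "dd v g22 p = 0"
  shows "dd v (dd v H) p = (dd v (dd v h11) p - l1 * dd v (dd v g11) p)
      + (dd v (dd v h22) p - l2 * dd v (dd v g22) p)"
    and "dd v (dd v K) p = l2 * (dd v (dd v h11) p - l1 * dd v (dd v g11) p)
      + l1 * (dd v (dd v h22) p - l2 * dd v (dd v g22) p)
      + 2 * dd v h11 p * dd v h22 p - 2 * (dd v h12 p)\<^sup>2"
    and "(1 - G p) * (2 * (dd v H p)\<^sup>2 + 2 * (l1 + l2) * dd v (dd v H) p)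
      - 4 * (l1 + l2) * dd v G p * dd v H p - dd v (dd v G) p * (l1 + l2)\<^sup>2 = 4 * dd v (dd v K) p"
proof -
  have "dd v (dd v (\<lambda>x. H x * (g11 x * g22 x - g12 x * g12 x))) p = dd v (dd v (\<lambda>x. g22 x * h11 x - 2 * (g12 x * h12 x) + g11 x * h22 x)) p"
    by (rule dd_dd_cong[OF S]) (rule H)
  note H'' = this[simplified dd_mult[OF S] dd_diff[OF S] dd_add[OF S] dd_dd_mult[OF S]
    dd_dd_diff[OF S] dd_dd_add[OF S] sms at_p HKG_at_p dd_const assms]
  have "dd v (dd v (\<lambda>x. K x * (g11 x * g22 x - g12 x * g12 x))) p = dd v (dd v (\<lambda>x. h11 x * h22 x - h12 x * h12 x)) p"
    by (rule dd_dd_cong[OF S]) (rule K)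
  note K'' = this[simplified dd_mult[OF S] dd_diff[OF S] dd_add[OF S] dd_dd_mult[OF S]
    dd_dd_diff[OF S] dd_dd_add[OF S] sms at_p HKG_at_p dd_const assms]
  have "dd v (dd v (\<lambda>x. (1 - G x) * (H x * H x))) p = dd v (dd v (\<lambda>x. 4 * K x)) p"
    by (rule dd_dd_cong[OF S]) (rule G)
  note G'' = this[simplified dd_mult[OF S] dd_diff[OF S] dd_add[OF S] dd_dd_mult[OF S]
    dd_dd_diff[OF S] dd_dd_add[OF S] sms at_p HKG_at_p dd_const assms]
  show "dd v (dd v H) p = (dd v (dd v h11) p - l1 * dd v (dd v g11) p)
      + (dd v (dd v h22) p - l2 * dd v (dd v g22) p)"
    using H'' by (simp add: algebra_simps power2_eq_square)
  show "dd v (dd v K) p = l2 * (dd v (dd v h11) p - l1 * dd v (dd v g11) p)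
      + l1 * (dd v (dd v h22) p - l2 * dd v (dd v g22) p)
      + 2 * dd v h11 p * dd v h22 p - 2 * (dd v h12 p)\<^sup>2"
    using K'' by (simp add: algebra_simps power2_eq_square)
  show "(1 - G p) * (2 * (dd v H p)\<^sup>2 + 2 * (l1 + l2) * dd v (dd v H) p)
      - 4 * (l1 + l2) * dd v G p * dd v H p - dd v (dd v G) p * (l1 + l2)\<^sup>2 = 4 * dd v (dd v K) p"
    using G'' by algebra
qed

end

section \<open>Moving surfaces in a chart\<close>

lemma bounded_bilinear_bform: "bounded_bilinear (bform \<kappa>)"
proof
  have "norm (bform \<kappa> p q) \<le> norm p * norm q * (\<bar>\<kappa>\<bar> + 1)" for p q
  proof -
    have "\<bar>fst p * fst q\<bar> \<le> norm p * norm q"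
      unfolding abs_mult using norm_fst_le[of "fst p" "snd p"] norm_fst_le[of "fst q" "snd q"] by (intro mult_mono) auto
    then have "\<bar>\<kappa>\<bar> * \<bar>fst p * fst q\<bar> \<le> \<bar>\<kappa>\<bar> * (norm p * norm q)" by (rule mult_left_mono) simp
    moreover have "\<bar>snd p \<bullet> snd q\<bar> \<le> norm (snd p) * norm (snd q)" by (rule Cauchy_Schwarz_ineq2)
    moreover have "norm (snd p) * norm (snd q) \<le> norm p * norm q"
      using norm_snd_le[of "snd p" "fst p"] norm_snd_le[of "snd q" "fst q"] by (intro mult_mono) auto
    moreover have "norm (bform \<kappa> p q) \<le> \<bar>\<kappa>\<bar> * \<bar>fst p * fst q\<bar> + \<bar>snd p \<bullet> snd q\<bar>"
      unfolding bform_def real_norm_def using abs_triangle_ineq[of "\<kappa> * (fst p * fst q)" "snd p \<bullet> snd q"]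
      by (simp add: abs_mult mult.assoc)
    ultimately show ?thesis by (simp add: algebra_simps)
  qed
  then show "\<exists>K. \<forall>p q. norm (bform \<kappa> p q) \<le> norm p * norm q * K" by blast
qed (simp_all add: bform_def inner_add_left inner_add_right algebra_simps)

lemma bform_sym: "bform \<kappa> p q = bform \<kappa> q p"
  by (simp add: bform_def inner_commute mult.commute mult.left_commute)

lemmas bform_simps =
  bounded_bilinear.add_left[OF bounded_bilinear_bform]
  bounded_bilinear.add_right[OF bounded_bilinear_bform]
  bounded_bilinear.diff_left[OF bounded_bilinear_bform]
  bounded_bilinear.diff_right[OF bounded_bilinear_bform]
  bounded_bilinear.minus_left[OF bounded_bilinear_bform]
  bounded_bilinear.minus_right[OF bounded_bilinear_bform]
  bounded_bilinear.scaleR_left[OF bounded_bilinear_bform]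
  bounded_bilinear.scaleR_right[OF bounded_bilinear_bform]
  bounded_bilinear.zero_left[OF bounded_bilinear_bform]
  bounded_bilinear.zero_right[OF bounded_bilinear_bform]

text \<open>
  For \<open>\<kappa> = 0\<close> the form is degenerate; there the position vector \<open>z\<close> is replaced by \<open>(1, 0)\<close> and
  the first coordinate of \<open>w\<close> has to be controlled separately.
\<close>

lemma bform_frame_eq_0:
  assumes \<kappa>: "\<kappa> \<in> {0, 1, -1}" and z: "\<kappa> * bform \<kappa> z z = \<kappa>\<^sup>2"
    and unit: "bform \<kappa> n n = 1" "bform \<kappa> u u = 1" "bform \<kappa> v v = 1"
    and perp: "bform \<kappa> n u = 0" "bform \<kappa> n v = 0" "bform \<kappa> u v = 0"
      "\<kappa> * bform \<kappa> n z = 0" "\<kappa> * bform \<kappa> u z = 0" "\<kappa> * bform \<kappa> v z = 0"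
    and fst0: "\<kappa> = 0 \<Longrightarrow> fst n = 0" "\<kappa> = 0 \<Longrightarrow> fst u = 0" "\<kappa> = 0 \<Longrightarrow> fst v = 0" "\<kappa> = 0 \<Longrightarrow> fst w = 0"
    and w: "bform \<kappa> w n = 0" "bform \<kappa> w u = 0" "bform \<kappa> w v = 0" "\<kappa> * bform \<kappa> w z = 0"
  shows "w = 0"
proof -
  define c where "c = (if \<kappa> = 0 then 1 else \<kappa>)"
  define z' where "z' = (if \<kappa> = 0 then (1, 0) else z)"
  define C where "C = bform c"
  have c: "c * c = 1" using \<kappa> by (auto simp: c_def)
  have zz: "C z' z' = c" using \<kappa> z by (auto simp: C_def c_def z'_def bform_def)
  have C0: "C x z' = 0" if "\<kappa> * bform \<kappa> x z = 0" "\<kappa> = 0 \<Longrightarrow> fst x = 0" for x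
    using that by (auto simp: C_def c_def z'_def bform_def)
  have C1: "C x y = bform \<kappa> x y" if "\<kappa> = 0 \<Longrightarrow> fst x = 0" for x y
    using that by (auto simp: C_def c_def bform_def)
  have Cs: "C x y = C y x" for x y by (simp add: C_def bform_sym)
  interpret C: bounded_bilinear C unfolding C_def by (rule bounded_bilinear_bform)
  \<comment> \<open>Pairing with the four frame vectors is a linear map of a four-dimensional space
    to itself. Orthonormality yields explicit preimages, so it is onto and therefore
    injective.\<close>
  define \<phi> :: "ambient \<Rightarrow> ambient" where "\<phi> y = (C y z', vector [C y n, C y u, C y v])" for y
  have Cn: "C n y = bform \<kappa> n y" and Cu: "C u y = bform \<kappa> u y" and Cv: "C v y = bform \<kappa> v y"
    and Cw: "C w y = bform \<kappa> w y" for y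
    by (rule C1, fact fst0)+
  have z0: "C n z' = 0" "C u z' = 0" "C v z' = 0" "C w z' = 0"
    by (rule C0, fact+)+
  then have vals: "C n z' = 0" "C u z' = 0" "C v z' = 0" "C z' n = 0" "C z' u = 0" "C z' v = 0"
    "C n n = 1" "C u u = 1" "C v v = 1" "C n u = 0" "C n v = 0" "C u v = 0" "C u n = 0" "C v n = 0" "C v u = 0"
    unfolding Cs[of z'] Cs[of u n] Cs[of v n] Cs[of v u]
    by (simp_all only: Cn Cu Cv unit perp(1-3))
  have lin: "linear \<phi>"
    by (intro linearI) (simp_all add: \<phi>_def C.add_left C.scaleR_left vec_eq_iff forall_3 vector_3)
  have sur: "surj \<phi>"
  proof (rule surjI)
    fix y :: ambient
    obtain a b where y: "y = (a, b)" by fastforce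
    have "b = vector [b $ 1, b $ 2, b $ 3]" by (simp add: vec_eq_iff forall_3 vector_3)
    then show "\<phi> ((c * fst y) *\<^sub>R z' + (snd y $ 1) *\<^sub>R n + (snd y $ 2) *\<^sub>R u + (snd y $ 3) *\<^sub>R v) = y"
      unfolding \<phi>_def y using c
      by (simp add: C.add_left C.scaleR_left zz vals mult.assoc[symmetric])
  qed
  have "\<phi> w = \<phi> 0"
    by (simp add: \<phi>_def C.zero_left z0 Cw[of n] Cw[of u] Cw[of v] w)
  then show ?thesis
    using linear_surjective_imp_injective[OF lin sur] injD by metis
qed

text \<open>
  \<open>e1\<close>, \<open>e2\<close> are the spatial coordinate directions and \<open>e0\<close> is the time direction. The time
  interval is not separated from the space parameters, so that all derivatives are directional
  derivatives on one open set.
\<close>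

locale moving_chart =
  fixes \<kappa> :: real and S :: "'a::euclidean_space set" and Z N :: "'a \<Rightarrow> ambient"
    and f :: "'a \<Rightarrow> real" and e0 e1 e2 :: 'a
  assumes \<kappa>: "\<kappa> \<in> {0, 1, -1}"
    and S: "open S"
    and smooth: "smooth_on S Z" "smooth_on S N" "smooth_on S f"
    and Z: "\<And>x. x \<in> S \<Longrightarrow> Z x \<in> space_form \<kappa>"
    and N: "\<And>x. x \<in> S \<Longrightarrow> N x \<in> tangent_at \<kappa> (Z x)" "\<And>x. x \<in> S \<Longrightarrow> bform \<kappa> (N x) (N x) = 1"
    and perp: "\<And>x. x \<in> S \<Longrightarrow> bform \<kappa> (dd e1 Z x) (N x) = 0"
      "\<And>x. x \<in> S \<Longrightarrow> bform \<kappa> (dd e2 Z x) (N x) = 0"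
    and flow: "\<And>x. x \<in> S \<Longrightarrow> dd e0 Z x = f x *\<^sub>R N x"
begin

abbreviation B where "B \<equiv> bform \<kappa>"

lemmas sd = smooth smooth_on_dd[OF smooth(1) S] smooth_on_dd[OF smooth(2) S] smooth_on_dd[OF smooth(3) S]
  smooth_on_dd[OF smooth_on_dd[OF smooth(1) S] S] smooth_on_dd[OF smooth_on_dd[OF smooth(2) S] S]
  smooth_on_dd[OF smooth_on_dd[OF smooth(3) S] S]
  smooth_on_dd[OF smooth_on_dd[OF smooth_on_dd[OF smooth(1) S] S] S]

lemmas smooth_on_B = smooth_on_bilinear[OF bounded_bilinear_bform[of \<kappa>]]
lemmas dd_B = dd_bilinear[OF bounded_bilinear_bform[of \<kappa>] S]
lemmas dd_dd_B = dd_dd_bilinear[OF bounded_bilinear_bform[of \<kappa>] S]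

lemma B_const:
  assumes "smooth_on S u" "smooth_on S v" "\<And>x. x \<in> S \<Longrightarrow> B (u x) (v x) = c" "x \<in> S"
  shows "B (u x) (dd w v x) + B (dd w u x) (v x) = 0"
proof -
  have "dd w (\<lambda>x. B (u x) (v x)) x = dd w (\<lambda>x. c) x"
    by (rule dd_cong[OF S assms(4)]) (rule assms(3))
  then show ?thesis using dd_B[OF assms(4,1,2), of w] by (simp add: dd_const)
qed

text \<open>Relations with the position vector are geometric only for \<kappa> = 1 and \<kappa> =
  -1. The factor \<kappa> lets them be carried through all cases uniformly, as they become trivial
  for \<kappa> = 0.\<close>

lemma kB_const:
  assumes "smooth_on S u" "smooth_on S v" "\<And>x. x \<in> S \<Longrightarrow> \<kappa> * B (u x) (v x) = c" "x \<in> S"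
  shows "\<kappa> * B (u x) (dd w v x) + \<kappa> * B (dd w u x) (v x) = 0"
proof (cases "\<kappa> = 0")
  case False
  have "B (u x) (v x) = c / \<kappa>" if "x \<in> S" for x using assms(3)[OF that] False by (simp add: field_simps)
  from B_const[OF assms(1,2) this assms(4)] show ?thesis by (simp flip: distrib_left)
qed simp

lemma fst_dd:
  assumes "smooth_on S (u :: 'a \<Rightarrow> ambient)" "\<And>x. x \<in> S \<Longrightarrow> fst (u x) = c" "x \<in> S"
  shows "fst (dd w u x) = 0"
proof -
  have "((\<lambda>x. fst (u x)) has_derivative (\<lambda>w. fst (dd w u x))) (at x)"
    by (rule bounded_linear.has_derivative[OF bounded_linear_fst smooth_on_has_derivative[OF assms(1) S assms(3)]])
  then have "fst (dd w u x) = dd w (\<lambda>x. fst (u x)) x" by (rule dd_eq[symmetric])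
  also have "\<dots> = dd w (\<lambda>x. c) x" by (rule dd_cong[OF S assms(3,2)])
  finally show ?thesis by (simp add: dd_const)
qed

lemma fst_Z: "x \<in> S \<Longrightarrow> \<kappa> = 0 \<Longrightarrow> fst (Z x) = 1"
  using Z[of x] by (auto simp: space_form_def power2_eq_1_iff)

lemma fst_N: "x \<in> S \<Longrightarrow> \<kappa> = 0 \<Longrightarrow> fst (N x) = 0"
  using N(1)[of x] fst_Z[of x] by (simp add: tangent_at_def)

lemma fst_dd_Z: "x \<in> S \<Longrightarrow> \<kappa> = 0 \<Longrightarrow> fst (dd w Z x) = 0"
  by (rule fst_dd[OF smooth(1) fst_Z])

lemma fst_dd_dd_Z: "x \<in> S \<Longrightarrow> \<kappa> = 0 \<Longrightarrow> fst (dd v (dd w Z) x) = 0"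
  by (rule fst_dd[OF sd(4) fst_dd_Z])

lemma fst_dd_N: "x \<in> S \<Longrightarrow> \<kappa> = 0 \<Longrightarrow> fst (dd w N x) = 0"
  by (rule fst_dd[OF smooth(2) fst_N])

lemma kB_Z_Z: "x \<in> S \<Longrightarrow> \<kappa> * B (Z x) (Z x) = \<kappa>\<^sup>2"
  using Z[of x] \<kappa> by (auto simp: space_form_def bform_def power2_eq_square split: prod.splits)

lemma kB_N_Z: "x \<in> S \<Longrightarrow> \<kappa> * B (N x) (Z x) = 0"
  using N(1)[of x] \<kappa> by (auto simp: tangent_at_def bform_def inner_commute algebra_simps)

lemma kB_Z_dd_Z: "x \<in> S \<Longrightarrow> \<kappa> * B (dd w Z x) (Z x) = 0"
  using kB_const[OF smooth(1,1) kB_Z_Z, where w = w, of x] by (simp add: bform_sym)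

lemma B_N_dd_N: "x \<in> S \<Longrightarrow> B (N x) (dd w N x) = 0"
  using B_const[OF smooth(2,2) N(2), where w = w, of x] by (simp add: bform_sym)

lemma B_dd_dd_Z_N:
  assumes "x \<in> S" "v \<in> {e1, e2}"
  shows "B (dd v Z x) (dd w N x) = - B (dd w (dd v Z) x) (N x)"
  using B_const[OF sd(4) smooth(2) _ assms(1), of v 0 w] perp assms by (auto simp: eq_neg_iff_add_eq_0)

lemma B_syms:
  "B (Z x) (N x) = B (N x) (Z x)" "B (Z x) (dd w Z x) = B (dd w Z x) (Z x)"
  "B (N x) (dd w Z x) = B (dd w Z x) (N x)" "B (N x) (dd v (dd w Z) x) = B (dd v (dd w Z) x) (N x)"
  "B (dd w N x) (N x) = B (N x) (dd w N x)" "B (dd w N x) (dd v Z x) = B (dd v Z x) (dd w N x)"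
  by (simp_all only: bform_sym)

lemma dd_Z_commute: "x \<in> S \<Longrightarrow> dd v (dd w Z) x = dd w (dd v Z) x"
  by (rule dd_commute[OF smooth(1) S])

end

text \<open>The coordinates are normal at \<open>p\<close>: the condition \<open>normal\<close> says that the Christoffel symbols vanish there.\<close>

locale normal_moving_chart = moving_chart \<kappa> S Z N f e0 e1 e2
  for \<kappa> and S :: "'a::euclidean_space set" and Z N f e0 e1 e2 +
  fixes p :: 'a and l1 l2 :: real
  assumes p: "p \<in> S"
    and frame: "bform \<kappa> (dd e1 Z p) (dd e1 Z p) = 1" "bform \<kappa> (dd e1 Z p) (dd e2 Z p) = 0"
      "bform \<kappa> (dd e2 Z p) (dd e2 Z p) = 1"
    and normal: "\<And>u v w. u \<in> {e1, e2} \<Longrightarrow> v \<in> {e1, e2} \<Longrightarrow> w \<in> {e1, e2} \<Longrightarrow>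
      bform \<kappa> (dd u (dd v Z) p) (dd w Z p) = 0"
    and principal: "bform \<kappa> (dd e1 (dd e1 Z) p) (N p) = - l1" "bform \<kappa> (dd e1 (dd e2 Z) p) (N p) = 0"
      "bform \<kappa> (dd e2 (dd e2 Z) p) (N p) = - l2"
begin

lemma eq_0:
  assumes "\<kappa> = 0 \<Longrightarrow> fst w = 0" "B w (N p) = 0" "B w (dd e1 Z p) = 0" "B w (dd e2 Z p) = 0"
    "\<kappa> * B w (Z p) = 0"
  shows "w = 0"
  by (rule bform_frame_eq_0[OF \<kappa> kB_Z_Z[OF p] N(2)[OF p] frame(1,3)])
    (use assms frame perp[OF p] kB_N_Z[OF p] kB_Z_dd_Z[OF p] fst_N[OF p] fst_dd_Z[OF p] in
      \<open>auto simp: B_syms\<close>)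

text \<open>The Gauss formula: the tangential part vanishes since the coordinates are normal, the
  normal part is the second fundamental form, and differentiating the orthogonality of
  \<open>dd v Z\<close> and \<open>Z\<close> gives the component along the position vector.\<close>

lemma Z_ij: "dd e1 (dd e1 Z) p = - l1 *\<^sub>R N p - \<kappa> *\<^sub>R Z p"
  "dd e1 (dd e2 Z) p = 0" "dd e2 (dd e1 Z) p = 0"
  "dd e2 (dd e2 Z) p = - l2 *\<^sub>R N p - \<kappa> *\<^sub>R Z p"
proof -
  have kk: "\<kappa> * (\<kappa> * B (Z p) (Z p)) = \<kappa>" using kB_Z_Z[OF p] \<kappa> by auto
  have Z2: "\<kappa> * B (dd u (dd v Z) p) (Z p) = - \<kappa> * B (dd v Z p) (dd u Z p)" for u v
    using kB_const[OF sd(4) smooth(1) kB_Z_dd_Z p, of v u] by simp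
  have gen: "dd u (dd v Z) p = l *\<^sub>R N p - (\<kappa> * B (dd v Z p) (dd u Z p)) *\<^sub>R Z p"
    if "u \<in> {e1, e2}" "v \<in> {e1, e2}" "B (dd u (dd v Z) p) (N p) = l" for u v l
  proof -
    have "dd u (dd v Z) p - l *\<^sub>R N p + (\<kappa> * B (dd v Z p) (dd u Z p)) *\<^sub>R Z p = 0"
    proof (rule eq_0)
      show "fst (dd u (dd v Z) p - l *\<^sub>R N p + (\<kappa> * B (dd v Z p) (dd u Z p)) *\<^sub>R Z p) = 0" if "\<kappa> = 0"
        using that by (simp add: fst_dd_dd_Z[OF p] fst_N[OF p])
      show "B (dd u (dd v Z) p - l *\<^sub>R N p + (\<kappa> * B (dd v Z p) (dd u Z p)) *\<^sub>R Z p) (N p) = 0"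
        using that kB_N_Z[OF p] by (auto simp: bform_simps N(2)[OF p] B_syms mult.assoc)
      show "B (dd u (dd v Z) p - l *\<^sub>R N p + (\<kappa> * B (dd v Z p) (dd u Z p)) *\<^sub>R Z p) (dd e1 Z p) = 0"
        using that kB_Z_dd_Z[OF p, of e1] perp(1)[OF p]
        by (auto simp: bform_simps normal B_syms)
      show "B (dd u (dd v Z) p - l *\<^sub>R N p + (\<kappa> * B (dd v Z p) (dd u Z p)) *\<^sub>R Z p) (dd e2 Z p) = 0"
        using that kB_Z_dd_Z[OF p, of e2] perp(2)[OF p]
        by (auto simp: bform_simps normal B_syms)
      have "\<kappa> * ((\<kappa> * B (dd v Z p) (dd u Z p)) * B (Z p) (Z p)) = (\<kappa> * (\<kappa> * B (Z p) (Z p))) * B (dd v Z p) (dd u Z p)"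
        by simp
      also have "\<dots> = \<kappa> * B (dd v Z p) (dd u Z p)" unfolding kk ..
      finally have "\<kappa> * ((\<kappa> * B (dd v Z p) (dd u Z p)) * B (Z p) (Z p)) = \<kappa> * B (dd v Z p) (dd u Z p)" .
      then show "\<kappa> * B (dd u (dd v Z) p - l *\<^sub>R N p + (\<kappa> * B (dd v Z p) (dd u Z p)) *\<^sub>R Z p) (Z p) = 0"
        unfolding bform_simps distrib_left right_diff_distrib using Z2[of u v] kB_N_Z[OF p] by auto
    qed
    then show ?thesis by (simp add: algebra_simps)
  qed
  show "dd e1 (dd e1 Z) p = - l1 *\<^sub>R N p - \<kappa> *\<^sub>R Z p" "dd e1 (dd e2 Z) p = 0"
    "dd e2 (dd e2 Z) p = - l2 *\<^sub>R N p - \<kappa> *\<^sub>R Z p"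
    using gen[OF _ _ principal(1)] gen[OF _ _ principal(2)] gen[OF _ _ principal(3)] frame
    by (simp_all add: bform_sym)
  then show "dd e2 (dd e1 Z) p = 0" using dd_Z_commute[OF p] by simp
qed

text \<open>The Weingarten equations: the coordinate directions are principal at \<open>p\<close>,
  and unit length and tangency of \<open>N\<close> exclude components along \<open>N p\<close> and
  the position vector.\<close>

lemma N_i: "dd e1 N p = l1 *\<^sub>R dd e1 Z p" "dd e2 N p = l2 *\<^sub>R dd e2 Z p"
proof -
  have gen: "dd u N p = l *\<^sub>R dd u Z p"
    if "u \<in> {e1, e2}" "- B (dd u (dd e1 Z) p) (N p) = l * B (dd u Z p) (dd e1 Z p)"
      "- B (dd u (dd e2 Z) p) (N p) = l * B (dd u Z p) (dd e2 Z p)" for u l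
  proof -
    have "dd u N p - l *\<^sub>R dd u Z p = 0"
    proof (rule eq_0)
      show "fst (dd u N p - l *\<^sub>R dd u Z p) = 0" if "\<kappa> = 0"
        using that by (simp add: fst_dd_Z[OF p] fst_dd_N[OF p])
      show "B (dd u N p - l *\<^sub>R dd u Z p) (N p) = 0"
        using that(1) perp[OF p] B_N_dd_N[OF p] by (auto simp: bform_simps B_syms)
      show "B (dd u N p - l *\<^sub>R dd u Z p) (dd e1 Z p) = 0"
        using that(2) B_dd_dd_Z_N[OF p, of e1 u] by (simp add: bform_simps B_syms)
      show "B (dd u N p - l *\<^sub>R dd u Z p) (dd e2 Z p) = 0"
        using that(3) B_dd_dd_Z_N[OF p, of e2 u] by (simp add: bform_simps B_syms)
      have "\<kappa> * B (dd u N p) (Z p) = - \<kappa> * B (N p) (dd u Z p)"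
        using kB_const[OF smooth(2,1) kB_N_Z p, of u] by simp
      then show "\<kappa> * B (dd u N p - l *\<^sub>R dd u Z p) (Z p) = 0"
        using that(1) perp[OF p] kB_Z_dd_Z[OF p, of u] by (auto simp: bform_simps right_diff_distrib B_syms)
    qed
    then show ?thesis by simp
  qed
  show "dd e1 N p = l1 *\<^sub>R dd e1 Z p" "dd e2 N p = l2 *\<^sub>R dd e2 Z p"
    by (rule gen; simp add: principal dd_Z_commute[OF p, of e2 e1] frame bform_sym[of _ "dd e2 Z p" "dd e1 Z p"])+
qed

end

lemma dd_dd_dd_commute:
  fixes u :: "'a::euclidean_space \<Rightarrow> 'b::euclidean_space"
  assumes "smooth_on S u" "open S" "x \<in> S"
  shows "dd b (dd a (dd a u)) x = dd a (dd a (dd b u)) x"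
proof -
  have "dd b (dd a (dd a u)) x = dd a (dd b (dd a u)) x"
    by (rule dd_commute[OF smooth_on_dd[OF assms(1,2)] assms(2,3)])
  also have "\<dots> = dd a (dd a (dd b u)) x"
    by (rule dd_cong[OF assms(2,3)]) (rule dd_commute[OF assms(1,2)])
  finally show ?thesis .
qed

section \<open>Structure and evolution equations at the centre of normal coordinates\<close>

context normal_moving_chart
begin

definition g where "g v w x = B (dd v Z x) (dd w Z x)"
definition h where "h v w x = - B (dd v (dd w Z) x) (N x)"

lemma smooth_g: "smooth_on S (g v w)" and smooth_h: "smooth_on S (h v w)"
  unfolding g_def[abs_def] h_def[abs_def]
  by (rule smooth_on_B[OF sd(4,4)], rule smooth_on_minus[OF smooth_on_B[OF sd(7) smooth(2)]])

lemma g_at_p: "g e1 e1 p = 1" "g e1 e2 p = 0" "g e2 e2 p = 1"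
  and h_at_p: "h e1 e1 p = l1" "h e1 e2 p = 0" "h e2 e2 p = l2"
  by (simp_all add: g_def h_def frame principal)

lemma dd_g:
  assumes "u \<in> {e1, e2}" "v \<in> {e1, e2}" "w \<in> {e1, e2}"
  shows "dd u (g v w) p = 0"
  unfolding g_def[abs_def] dd_B[OF p sd(4,4)]
  using normal[OF assms(1,2,3)] normal[OF assms(1,3,2)] by (simp add: bform_sym)

lemma dd_h: "dd u (h v w) p = - B (dd v (dd w Z) p) (dd u N p) - B (dd u (dd v (dd w Z)) p) (N p)"
  unfolding h_def[abs_def] dd_minus[OF S p smooth_on_B[OF sd(7) smooth(2)]] dd_B[OF p sd(7) smooth(2)]
  by simp

text \<open>Third derivatives of \<open>Z\<close> commute. The other terms pair second derivatives
  of \<open>Z\<close>, which have no tangential part at \<open>p\<close>, with the tangent vectors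
  \<open>dd u N p\<close>.\<close>

lemma codazzi: "dd e1 (h e1 e2) p = dd e2 (h e1 e1) p" "dd e2 (h e1 e2) p = dd e1 (h e2 e2) p"
proof -
  have "dd e2 (dd e1 (dd e1 Z)) p = dd e1 (dd e1 (dd e2 Z)) p"
    by (rule dd_dd_dd_commute[OF smooth(1) S p])
  then show "dd e1 (h e1 e2) p = dd e2 (h e1 e1) p"
    using perp[OF p] kB_Z_dd_Z[OF p, of e2] frame(2)
    by (simp add: dd_h Z_ij N_i bform_simps B_syms)
  have "dd e1 (dd e2 (dd e2 Z)) p = dd e2 (dd e1 (dd e2 Z)) p"
    by (rule dd_commute[OF sd(4) S p])
  then show "dd e2 (h e1 e2) p = dd e1 (h e2 e2) p"
    using perp[OF p] kB_Z_dd_Z[OF p, of e1] frame(2)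
    by (simp add: dd_h Z_ij N_i bform_simps B_syms)
qed

lemma B_N_dd_dd_N: "B (N p) (dd w (dd w N) p) = - B (dd w N p) (dd w N p)"
  using B_const[OF smooth(2) sd(5) B_N_dd_N p, of w w] by simp

lemma kB_dd_N_Z: "x \<in> S \<Longrightarrow> \<kappa> * B (dd w N x) (Z x) = - \<kappa> * B (dd w Z x) (N x)"
  using kB_const[OF smooth(2,1) kB_N_Z, where w = w, of x] by (simp add: B_syms)

lemma kB_dd_dd_N_Z:
  assumes "w \<in> {e1, e2}"
  shows "\<kappa> * B (Z p) (dd w (dd w N) p) = - \<kappa> * B (dd w Z p) (dd w N p)"
proof -
  have "\<kappa> * B (dd w N x) (Z x) = 0" if "x \<in> S" for x
    using kB_dd_N_Z[OF that, of w] perp[OF that] assms by auto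
  from kB_const[OF sd(5) smooth(1) this p, of w] show ?thesis
    by (simp add: bform_sym)
qed

text \<open>Only the normal and the position component of \<open>dd u (dd u Z) p\<close> count;
  their pairings with the second derivative of \<open>N\<close> come from differentiating the unit
  length of \<open>N\<close> and its orthogonality to \<open>Z\<close> twice.\<close>

lemma Z_ii_dd_dd_N:
  assumes "(u, l, v, m) = (e1, l1, e2, l2) \<or> (u, l, v, m) = (e2, l2, e1, l1)"
  shows "B (dd u (dd u Z) p) (dd v (dd v N) p) = l * m\<^sup>2 + \<kappa> * m"
proof -
  have v: "v \<in> {e1, e2}" "dd v N p = m *\<^sub>R dd v Z p" "B (dd v Z p) (dd v Z p) = 1"
    and u: "dd u (dd u Z) p = - l *\<^sub>R N p - \<kappa> *\<^sub>R Z p"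
    using assms N_i frame Z_ij by auto
  show ?thesis
    using kB_dd_dd_N_Z[OF v(1)]
    by (simp add: u bform_simps B_N_dd_dd_N v(2,3) power2_eq_square)
qed

text \<open>The fourth derivatives of \<open>Z\<close> agree in both orders, and the metric terms
  cancel all third derivatives. What remains is the difference of the two pairings of
  \<open>dd u (dd u Z) p\<close> with \<open>dd v (dd v N) p\<close>.\<close>

lemma gauss:
  "(dd e2 (dd e2 (h e1 e1)) p - l1 * dd e2 (dd e2 (g e1 e1)) p)
    - (dd e1 (dd e1 (h e2 e2)) p - l2 * dd e1 (dd e1 (g e2 e2)) p) = (l1 - l2) * (l1 * l2 + \<kappa>)"
proof -
  have hh: "dd v (dd v (h u u)) p = - (B (dd u (dd u Z) p) (dd v (dd v N) p)
      + 2 * B (dd v (dd u (dd u Z)) p) (dd v N p) + B (dd v (dd v (dd u (dd u Z))) p) (N p))" for u v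
    unfolding h_def[abs_def] dd_dd_minus[OF S p smooth_on_B[OF sd(7) smooth(2)]]
      dd_dd_B[OF p sd(7) smooth(2)] by simp
  have gg: "dd v (dd v (g u u)) p = 2 * B (dd v (dd v (dd u Z)) p) (dd u Z p)"
    if "dd v (dd u Z) p = 0" for u v
    unfolding g_def[abs_def] dd_dd_B[OF p sd(4,4)] that
    by (simp add: bform_simps bform_sym[of \<kappa> "dd u Z p"])
  have c3: "dd e2 (dd e1 (dd e1 Z)) p = dd e1 (dd e1 (dd e2 Z)) p"
    "dd e1 (dd e2 (dd e2 Z)) p = dd e2 (dd e2 (dd e1 Z)) p"
    by (rule dd_dd_dd_commute[OF smooth(1) S p])+
  have c4: "dd e2 (dd e2 (dd e1 (dd e1 Z))) p = dd e1 (dd e1 (dd e2 (dd e2 Z))) p"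
  proof -
    have "dd e2 (dd e2 (dd e1 (dd e1 Z))) p = dd e2 (dd e1 (dd e1 (dd e2 Z))) p"
      by (rule dd_cong[OF S p]) (rule dd_dd_dd_commute[OF smooth(1) S])
    also have "\<dots> = dd e1 (dd e1 (dd e2 (dd e2 Z))) p"
      by (rule dd_dd_dd_commute[OF sd(4) S p])
    finally show ?thesis .
  qed
  have Zi: "B (dd e1 (dd e1 Z) p) (dd e2 (dd e2 N) p) = l1 * l2\<^sup>2 + \<kappa> * l2"
    "B (dd e2 (dd e2 Z) p) (dd e1 (dd e1 N) p) = l2 * l1\<^sup>2 + \<kappa> * l1"
    by (rule Z_ii_dd_dd_N; simp)+
  show ?thesis
    unfolding hh gg[OF Z_ij(2)] gg[OF Z_ij(3)] c4 c3 Zi N_i bform_simps real_scaleR_def by algebra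
qed

lemma dd_e0_g:
  assumes "(u, l) = (e1, l1) \<or> (u, l) = (e2, l2)"
  shows "dd e0 (g u u) p = 2 * f p * l"
proof -
  have "dd e0 (dd u Z) p = dd u (dd e0 Z) p" by (rule dd_commute[OF smooth(1) S p])
  also have "\<dots> = dd u (\<lambda>x. f x *\<^sub>R N x) p" by (rule dd_cong[OF S p]) (rule flow)
  also have "\<dots> = f p *\<^sub>R dd u N p + dd u f p *\<^sub>R N p"
    by (rule dd_bilinear[OF bounded_bilinear_scaleR S p smooth(3,2)])
  finally have e: "dd e0 (dd u Z) p = f p *\<^sub>R dd u N p + dd u f p *\<^sub>R N p" .
  have u: "dd u N p = l *\<^sub>R dd u Z p" "B (dd u Z p) (dd u Z p) = 1" "B (dd u Z p) (N p) = 0"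
    using assms N_i frame perp[OF p] by auto
  show ?thesis
    unfolding g_def[abs_def] dd_B[OF p sd(4,4)] e bform_simps
    by (simp add: u bform_simps B_syms)
qed

text \<open>Time and space derivatives commute, so the flow equation is differentiated twice in
  space. The term with \<kappa> comes from the position component of \<open>dd u (dd u Z) p\<close>
  paired with \<open>dd e0 N p\<close>.\<close>

lemma dd_e0_h:
  assumes "(u, l) = (e1, l1) \<or> (u, l) = (e2, l2)"
  shows "dd e0 (h u u) p = - dd u (dd u f) p + f p * l\<^sup>2 - \<kappa> * f p"
proof -
  have "dd e0 (dd u (dd u Z)) p = dd u (dd u (dd e0 Z)) p"
    by (rule dd_dd_dd_commute[OF smooth(1) S p])
  also have "\<dots> = dd u (dd u (\<lambda>x. f x *\<^sub>R N x)) p" by (rule dd_dd_cong[OF S p]) (rule flow)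
  also have "\<dots> = f p *\<^sub>R dd u (dd u N) p + dd u f p *\<^sub>R dd u N p + dd u f p *\<^sub>R dd u N p
      + dd u (dd u f) p *\<^sub>R N p"
    by (rule dd_dd_bilinear[OF bounded_bilinear_scaleR S p smooth(3,2)])
  finally have e: "dd e0 (dd u (dd u Z)) p = \<dots>" .
  have u: "dd u N p = l *\<^sub>R dd u Z p" "B (dd u Z p) (dd u Z p) = 1" "B (dd u Z p) (N p) = 0"
    "dd u (dd u Z) p = - l *\<^sub>R N p - \<kappa> *\<^sub>R Z p"
    using assms N_i frame perp[OF p] Z_ij by auto
  have 1: "B (dd e0 (dd u (dd u Z)) p) (N p) = - f p * l\<^sup>2 + dd u (dd u f) p"
    unfolding e bform_simps using B_N_dd_dd_N[of u] B_N_dd_N[OF p, of u] N(2)[OF p] u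
    by (simp add: bform_simps B_syms bform_sym[of \<kappa> "dd u (dd u N) p"] power2_eq_square)
  have 2: "\<kappa> * B (Z p) (dd e0 N p) = - \<kappa> * f p"
    using kB_dd_N_Z[OF p, of e0] N(2)[OF p] by (simp add: flow[OF p] bform_simps bform_sym[of \<kappa> "Z p"])
  have "B (dd u (dd u Z) p) (dd e0 N p) = \<kappa> * f p"
    using 2 by (simp add: u bform_simps B_N_dd_N[OF p])
  then show ?thesis unfolding dd_h 1 by simp
qed

text \<open>The curvature function enters through \<open>b\<close>, which stands for F / H as a
  function of \<open>G\<close>, and through the two ellipticity inequalities. What remains is to
  translate the geometry into the quantities of \<open>pinching_algebra\<close>.\<close>

theorem dd_e0_pinching_le_0:
  assumes sm: "smooth_on S H" "smooth_on S K" "smooth_on S G"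
    and H: "\<And>x. x \<in> S \<Longrightarrow> H x * (g e1 e1 x * g e2 e2 x - g e1 e2 x * g e1 e2 x)
        = g e2 e2 x * h e1 e1 x - 2 * (g e1 e2 x * h e1 e2 x) + g e1 e1 x * h e2 e2 x"
    and K: "\<And>x. x \<in> S \<Longrightarrow> K x * (g e1 e1 x * g e2 e2 x - g e1 e2 x * g e1 e2 x)
        = h e1 e1 x * h e2 e2 x - h e1 e2 x * h e1 e2 x"
    and G: "\<And>x. x \<in> S \<Longrightarrow> (1 - G x) * (H x * H x) = 4 * K x"
    and l: "l1 > l2" "l2 > 0" and \<alpha>: "0 < \<alpha>" "\<alpha> \<le> 1" "(1 - \<alpha>) * \<kappa> \<le> (1 + \<alpha>) * (l1 * l2)"
    and pos: "\<And>x. x \<in> S \<Longrightarrow> H x > 0 \<and> b (G x) > 0"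
    and b: "\<And>x. x \<in> S \<Longrightarrow> (b has_real_derivative b' (G x)) (at (G x))" "isCont b' (G p)"
    and f: "\<And>x. x \<in> S \<Longrightarrow> f x = (H x * b (G x)) powr (- \<alpha>)"
    and ell: "0 \<le> (l1 + l2)\<^sup>2 + 4 * (l1 - l2) * (b' (G p) / b (G p)) * l2"
      "0 \<le> (l1 + l2)\<^sup>2 - 4 * (l1 - l2) * (b' (G p) / b (G p)) * l1"
    and max: "dd e1 G p = 0" "dd e2 G p = 0" "dd e1 (dd e1 G) p \<le> 0" "dd e2 (dd e2 G) p \<le> 0"
  shows "dd e0 G p \<le> 0"
proof -
  interpret c: curvature_functions S p "g e1 e1" "g e1 e2" "g e2 e2" "h e1 e1" "h e1 e2" "h e2 e2" H K G l1 l2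
    by unfold_locales (use S p smooth_g smooth_h sm H K G g_at_p h_at_p in auto)
  have fpos: "f p > 0" using f[OF p] pos[OF p] by simp
  have Gp: "1 - G p = 4 * (l1 * l2) / (l1 + l2)\<^sup>2"
    using c.HKG_at_p(3) l by (simp add: field_simps)
  define a1 where "a1 = dd e1 (dd e1 (h e1 e1)) p - l1 * dd e1 (dd e1 (g e1 e1)) p"
  define a2 where "a2 = dd e1 (dd e1 (h e2 e2)) p - l2 * dd e1 (dd e1 (g e2 e2)) p"
  define a3 where "a3 = dd e2 (dd e2 (h e1 e1)) p - l1 * dd e2 (dd e2 (g e1 e1)) p"
  define a4 where "a4 = dd e2 (dd e2 (h e2 e2)) p - l2 * dd e2 (dd e2 (g e2 e2)) p"
  have dg: "dd e1 (g e1 e1) p = 0" "dd e1 (g e1 e2) p = 0" "dd e1 (g e2 e2) p = 0"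
    "dd e2 (g e1 e1) p = 0" "dd e2 (g e1 e2) p = 0" "dd e2 (g e2 e2) p = 0"
    by (rule dd_g; simp)+
  note fst1 = c.first_derivatives[of e1, unfolded dg max] note fst2 = c.first_derivatives[of e2, unfolded dg max]
  note fst0 = c.first_derivatives[of e0, unfolded dd_e0_g[of e1 l1, simplified] dd_e0_g[of e2 l2, simplified]
      dd_e0_h[of e1 l1, simplified] dd_e0_h[of e2 l2, simplified]]
  note snd1 = c.second_derivatives[OF dg(1-3), folded a1_def a2_def, unfolded max codazzi]
  note snd2 = c.second_derivatives[OF dg(4-6), folded a3_def a4_def, unfolded max codazzi]
  define x1 where "x1 = dd e1 (h e1 e1) p" define y1 where "y1 = dd e1 (h e2 e2) p"
  define x2 where "x2 = dd e2 (h e1 e1) p" define y2 where "y2 = dd e2 (h e2 e2) p"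
  note fs = x1_def[symmetric] x2_def[symmetric] y1_def[symmetric] y2_def[symmetric]
  have Hn: "l1 + l2 \<noteq> 0" using l by simp
  have H1: "dd e1 H p = x1 + y1" "dd e2 H p = x2 + y2" using fst1(1) fst2(1) unfolding fs by simp_all
  \<comment> \<open>Eliminating \<open>G p\<close> from the critical point equation leaves the
    common factor \<open>l1 - l2\<close>, which is not zero away from umbilic points.\<close>
  have crit: "l2 * x = l1 * y"
    if "(1 - G p) * (2 * (l1 + l2) * (x + y)) = 4 * (l1 * y + l2 * x)" for x y
  proof -
    have "(1 - G p) * (l1 + l2)\<^sup>2 * (2 * (x + y)) = 4 * (l1 * y + l2 * x) * (l1 + l2)"
      using that by algebra
    then have "(l1 - l2) * (l2 * x) = (l1 - l2) * (l1 * y)" unfolding c.HKG_at_p(3) by algebra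
    then show ?thesis using l by simp
  qed
  have c1: "l2 * x1 = l1 * y1" and c2: "l2 * x2 = l1 * y2"
    using fst1(2,3) fst2(2,3) unfolding H1 fs by (auto intro!: crit)
  have Gii: "g2 * (l1 + l2) ^ 4 = 8 * (l1 * l2) * (s\<^sup>2 + (l1 + l2) * h2) - 4 * k2 * (l1 + l2)\<^sup>2"
    if "(1 - G p) * (2 * s\<^sup>2 + 2 * (l1 + l2) * h2) - 4 * (l1 + l2) * 0 * s - g2 * (l1 + l2)\<^sup>2 = 4 * k2"
    for g2 s h2 k2
    using that c.HKG_at_p(3) by algebra
  have fii: "dd v (dd v f) p * (H p)\<^sup>2 = \<alpha> * f p * ((\<alpha> + 1) * (dd v H p)\<^sup>2
      - H p * dd v (dd v H) p - b' (G p) / b (G p) * dd v (dd v G) p * (H p)\<^sup>2)" if "dd v G p = 0" for v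
    by (rule dd_dd_speed[OF S p smooth(3) sm(1,3) pos b f that])
  have "dd e0 G p * (l1 + l2) ^ 3 = 8 * (l1 * l2) *
      ((- dd e1 (dd e1 f) p - f p * l1\<^sup>2 - \<kappa> * f p) + (- dd e2 (dd e2 f) p - f p * l2\<^sup>2 - \<kappa> * f p))
      - 4 * (l1 * (- dd e2 (dd e2 f) p - f p * l2\<^sup>2 - \<kappa> * f p)
        + l2 * (- dd e1 (dd e1 f) p - f p * l1\<^sup>2 - \<kappa> * f p)) * (l1 + l2)"
  proof -
    have "(l1 + l2) * (dd e0 G p * (l1 + l2)\<^sup>2) = (1 - G p) * (l1 + l2)\<^sup>2 * (2 * dd e0 H p) - 4 * dd e0 K p * (l1 + l2)"
      using fst0(3) by algebra
    then show ?thesis unfolding c.HKG_at_p(3) using fst0(1,2) by algebra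
  qed
  from pinching_algebra[OF l refl refl fpos \<alpha> c1 c2 gauss[folded a2_def a3_def] snd1(2)[unfolded fs] snd2(2)[unfolded fs]
      Gii[OF snd1(3), unfolded H1 snd1(1)] Gii[OF snd2(3), unfolded H1 snd2(1)]
      fii[OF max(1), unfolded c.HKG_at_p H1 snd1(1)] fii[OF max(2), unfolded c.HKG_at_p H1 snd2(1)] refl refl this ell max(3,4)]
  show ?thesis .
qed

end

section \<open>Change of coordinates and the second derivative test\<close>

lemma smooth_on_Pair [smooth_intros]:
  assumes "smooth_on S f" "smooth_on S g"
  shows "smooth_on S (\<lambda>x. (f x, g x))"
proof -
  have "Ck_on k S f \<Longrightarrow> Ck_on k S g \<Longrightarrow> Ck_on k S (\<lambda>x. (f x, g x))" for k
  proof (induction k arbitrary: f g)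
    case 0
    then show ?case by (simp add: continuous_on_Pair)
  next
    case (Suc k)
    then obtain f' g' where
      "\<forall>x\<in>S. (f has_derivative f' x) (at x within S)" "\<forall>v. Ck_on k S (\<lambda>x. f' x v)"
      "\<forall>x\<in>S. (g has_derivative g' x) (at x within S)" "\<forall>v. Ck_on k S (\<lambda>x. g' x v)"
      by auto
    with Suc.IH show ?case
      unfolding Ck_on.simps
      by (intro exI[of _ "\<lambda>x v. (f' x v, g' x v)"]) (simp add: has_derivative_Pair)
  qed
  with assms show ?thesis by (simp add: smooth_on_def)
qed

lemma dd_compose:
  fixes \<sigma> :: "'a::euclidean_space \<Rightarrow> 'b::euclidean_space"
  assumes "open S" "open T" "smooth_on T W" "smooth_on S \<sigma>" "\<sigma> ` S \<subseteq> T" "x \<in> S"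
  shows "dd v (\<lambda>x. W (\<sigma> x)) x = dd (dd v \<sigma> x) W (\<sigma> x)"
proof (rule dd_eq)
  show "((\<lambda>x. W (\<sigma> x)) has_derivative (\<lambda>v. dd (dd v \<sigma> x) W (\<sigma> x))) (at x)"
    using assms by (intro has_derivative_compose[OF smooth_on_has_derivative[of S] smooth_on_has_derivative[of T]]) auto
qed

lemma linear_basis_expansion:
  fixes f :: "'a::euclidean_space \<Rightarrow> 'b::real_vector"
  assumes "linear f"
  shows "f h = (\<Sum>b\<in>Basis. (h \<bullet> b) *\<^sub>R f b)"
proof -
  have "f h = f (\<Sum>b\<in>Basis. (h \<bullet> b) *\<^sub>R b)" by (simp add: euclidean_representation)
  also have "\<dots> = (\<Sum>b\<in>Basis. f ((h \<bullet> b) *\<^sub>R b))" by (rule linear_sum[OF assms])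
  finally show ?thesis by (simp add: linear_cmul[OF assms])
qed

text \<open>The direction \<open>dd w \<sigma> y\<close> varies with \<open>y\<close>, so it is
  expanded in the basis before differentiating. The last summand is the lever by which a quadratic
  change of coordinates alters second derivatives.\<close>

lemma dd_dd_compose:
  fixes \<sigma> :: "'a::euclidean_space \<Rightarrow> 'b::euclidean_space" and W :: "'b \<Rightarrow> 'c::euclidean_space"
  assumes S: "open S" and T: "open T" "smooth_on T W" and \<sigma>: "smooth_on S \<sigma>" "\<sigma> ` S \<subseteq> T" and x: "x \<in> S"
  shows "dd v (dd w (\<lambda>x. W (\<sigma> x))) x
    = dd (dd v \<sigma> x) (dd (dd w \<sigma> x) W) (\<sigma> x) + dd (dd v (dd w \<sigma>) x) W (\<sigma> x)"
proof -
  have Tx: "\<sigma> y \<in> T" if "y \<in> S" for y using \<sigma>(2) that by blast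
  have lin: "dd h W z = (\<Sum>b\<in>Basis. (h \<bullet> b) *\<^sub>R dd b W z)" if "z \<in> T" for h z
    by (rule linear_basis_expansion[OF linear_dd[OF T(2,1) that]])
  have sW: "smooth_on S (\<lambda>y. dd b W (\<sigma> y))" for b
    by (rule smooth_on_compose[OF smooth_on_dd[OF T(2,1)] \<sigma>])
  have s\<sigma>: "smooth_on S (\<lambda>y. dd w \<sigma> y \<bullet> b)" for b
    by (rule smooth_on_bilinear[OF bounded_bilinear_inner smooth_on_dd[OF \<sigma>(1) S] smooth_on_const])
  have ds: "dd v (\<lambda>y. dd w \<sigma> y \<bullet> b) x = dd v (dd w \<sigma>) x \<bullet> b" for b
    using dd_bilinear[OF bounded_bilinear_inner S x smooth_on_dd[OF \<sigma>(1) S] smooth_on_const, of v w b]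
    by (simp add: dd_const)
  have sum: "dd v (\<lambda>y. \<Sum>b\<in>I. u b y) x = (\<Sum>b\<in>I. dd v (u b) x)"
    if "finite I" "\<And>b. b \<in> I \<Longrightarrow> smooth_on S (u b)" for I and u :: "'b \<Rightarrow> 'a \<Rightarrow> 'c"
    by (rule dd_eq, rule has_derivative_sum, rule smooth_on_has_derivative[OF _ S x]) (rule that)
  have "dd v (dd w (\<lambda>x. W (\<sigma> x))) x = dd v (\<lambda>y. \<Sum>b\<in>Basis. (dd w \<sigma> y \<bullet> b) *\<^sub>R dd b W (\<sigma> y)) x"
    using lin[OF Tx] by (intro dd_cong[OF S x]) (simp add: dd_compose[OF S T \<sigma>])
  also have "\<dots> = (\<Sum>b\<in>Basis. dd v (\<lambda>y. (dd w \<sigma> y \<bullet> b) *\<^sub>R dd b W (\<sigma> y)) x)"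
    by (rule sum[OF finite_Basis smooth_on_scaleR[OF s\<sigma> sW]])
  also have "\<dots> = (\<Sum>b\<in>Basis. (dd w \<sigma> x \<bullet> b) *\<^sub>R dd (dd v \<sigma> x) (dd b W) (\<sigma> x)
      + (dd v (dd w \<sigma>) x \<bullet> b) *\<^sub>R dd b W (\<sigma> x))"
    by (rule sum.cong[OF refl])
      (simp add: dd_bilinear[OF bounded_bilinear_scaleR S x s\<sigma> sW] ds
        dd_compose[OF S T(1) smooth_on_dd[OF T(2,1)] \<sigma> x])
  also have "\<dots> = (\<Sum>b\<in>Basis. (dd w \<sigma> x \<bullet> b) *\<^sub>R dd (dd v \<sigma> x) (dd b W) (\<sigma> x))
      + dd (dd v (dd w \<sigma>) x) W (\<sigma> x)"
    by (simp add: sum.distrib lin[OF Tx[OF x], symmetric])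
  also have "(\<Sum>b\<in>Basis. (dd w \<sigma> x \<bullet> b) *\<^sub>R dd (dd v \<sigma> x) (dd b W) (\<sigma> x))
      = dd (dd v \<sigma> x) (dd (dd w \<sigma> x) W) (\<sigma> x)"
  proof -
    have c: "dd (dd v \<sigma> x) (dd h W) (\<sigma> x) = dd h (dd (dd v \<sigma> x) W) (\<sigma> x)" for h
      by (rule dd_commute[OF T(2,1) Tx[OF x]])
    show ?thesis
      unfolding c
      by (rule linear_basis_expansion[OF linear_dd[OF smooth_on_dd[OF T(2,1)] T(1) Tx[OF x]], symmetric])
  qed
  finally show ?thesis .
qed

text \<open>A positive second derivative would make the first derivative positive just after the
  critical point, and by the mean value theorem the function would rise above its maximum.\<close>

lemma second_derivative_at_local_max:
  fixes G :: "'a::euclidean_space \<Rightarrow> real"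
  assumes "smooth_on S G" "open S" "p \<in> S" and max: "\<forall>\<^sub>F r in nhds 0. G (p + r *\<^sub>R v) \<le> G p"
  shows "dd v G p = 0" "dd v (dd v G) p \<le> 0"
proof -
  have line: "((\<lambda>r. k (p + r *\<^sub>R v)) has_real_derivative dd v k (p + r *\<^sub>R v)) (at r)"
    if "smooth_on S k" "p + r *\<^sub>R v \<in> S" for k r
    using has_derivative_along_line[OF that(1) assms(2) that(2)]
    by (simp add: has_real_derivative_iff_has_vector_derivative)
  obtain d1 where d1: "d1 > 0" "\<And>r. \<bar>r\<bar> < d1 \<Longrightarrow> G (p + r *\<^sub>R v) \<le> G p"
    using max by (auto simp: eventually_nhds_metric dist_real_def)
  have d0: "((\<lambda>r. G (p + r *\<^sub>R v)) has_real_derivative dd v G p) (at 0)"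
    using line[OF assms(1), of 0] assms(3) by simp
  show z: "dd v G p = 0"
    by (rule DERIV_local_max[OF d0 d1(1)]) (use d1(2) in auto)
  obtain d2 where d2: "d2 > 0" "\<And>r. \<bar>r\<bar> < d2 \<Longrightarrow> p + r *\<^sub>R v \<in> S"
    using eventually_line_in_open[OF assms(2,3), of v] by (auto simp: eventually_nhds_metric dist_real_def)
  show "dd v (dd v G) p \<le> 0"
  proof (rule ccontr)
    assume "\<not> ?thesis"
    then have pos: "dd v (dd v G) p > 0" by simp
    have "((\<lambda>r. dd v G (p + r *\<^sub>R v)) has_real_derivative dd v (dd v G) p) (at 0)"
      using line[OF smooth_on_dd[OF assms(1,2)], of 0] assms(3) by simp
    from DERIV_pos_inc_right[OF this pos] obtain d3 where
      d3: "d3 > 0" "\<And>h. h > 0 \<Longrightarrow> h < d3 \<Longrightarrow> dd v G (p + h *\<^sub>R v) > 0"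
      using z by auto
    define h where "h = min d1 (min d2 d3) / 2"
    have h: "h > 0" "h < d1" "h < d2" "h < d3" using d1(1) d2(1) d3(1) by (auto simp: h_def)
    have "\<exists>z>0. z < h \<and> G (p + h *\<^sub>R v) - G (p + 0 *\<^sub>R v) = (h - 0) * dd v G (p + z *\<^sub>R v)"
      by (rule MVT2[OF h(1)], rule line[OF assms(1)], rule d2(2)) (use h in auto)
    then obtain z where z: "z > 0" "z < h" "G (p + h *\<^sub>R v) - G p = h * dd v G (p + z *\<^sub>R v)" by auto
    have "h * dd v G (p + z *\<^sub>R v) > 0" using z(1,2) h d3(2)[of z] by simp
    moreover have "G (p + h *\<^sub>R v) \<le> G p" using d1(2)[of h] h by simp
    ultimately show False using z(3) by simp
  qed
qed

section \<open>The curvature function\<close>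

context
  fixes F :: "real \<times> real \<Rightarrow> real"
  assumes F: "curvature_function F"
begin

lemma open_Gamma_plus: "open Gamma_plus"
proof -
  have eq: "Gamma_plus = {0<..} \<times> {0<..}" by (auto simp: Gamma_plus_def)
  show ?thesis unfolding eq by (intro open_Times open_greaterThan)
qed

lemma smooth_F: "smooth_on Gamma_plus F"
  using F by (simp add: curvature_function_def)

lemma F_pos: "a > 0 \<Longrightarrow> b > 0 \<Longrightarrow> F (a, b) > 0"
  using F by (auto simp: curvature_function_def Gamma_plus_def)

lemma F_sym: "a > 0 \<Longrightarrow> b > 0 \<Longrightarrow> F (a, b) = F (b, a)"
  using F by (auto simp: curvature_function_def Gamma_plus_def)

lemma F_scale: "a > 0 \<Longrightarrow> b > 0 \<Longrightarrow> k > 0 \<Longrightarrow> F (k * a, k * b) = k * F (a, b)"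
  using F by (auto simp: curvature_function_def Gamma_plus_def)

lemma F_has_derivative:
  "a > 0 \<Longrightarrow> b > 0 \<Longrightarrow> (F has_derivative (\<lambda>v. dd v F (a, b))) (at (a, b))"
  using smooth_on_has_derivative[OF smooth_F open_Gamma_plus] by (simp add: Gamma_plus_def)

lemma F_curve:
  assumes "(x has_real_derivative x') (at s)" "(y has_real_derivative y') (at s)" "x s > 0" "y s > 0"
  shows "((\<lambda>s. F (x s, y s)) has_real_derivative
    x' * dd (1, 0) F (x s, y s) + y' * dd (0, 1) F (x s, y s)) (at s)"
proof -
  let ?D = "\<lambda>v. dd v F (x s, y s)"
  have lin: "linear ?D" using F_has_derivative[OF assms(3,4)] has_derivative_linear by blast
  have xy: "((\<lambda>s. (x s, y s)) has_derivative (\<lambda>h. (x' * h, y' * h))) (at s)"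
    using has_derivative_Pair assms(1,2)[unfolded has_field_derivative_def] .
  have "((\<lambda>s. F (x s, y s)) has_derivative (\<lambda>h. ?D (x' * h, y' * h))) (at s)"
    using has_derivative_compose[OF xy F_has_derivative[OF assms(3,4)]] .
  moreover have "?D (x' * h, y' * h) = (x' * ?D (1, 0) + y' * ?D (0, 1)) * h" for h
  proof -
    have "(x' * h, y' * h) = (x' * h) *\<^sub>R (1, 0) + (y' * h) *\<^sub>R (0, 1 :: real)" by simp
    then have "?D (x' * h, y' * h) = (x' * h) *\<^sub>R ?D (1, 0) + (y' * h) *\<^sub>R ?D (0, 1)"
      using linear_add[OF lin] linear_cmul[OF lin] by metis
    then show ?thesis by (simp add: algebra_simps)
  qed
  ultimately show ?thesis by (simp add: has_field_derivative_def mult_commute_abs)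
qed

lemma F_partials_pos:
  assumes "a > 0" "b > 0"
  shows "dd (1, 0) F (a, b) > 0" "dd (0, 1) F (a, b) > 0"
proof -
  have "deriv (\<lambda>s. F (s, b)) a = dd (1, 0) F (a, b)" "deriv (\<lambda>s. F (a, s)) b = dd (0, 1) F (a, b)"
    using F_curve[of "\<lambda>s. s" 1 a "\<lambda>_. b" 0] F_curve[of "\<lambda>_. a" 0 b "\<lambda>s. s" 1] assms
    by (auto intro!: DERIV_imp_deriv)
  moreover have "deriv (\<lambda>s. F (s, b)) a > 0" "deriv (\<lambda>s. F (a, s)) b > 0"
    using F assms by (auto simp: curvature_function_def Gamma_plus_def)
  ultimately show "dd (1, 0) F (a, b) > 0" "dd (0, 1) F (a, b) > 0" by simp_all
qed

lemma F_euler: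
  assumes "a > 0" "b > 0"
  shows "a * dd (1, 0) F (a, b) + b * dd (0, 1) F (a, b) = F (a, b)"
proof -
  have "((\<lambda>s. F (s * a, s * b)) has_real_derivative
      a * dd (1, 0) F (a, b) + b * dd (0, 1) F (a, b)) (at 1)"
  proof -
    have "((\<lambda>s. s * c) has_real_derivative c) (at 1)" for c :: real
      by (auto intro!: derivative_eq_intros)
    from F_curve[OF this this, of a b] assms show ?thesis by simp
  qed
  moreover have "\<forall>\<^sub>F s in nhds 1. F (s * a, s * b) = s * F (a, b)"
  proof -
    have "\<forall>\<^sub>F s in nhds (1::real). s \<in> {0<..}" by (rule eventually_nhds_in_open) auto
    then show ?thesis by eventually_elim (simp add: F_scale assms)
  qed
  ultimately have "((\<lambda>s. s * F (a, b)) has_real_derivative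
      a * dd (1, 0) F (a, b) + b * dd (0, 1) F (a, b)) (at 1)"
    by (subst (asm) DERIV_cong_ev[OF refl _ refl])
  moreover have "((\<lambda>s. s * F (a, b)) has_real_derivative F (a, b)) (at 1)"
    by (auto intro!: derivative_eq_intros)
  ultimately show ?thesis using DERIV_unique by blast
qed

text \<open>
  By homogeneity and symmetry \<open>F\<close> is the mean curvature times a function of the pinching
  quantity: the pair \<open>(1 \<plusminus> \<surd>s) / 2\<close> has sum 1 and pinching quantity \<open>s\<close>.
\<close>

definition profile :: "real \<Rightarrow> real" where
  "profile s = F ((1 + sqrt s) / 2, (1 - sqrt s) / 2)"

text \<open>By the chain rule: the two arguments of \<open>F\<close> have derivatives
  \<open>1 / (4 * sqrt s)\<close> and its negative. The formula is used for s > 0 only, that is,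
  away from umbilic points.\<close>

definition profile' :: "real \<Rightarrow> real" where
  "profile' s = (dd (1, 0) F ((1 + sqrt s) / 2, (1 - sqrt s) / 2)
    - dd (0, 1) F ((1 + sqrt s) / 2, (1 - sqrt s) / 2)) / (4 * sqrt s)"

lemma half_pos:
  fixes r :: real
  assumes "0 < r" "r < 1"
  shows "0 < (1 + r) / 2 \<and> 0 < (1 - r) / 2"
  using assms by simp

lemma profile_has_derivative:
  assumes "0 < s" "s < 1"
  shows "(profile has_real_derivative profile' s) (at s)"
proof -
  have s: "sqrt s < 1" "sqrt s > 0" using assms by auto
  have "((\<lambda>s. F ((1 + sqrt s) / 2, (1 - sqrt s) / 2)) has_real_derivative
     inverse (sqrt s) / 4 * dd (1, 0) F ((1 + sqrt s) / 2, (1 - sqrt s) / 2)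
     + (- inverse (sqrt s) / 4) * dd (0, 1) F ((1 + sqrt s) / 2, (1 - sqrt s) / 2)) (at s)"
  proof (rule F_curve)
    show "((\<lambda>s. (1 + sqrt s) / 2) has_real_derivative inverse (sqrt s) / 4) (at s)"
      "((\<lambda>s. (1 - sqrt s) / 2) has_real_derivative - inverse (sqrt s) / 4) (at s)"
      using assms by (auto intro!: derivative_eq_intros)
    show "(1 + sqrt s) / 2 > 0" "(1 - sqrt s) / 2 > 0" using half_pos[OF s(2,1)] by auto
  qed
  moreover have "profile = (\<lambda>s. F ((1 + sqrt s) / 2, (1 - sqrt s) / 2))" by (rule ext) (simp add: profile_def)
  ultimately show ?thesis using s by (simp add: profile'_def field_simps)
qed

lemma profile_pos:
  assumes "0 < s" "s < 1"
  shows "profile s > 0"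
proof -
  have s: "sqrt s < 1" "sqrt s > 0" using assms by auto
  show ?thesis unfolding profile_def using half_pos[OF s(2,1)] by (intro F_pos) auto
qed

lemma isCont_profile':
  assumes "0 < s" "s < 1"
  shows "isCont profile' s"
proof -
  have s: "sqrt s < 1" "sqrt s > 0" using assms by auto
  have in_G: "((1 + sqrt s) / 2, (1 - sqrt s) / 2) \<in> Gamma_plus"
    unfolding Gamma_plus_def using half_pos[OF s(2,1)] by auto
  have "isCont (\<lambda>s. ((1 + sqrt s) / 2, (1 - sqrt s) / 2)) s" by (intro continuous_intros) auto
  moreover have "isCont (dd v F) ((1 + sqrt s) / 2, (1 - sqrt s) / 2)" for v
    using smooth_on_imp_continuous_on[OF smooth_on_dd[OF smooth_F open_Gamma_plus]]
      continuous_on_eq_continuous_at[OF open_Gamma_plus] in_G by blast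
  ultimately have "isCont (\<lambda>s. dd v F ((1 + sqrt s) / 2, (1 - sqrt s) / 2)) s" for v
    by (rule isCont_o2)
  then show ?thesis unfolding profile'_def[abs_def] using s
    by (intro continuous_intros) auto
qed

lemma F_eq_profile:
  assumes "a > 0" "b > 0"
  shows "F (a, b) = (a + b) * profile ((a - b)\<^sup>2 / (a + b)\<^sup>2)"
proof -
  \<comment> \<open>For a \<ge> b the square root of the pinching quantity is
    \<open>(a - b) / (a + b)\<close>; symmetry of \<open>F\<close> gives the other order.\<close>
  have *: "F (a, b) = (a + b) * profile ((a - b)\<^sup>2 / (a + b)\<^sup>2)" if "a > 0" "b > 0" "a \<ge> b" for a b
  proof -
    have sq: "sqrt ((a - b)\<^sup>2 / (a + b)\<^sup>2) = (a - b) / (a + b)"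
      using that by (simp add: real_sqrt_divide)
    have "(1 + (a - b) / (a + b)) / 2 = inverse (a + b) * a" "(1 - (a - b) / (a + b)) / 2 = inverse (a + b) * b"
      using that by (simp_all add: field_simps)
    then have "profile ((a - b)\<^sup>2 / (a + b)\<^sup>2) = F (inverse (a + b) * a, inverse (a + b) * b)"
      by (simp only: profile_def sq)
    also have "\<dots> = inverse (a + b) * F (a, b)" using that by (intro F_scale) auto
    finally show ?thesis using that by (simp add: field_simps)
  qed
  show ?thesis
  proof (cases "a \<ge> b")
    case False
    then show ?thesis using *[of b a] assms F_sym[of a b] by (simp add: power2_commute add.commute)
  qed (rule *[OF assms])
qed

text \<open>Ellipticity of the flow at a non-umbilic point: the two terms are \<open>H\<^sup>2 F\<^sub>i / F\<close>.\<close>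

lemma profile_elliptic:
  assumes l: "l1 > l2" "l2 > 0" and G: "G = (l1 - l2)\<^sup>2 / (l1 + l2)\<^sup>2"
  shows "0 \<le> (l1 + l2)\<^sup>2 + 4 * (l1 - l2) * (profile' G / profile G) * l2"
    and "0 \<le> (l1 + l2)\<^sup>2 - 4 * (l1 - l2) * (profile' G / profile G) * l1"
proof -
  define H where "H = l1 + l2"
  have H: "H > 0" using l by (simp add: H_def)
  have sq: "sqrt G = (l1 - l2) / H" using l by (simp add: G H_def real_sqrt_divide)
  have e: "(1 + sqrt G) / 2 = l1 / H" "(1 - sqrt G) / 2 = l2 / H"
    using H unfolding sq by (auto simp: H_def field_simps)
  define F1 where "F1 = dd (1, 0) F (l1 / H, l2 / H)"
  define F2 where "F2 = dd (0, 1) F (l1 / H, l2 / H)"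
  have lp: "l1 / H > 0" "l2 / H > 0" using l H by auto
  have F12: "F1 > 0" "F2 > 0" unfolding F1_def F2_def using F_partials_pos[OF lp] by auto
  \<comment> \<open>Euler's relation expresses the profile through the partial derivatives, so that
    each of the two terms reduces to a multiple of a single partial derivative.\<close>
  have b: "profile G = (l1 * F1 + l2 * F2) / H"
    using F_euler[OF lp] unfolding profile_def e F1_def F2_def by (simp add: add_divide_distrib)
  have b': "profile' G = (F1 - F2) * H / (4 * (l1 - l2))"
  proof -
    have "profile' G = (F1 - F2) / (4 * sqrt G)" unfolding profile'_def e F1_def F2_def ..
    then show ?thesis unfolding sq using l H by simp
  qed
  define P where "P = l1 * F1 + l2 * F2"
  have P: "P > 0" using l F12 by (simp add: P_def add_pos_pos)
  have "4 * (l1 - l2) * (profile' G / profile G) = (F1 - F2) * H\<^sup>2 / P"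
    using l H P unfolding b b' P_def[symmetric] by (simp add: field_simps power2_eq_square)
  note q = this
  have "(l1 + l2)\<^sup>2 + 4 * (l1 - l2) * (profile' G / profile G) * l2 = H\<^sup>2 * (P + (F1 - F2) * l2) / P"
    "(l1 + l2)\<^sup>2 - 4 * (l1 - l2) * (profile' G / profile G) * l1 = H\<^sup>2 * (P - (F1 - F2) * l1) / P"
    unfolding q H_def[symmetric] using P by (simp_all add: field_simps)
  moreover have "P + (F1 - F2) * l2 = H * F1" "P - (F1 - F2) * l1 = H * F2"
    unfolding P_def H_def by algebra+
  ultimately show "0 \<le> (l1 + l2)\<^sup>2 + 4 * (l1 - l2) * (profile' G / profile G) * l2"
    "0 \<le> (l1 + l2)\<^sup>2 - 4 * (l1 - l2) * (profile' G / profile G) * l1"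
    using H F12 P by simp_all
qed

end

section \<open>The maximum principle in a chart\<close>

text \<open>
  Under a change of basis both sides of each relation are multiplied by the squared determinant.
\<close>

lemma bilinear_curvature_relations:
  fixes G A :: "real^2 \<Rightarrow> real^2 \<Rightarrow> real"
  assumes G: "bilinear G" "\<And>v w. G v w = G w v" and A: "bilinear A" "\<And>v w. A v w = A w v"
    and H: "H * (G (axis 1 1) (axis 1 1) * G (axis 2 1) (axis 2 1) - G (axis 1 1) (axis 2 1) * G (axis 1 1) (axis 2 1))
      = G (axis 2 1) (axis 2 1) * A (axis 1 1) (axis 1 1) - 2 * (G (axis 1 1) (axis 2 1) * A (axis 1 1) (axis 2 1))
        + G (axis 1 1) (axis 1 1) * A (axis 2 1) (axis 2 1)"
    and K: "K * (G (axis 1 1) (axis 1 1) * G (axis 2 1) (axis 2 1) - G (axis 1 1) (axis 2 1) * G (axis 1 1) (axis 2 1))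
      = A (axis 1 1) (axis 1 1) * A (axis 2 1) (axis 2 1) - A (axis 1 1) (axis 2 1) * A (axis 1 1) (axis 2 1)"
  shows "H * (G v v * G w w - G v w * G v w) = G w w * A v v - 2 * (G v w * A v w) + G v v * A w w"
    and "K * (G v v * G w w - G v w * G v w) = A v v * A w w - A v w * A v w"
proof -
  let ?a = "axis 1 1 :: real^2" and ?b = "axis 2 1 :: real^2"
  have exp: "C v w = v $ 1 * w $ 1 * C ?a ?a + (v $ 1 * w $ 2 + v $ 2 * w $ 1) * C ?a ?b + v $ 2 * w $ 2 * C ?b ?b"
    if "bilinear C" "\<And>v w. C v w = C w v" for C :: "real^2 \<Rightarrow> real^2 \<Rightarrow> real" and v w
  proof -
    have "v = v $ 1 *\<^sub>R ?a + v $ 2 *\<^sub>R ?b" for v :: "real^2"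
      by (simp add: vec_eq_iff forall_2 axis_def)
    then have "C v w = C (v $ 1 *\<^sub>R ?a + v $ 2 *\<^sub>R ?b) (w $ 1 *\<^sub>R ?a + w $ 2 *\<^sub>R ?b)" by metis
    then show ?thesis
      using that(2)[of ?b ?a]
      by (simp add: bilinear_ladd[OF that(1)] bilinear_radd[OF that(1)] bilinear_lmul[OF that(1)]
          bilinear_rmul[OF that(1)] algebra_simps)
  qed
  note e = exp[OF G, of v v] exp[OF G, of v w] exp[OF G, of w w] exp[OF A, of v v] exp[OF A, of v w] exp[OF A, of w w]
  define D where "D = (v $ 1 * w $ 2 - v $ 2 * w $ 1)\<^sup>2"
  let ?\<Delta> = "G ?a ?a * G ?b ?b - G ?a ?b * G ?a ?b"
  have d: "G v v * G w w - G v w * G v w = D * ?\<Delta>"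
    unfolding e D_def by algebra
  have "G w w * A v v - 2 * (G v w * A v w) + G v v * A w w
    = D * (G ?b ?b * A ?a ?a - 2 * (G ?a ?b * A ?a ?b) + G ?a ?a * A ?b ?b)"
    unfolding e D_def by algebra
  then show "H * (G v v * G w w - G v w * G v w) = G w w * A v v - 2 * (G v w * A v w) + G v v * A w w"
    unfolding d H[symmetric] by simp
  have "A v v * A w w - A v w * A v w = D * (A ?a ?a * A ?b ?b - A ?a ?b * A ?a ?b)"
    unfolding e D_def by algebra
  then show "K * (G v v * G w w - G v w * G v w) = A v v * A w w - A v w * A v w"
    unfolding d K[symmetric] by simp
qed

text \<open>The hypothesis on \<open>l\<close> says that the form \<open>A - l * G\<close> is
  degenerate; a vector in its kernel, normalised with respect to \<open>G\<close>, has the required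
  property.\<close>

lemma bilinear_eigenvector:
  fixes G A :: "real^2 \<Rightarrow> real^2 \<Rightarrow> real"
  assumes G: "bilinear G" "\<And>v w. G v w = G w v" "\<And>v. v \<noteq> 0 \<Longrightarrow> G v v > 0"
    and A: "bilinear A" "\<And>v w. A v w = A w v"
    and l: "(A (axis 1 1) (axis 1 1) - l * G (axis 1 1) (axis 1 1)) * (A (axis 2 1) (axis 2 1) - l * G (axis 2 1) (axis 2 1))
      = (A (axis 1 1) (axis 2 1) - l * G (axis 1 1) (axis 2 1))\<^sup>2"
  shows "\<exists>v. G v v = 1 \<and> (\<forall>w. A v w = l * G v w)"
proof -
  let ?a = "axis 1 1 :: real^2" and ?b = "axis 2 1 :: real^2"
  define M where "M v w = A v w - l * G v w" for v w
  have bM: "bilinear M"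
    using G(1) A(1) unfolding M_def bilinear_def linear_iff by (auto simp: algebra_simps)
  have sM: "M v w = M w v" for v w by (simp add: M_def G(2) A(2))
  have det: "M ?a ?a * M ?b ?b = (M ?a ?b)\<^sup>2" using l by (simp add: M_def)
  have "\<exists>v. v \<noteq> 0 \<and> M v ?a = 0 \<and> M v ?b = 0"
  proof (cases "M ?a ?a = 0")
    case True
    then have "M ?a ?b = 0" using det by simp
    with True show ?thesis by (intro exI[of _ ?a]) (simp add: sM axis_eq_0_iff)
  next
    case False
    \<comment> \<open>The first component of the kernel equation holds identically for this vector,
      the second by the determinant condition.\<close>
    let ?v = "M ?a ?b *\<^sub>R ?a - M ?a ?a *\<^sub>R ?b"
    have "?v $ 2 \<noteq> 0" using False by (simp add: axis_def)
    then have "?v \<noteq> 0" by (metis zero_index)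
    moreover have "M ?v ?a = 0" "M ?v ?b = 0"
      using det by (simp_all add: bilinear_lsub[OF bM] bilinear_lmul[OF bM] sM[of ?b ?a] power2_eq_square)
    ultimately show ?thesis by blast
  qed
  then obtain v where v: "v \<noteq> 0" "M v ?a = 0" "M v ?b = 0" by blast
  have Mv: "M v w = 0" for w
  proof -
    have "w = w $ 1 *\<^sub>R ?a + w $ 2 *\<^sub>R ?b" by (simp add: vec_eq_iff forall_2 axis_def)
    then have "M v w = M v (w $ 1 *\<^sub>R ?a + w $ 2 *\<^sub>R ?b)" by metis
    then show ?thesis by (simp add: bilinear_radd[OF bM] bilinear_rmul[OF bM] v)
  qed
  define c where "c = 1 / sqrt (G v v)"
  have "c * c * G v v = 1" using G(3)[OF v(1)] by (simp add: c_def)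
  then have "G (c *\<^sub>R v) (c *\<^sub>R v) = 1"
    by (simp add: bilinear_lmul[OF G(1)] bilinear_rmul[OF G(1)] mult.assoc)
  moreover have "A (c *\<^sub>R v) w = l * G (c *\<^sub>R v) w" for w
    using Mv[of w] by (simp add: bilinear_lmul[OF G(1)] bilinear_lmul[OF A(1)] M_def)
  ultimately show ?thesis by blast
qed

text \<open>Separated from the flow so that the assumptions on the flow can be stated in terms of
  \<open>g\<close>, \<open>a\<close> and \<open>\<Delta>\<close>.\<close>

locale chart_data =
  fixes \<kappa> :: real and W N :: "(real^2) \<times> real \<Rightarrow> ambient"
begin

definition g where "g v w x = bform \<kappa> (dd (v, 0) W x) (dd (w, 0) W x)"
definition a where "a v w x = - bform \<kappa> (dd (v, 0) (dd (w, 0) W) x) (N x)"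
definition \<Delta> where "\<Delta> x = g (axis 1 1) (axis 1 1) x * g (axis 2 1) (axis 2 1) x
  - g (axis 1 1) (axis 2 1) x * g (axis 1 1) (axis 2 1) x"

end

locale chart_flow = chart_data \<kappa> W N
  for \<kappa> :: real and W N :: "(real^2) \<times> real \<Rightarrow> ambient" +
  fixes \<alpha> :: real and F :: "real \<times> real \<Rightarrow> real" and S0 :: "((real^2) \<times> real) set"
    and f la lb :: "(real^2) \<times> real \<Rightarrow> real"
  assumes \<kappa>: "\<kappa> \<in> {0, 1, -1}" and F: "curvature_function F" and S0: "open S0"
    and smooth: "smooth_on S0 W" "smooth_on S0 N" "smooth_on S0 f"
    and W: "\<And>x. x \<in> S0 \<Longrightarrow> W x \<in> space_form \<kappa>"
    and N: "\<And>x. x \<in> S0 \<Longrightarrow> N x \<in> tangent_at \<kappa> (W x)" "\<And>x. x \<in> S0 \<Longrightarrow> bform \<kappa> (N x) (N x) = 1"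
    and perp: "\<And>x v. x \<in> S0 \<Longrightarrow> bform \<kappa> (dd (v, 0) W x) (N x) = 0"
    and flow: "\<And>x. x \<in> S0 \<Longrightarrow> dd (0, 1) W x = f x *\<^sub>R N x"
    and pos_def: "\<And>x v. x \<in> S0 \<Longrightarrow> v \<noteq> 0 \<Longrightarrow> g v v x > 0" and \<Delta>_pos: "\<And>x. x \<in> S0 \<Longrightarrow> \<Delta> x > 0"
    and mean: "\<And>x. x \<in> S0 \<Longrightarrow> (la x + lb x) * \<Delta> x
      = g (axis 2 1) (axis 2 1) x * a (axis 1 1) (axis 1 1) x
        - 2 * (g (axis 1 1) (axis 2 1) x * a (axis 1 1) (axis 2 1) x)
        + g (axis 1 1) (axis 1 1) x * a (axis 2 1) (axis 2 1) x"
    and gauss: "\<And>x. x \<in> S0 \<Longrightarrow> la x * lb x * \<Delta> x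
      = a (axis 1 1) (axis 1 1) x * a (axis 2 1) (axis 2 1) x
        - a (axis 1 1) (axis 2 1) x * a (axis 1 1) (axis 2 1) x"
    and convex: "\<And>x. x \<in> S0 \<Longrightarrow> la x > 0 \<and> lb x > 0"
    and speed: "\<And>x. x \<in> S0 \<Longrightarrow> f x = F (la x, lb x) powr (- \<alpha>)"
    and \<alpha>: "0 < \<alpha>" "\<alpha> \<le> 1" "\<kappa> = 1 \<Longrightarrow> \<alpha> = 1"
begin

definition pinching where "pinching x = (la x - lb x)\<^sup>2 / (la x + lb x)\<^sup>2"

lemma smooth_g: "smooth_on S0 (g v w)" and smooth_a: "smooth_on S0 (a v w)"
  unfolding g_def[abs_def] a_def[abs_def]
  by (intro smooth_on_bilinear[OF bounded_bilinear_bform] smooth_on_dd smooth S0,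
      rule smooth_on_minus, intro smooth_on_bilinear[OF bounded_bilinear_bform] smooth_on_dd smooth S0)

lemma g_sym: "g v w x = g w v x" by (simp add: g_def bform_sym)

lemma a_sym: "x \<in> S0 \<Longrightarrow> a v w x = a w v x"
  by (simp add: a_def dd_commute[OF smooth(1) S0, of x "(v, 0)"])

lemma linear_dd_slice:
  assumes "smooth_on S0 u" "x \<in> S0"
  shows "linear (\<lambda>v. dd (v, 0) u x)"
proof -
  have "linear (\<lambda>v::real^2. (v, 0::real))" by (auto intro: linearI)
  from linear_compose[OF this linear_dd[OF assms(1) S0 assms(2)]] show ?thesis by (simp add: o_def)
qed

lemma bilinear_g: "x \<in> S0 \<Longrightarrow> bilinear (\<lambda>v w. g v w x)"
  using linear_dd_slice[OF smooth(1), of x]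
  by (auto simp: bilinear_def g_def linear_iff bform_simps)

lemma bilinear_a:
  assumes "x \<in> S0"
  shows "bilinear (\<lambda>v w. a v w x)"
proof -
  have "linear (\<lambda>v. a v w x)" for w
    using linear_dd_slice[OF smooth_on_dd[OF smooth(1) S0] assms, of "(w, 0)"]
    by (auto simp: a_def linear_iff bform_simps)
  then show ?thesis by (simp add: bilinear_def a_sym[OF assms, of _ ])
qed

lemma smooth_\<Delta>: "smooth_on S0 \<Delta>"
  unfolding \<Delta>_def[abs_def] by (intro smooth_intros smooth_g)

lemma smooth_mean: "smooth_on S0 (\<lambda>x. la x + lb x)"
proof (rule smooth_on_cong)
  show "smooth_on S0 (\<lambda>x. (g (axis 2 1) (axis 2 1) x * a (axis 1 1) (axis 1 1) x
        - 2 * (g (axis 1 1) (axis 2 1) x * a (axis 1 1) (axis 2 1) x)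
        + g (axis 1 1) (axis 1 1) x * a (axis 2 1) (axis 2 1) x) / \<Delta> x)"
    by (intro smooth_intros smooth_g smooth_a smooth_\<Delta> \<Delta>_pos)
qed (simp add: mean[symmetric] \<Delta>_pos less_imp_neq[OF \<Delta>_pos, symmetric])

lemma smooth_gauss: "smooth_on S0 (\<lambda>x. la x * lb x)"
proof (rule smooth_on_cong)
  show "smooth_on S0 (\<lambda>x. (a (axis 1 1) (axis 1 1) x * a (axis 2 1) (axis 2 1) x
        - a (axis 1 1) (axis 2 1) x * a (axis 1 1) (axis 2 1) x) / \<Delta> x)"
    by (intro smooth_intros smooth_g smooth_a smooth_\<Delta> \<Delta>_pos)
qed (simp add: gauss[symmetric] less_imp_neq[OF \<Delta>_pos, symmetric])

lemma sum_pos: "x \<in> S0 \<Longrightarrow> la x + lb x > 0"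
  using convex[of x] by (simp add: add_pos_pos)

text \<open>The squared difference is rewritten by sum and product, since \<open>la\<close> and
  \<open>lb\<close> separately may switch between the two eigenvalues and are not known to be
  smooth.\<close>

lemma smooth_pinching: "smooth_on S0 pinching"
proof (rule smooth_on_cong)
  show "smooth_on S0 (\<lambda>x. ((la x + lb x)\<^sup>2 - 4 * (la x * lb x)) / (la x + lb x)\<^sup>2)"
    by (rule smooth_on_divide, rule smooth_on_diff, rule smooth_on_power, rule smooth_mean,
        rule smooth_on_mult[OF smooth_on_const smooth_gauss], rule smooth_on_power, rule smooth_mean)
      (rule zero_less_power, rule sum_pos)
qed (simp add: pinching_def power2_eq_square algebra_simps)

lemma pinching_less_1: "x \<in> S0 \<Longrightarrow> pinching x < 1"
  using convex[of x] by (simp add: pinching_def power2_eq_square divide_less_eq algebra_simps add_pos_pos)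

text \<open>
  In the coordinates \<open>\<sigma>\<close> the linear part diagonalises the second fundamental form and the
  quadratic part cancels the Christoffel symbols at \<open>(u0, t0)\<close>. Injectivity of \<open>\<sigma>\<close> is irrelevant.
\<close>

theorem dd_pinching_le_0:
  assumes x0: "(u0, t0) \<in> S0" and pos: "pinching (u0, t0) > 0"
    and max: "\<forall>\<^sub>F u in nhds u0. pinching (u, t0) \<le> pinching (u0, t0)"
  shows "dd (0, 1) pinching (u0, t0) \<le> 0"
proof -
  let ?x = "(u0, t0)"
  let ?B = "bform \<kappa>"
  define l1 where "l1 = max (la ?x) (lb ?x)"
  define l2 where "l2 = min (la ?x) (lb ?x)"
  have "la ?x \<noteq> lb ?x" using pos by (auto simp: pinching_def)
  then have l: "l1 > l2" "l2 > 0" and sum: "l1 + l2 = la ?x + lb ?x" and prod: "l1 * l2 = la ?x * lb ?x"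
    and Gl: "pinching ?x = (l1 - l2)\<^sup>2 / (l1 + l2)\<^sup>2"
    using convex[OF x0] by (auto simp: l1_def l2_def max_def min_def pinching_def power2_commute add.commute mult.commute)
  note bg = bilinear_g[OF x0] note ba = bilinear_a[OF x0]
  have ev: "\<exists>v. g v v ?x = 1 \<and> (\<forall>w. a v w ?x = l * g v w ?x)" if "l = l1 \<or> l = l2" for l
  proof (rule bilinear_eigenvector[OF bg g_sym pos_def[OF x0] ba a_sym[OF x0]])
    have "l * l - (l1 + l2) * l + l1 * l2 = 0" using that by (auto simp: algebra_simps)
    then have "\<Delta> ?x * (l * l) - ((l1 + l2) * \<Delta> ?x) * l + l1 * l2 * \<Delta> ?x = 0" by algebra
    then show "(a (axis 1 1) (axis 1 1) ?x - l * g (axis 1 1) (axis 1 1) ?x) * (a (axis 2 1) (axis 2 1) ?x - l * g (axis 2 1) (axis 2 1) ?x)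
      = (a (axis 1 1) (axis 2 1) ?x - l * g (axis 1 1) (axis 2 1) ?x)\<^sup>2"
      using mean[OF x0] gauss[OF x0] unfolding sum prod \<Delta>_def by algebra
  qed
  obtain v1 where v1: "g v1 v1 ?x = 1" "\<And>w. a v1 w ?x = l1 * g v1 w ?x" using ev[of l1] by blast
  obtain v2 where v2: "g v2 v2 ?x = 1" "\<And>w. a v2 w ?x = l2 * g v2 w ?x" using ev[of l2] by blast
  have "l1 * g v1 v2 ?x = l2 * g v1 v2 ?x" using v1(2)[of v2] v2(2)[of v1] a_sym[OF x0, of v1 v2] g_sym[of v2 v1] by auto
  then have v12: "g v1 v2 ?x = 0" using l by simp
  have a12: "a v1 v2 ?x = 0" using v1(2) v12 by simp
  have a11: "a v1 v1 ?x = l1" "a v2 v2 ?x = l2" using v1 v2 by simp_all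
  \<comment> \<open>Minus the tangential part of the second derivative of \<open>W\<close>, in the
    orthonormal frame given by \<open>v1\<close> and \<open>v2\<close>: the vector of Christoffel
    symbols with the sign changed.\<close>
  define q where "q v w = - (?B (dd (v, 0) (dd (w, 0) W) ?x) (dd (v1, 0) W ?x)) *\<^sub>R v1
      - (?B (dd (v, 0) (dd (w, 0) W) ?x) (dd (v2, 0) W ?x)) *\<^sub>R v2" for v w
  \<comment> \<open>Time is passed on unchanged and does not affect the spatial part, so
    \<open>dd e0\<close> is the time derivative at a fixed point of the chart and the flow equation
    keeps its form.\<close>
  define \<sigma> :: "real \<times> real \<times> real \<Rightarrow> (real^2) \<times> real" where
    "\<sigma> y = (u0 + fst y *\<^sub>R v1 + fst (snd y) *\<^sub>R v2 + ((fst y)\<^sup>2 / 2) *\<^sub>R q v1 v1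
      + (fst y * fst (snd y)) *\<^sub>R q v1 v2 + ((fst (snd y))\<^sup>2 / 2) *\<^sub>R q v2 v2, snd (snd y))" for y
  define e0 :: "real \<times> real \<times> real" where "e0 = (0, 0, 1)"
  define e1 :: "real \<times> real \<times> real" where "e1 = (1, 0, 0)"
  define e2 :: "real \<times> real \<times> real" where "e2 = (0, 1, 0)"
  define p :: "real \<times> real \<times> real" where "p = (0, 0, t0)"
  define w1 where "w1 y = v1 + fst y *\<^sub>R q v1 v1 + fst (snd y) *\<^sub>R q v1 v2" for y :: "real \<times> real \<times> real"
  define w2 where "w2 y = v2 + fst y *\<^sub>R q v1 v2 + fst (snd y) *\<^sub>R q v2 v2" for y :: "real \<times> real \<times> real"
  have \<sigma>p: "\<sigma> p = ?x" by (simp add: \<sigma>_def p_def)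
  have \<sigma>': "(\<sigma> has_derivative (\<lambda>h. (fst h *\<^sub>R w1 y + fst (snd h) *\<^sub>R w2 y, snd (snd h)))) (at y)" for y
    unfolding \<sigma>_def[abs_def]
    by (auto intro!: derivative_eq_intros simp: w1_def w2_def algebra_simps)
  have d\<sigma>: "dd e0 \<sigma> = (\<lambda>y. (0, 1))" "dd e1 \<sigma> = (\<lambda>y. (w1 y, 0))" "dd e2 \<sigma> = (\<lambda>y. (w2 y, 0))"
    by (rule ext, subst dd_eq[OF \<sigma>'], simp add: e0_def e1_def e2_def)+
  have w': "((\<lambda>y. (w1 y, 0::real)) has_derivative (\<lambda>h. (fst h *\<^sub>R q v1 v1 + fst (snd h) *\<^sub>R q v1 v2, 0))) (at y)"
    "((\<lambda>y. (w2 y, 0::real)) has_derivative (\<lambda>h. (fst h *\<^sub>R q v1 v2 + fst (snd h) *\<^sub>R q v2 v2, 0))) (at y)" for y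
    unfolding w1_def[abs_def] w2_def[abs_def] by (auto intro!: derivative_eq_intros)
  have dd\<sigma>: "dd e1 (dd e1 \<sigma>) y = (q v1 v1, 0)" "dd e1 (dd e2 \<sigma>) y = (q v1 v2, 0)"
    "dd e2 (dd e1 \<sigma>) y = (q v1 v2, 0)" "dd e2 (dd e2 \<sigma>) y = (q v2 v2, 0)" for y
    unfolding d\<sigma> dd_eq[OF w'(1)] dd_eq[OF w'(2)] by (simp_all add: e1_def e2_def)
  have sm\<sigma>: "smooth_on X \<sigma>" for X
  proof -
    note bl = smooth_on_bounded_linear[of _ X]
    have c: "smooth_on X (\<lambda>y::real \<times> real \<times> real. fst y)" "smooth_on X (\<lambda>y::real \<times> real \<times> real. fst (snd y))"
      "smooth_on X (\<lambda>y::real \<times> real \<times> real. snd (snd y))"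
      by (rule bl[OF bounded_linear_fst] bl[OF bounded_linear_compose[OF bounded_linear_fst bounded_linear_snd]]
          bl[OF bounded_linear_compose[OF bounded_linear_snd bounded_linear_snd]])+
    have c': "smooth_on X (\<lambda>y::real \<times> real \<times> real. (fst y)\<^sup>2 / 2)"
      "smooth_on X (\<lambda>y::real \<times> real \<times> real. (fst (snd y))\<^sup>2 / 2)"
      by (rule smooth_on_divide[OF smooth_on_power[OF c(1)] smooth_on_const]
          smooth_on_divide[OF smooth_on_power[OF c(2)] smooth_on_const], simp)+
    show ?thesis
      unfolding \<sigma>_def[abs_def]
      by (intro smooth_on_Pair smooth_on_add smooth_on_scaleR smooth_on_const c c' smooth_on_mult[OF c(1,2)])
  qed
  have cont\<sigma>: "continuous_on UNIV \<sigma>" using smooth_on_imp_continuous_on[OF sm\<sigma>] .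
  \<comment> \<open>Points of zero pinching are cut away, since \<open>profile'\<close> divides by
    the square root of the pinching quantity.\<close>
  define T where "T = {x \<in> S0. pinching x > 0}"
  have T: "open T"
  proof -
    have "T = S0 \<inter> pinching -` {0<..}" by (auto simp: T_def)
    then show ?thesis
      using continuous_open_preimage[OF smooth_on_imp_continuous_on[OF smooth_pinching] S0 open_greaterThan[of 0]]
      by simp
  qed
  have TS: "T \<subseteq> S0" by (auto simp: T_def)
  define S where "S = \<sigma> -` T"
  have S: "open S" unfolding S_def by (rule open_vimage[OF T cont\<sigma>])
  have pS: "p \<in> S" using x0 pos by (simp add: S_def T_def \<sigma>p)
  have im: "\<sigma> ` S \<subseteq> T" by (auto simp: S_def)
  have in_S0: "\<sigma> y \<in> S0" if "y \<in> S" for y using that TS by (auto simp: S_def)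
  note smT = smooth[THEN smooth_on_subset[OF _ TS]]
  note chain = dd_compose[OF S T _ sm\<sigma> im]
  note chain2 = dd_dd_compose[OF S T _ sm\<sigma> im]
  define Z where "Z y = W (\<sigma> y)" for y
  have dZ: "dd e0 Z y = dd (0, 1) W (\<sigma> y)" "dd e1 Z y = dd (w1 y, 0) W (\<sigma> y)" "dd e2 Z y = dd (w2 y, 0) W (\<sigma> y)"
    if "y \<in> S" for y
    unfolding Z_def[abs_def] chain[OF smT(1) that] d\<sigma> by simp_all
  have ddZ: "dd e1 (dd e1 Z) y = dd (w1 y, 0) (dd (w1 y, 0) W) (\<sigma> y) + dd (q v1 v1, 0) W (\<sigma> y)"
    "dd e1 (dd e2 Z) y = dd (w1 y, 0) (dd (w2 y, 0) W) (\<sigma> y) + dd (q v1 v2, 0) W (\<sigma> y)"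
    "dd e2 (dd e1 Z) y = dd (w2 y, 0) (dd (w1 y, 0) W) (\<sigma> y) + dd (q v1 v2, 0) W (\<sigma> y)"
    "dd e2 (dd e2 Z) y = dd (w2 y, 0) (dd (w2 y, 0) W) (\<sigma> y) + dd (q v2 v2, 0) W (\<sigma> y)"
    if "y \<in> S" for y
    unfolding Z_def[abs_def] chain2[OF smT(1) that] dd\<sigma> unfolding d\<sigma> by simp_all
  have wp: "w1 p = v1" "w2 p = v2" by (simp_all add: w1_def w2_def p_def)
  have dq: "dd (q v w, 0) W ?x = - (?B (dd (v, 0) (dd (w, 0) W) ?x) (dd (v1, 0) W ?x)) *\<^sub>R dd (v1, 0) W ?x
      - (?B (dd (v, 0) (dd (w, 0) W) ?x) (dd (v2, 0) W ?x)) *\<^sub>R dd (v2, 0) W ?x" for v w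
  proof -
    define L where "L v = dd (v, 0) W ?x" for v
    have "linear L" using linear_dd_slice[OF smooth(1) x0] by (simp add: L_def[abs_def])
    then have "L (q v w) = - (?B (dd (v, 0) (dd (w, 0) W) ?x) (dd (v1, 0) W ?x)) *\<^sub>R L v1
      - (?B (dd (v, 0) (dd (w, 0) W) ?x) (dd (v2, 0) W ?x)) *\<^sub>R L v2"
      unfolding q_def by (simp only: linear_diff linear_cmul)
    then show ?thesis by (simp only: L_def)
  qed
  have frame: "?B (dd (v1, 0) W ?x) (dd (v1, 0) W ?x) = 1" "?B (dd (v1, 0) W ?x) (dd (v2, 0) W ?x) = 0"
    "?B (dd (v2, 0) W ?x) (dd (v1, 0) W ?x) = 0" "?B (dd (v2, 0) W ?x) (dd (v2, 0) W ?x) = 1"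
    using v1(1) v2(1) v12 g_sym[of v2 v1] by (simp_all add: g_def)
  have comm: "dd (v2, 0) (dd (v1, 0) W) ?x = dd (v1, 0) (dd (v2, 0) W) ?x"
    by (rule dd_commute[OF smooth(1) S0 x0])
  have norm: "?B (dd (v, 0) (dd (w, 0) W) ?x + dd (q v w, 0) W ?x) (dd (v1, 0) W ?x) = 0"
    "?B (dd (v, 0) (dd (w, 0) W) ?x + dd (q v w, 0) W ?x) (dd (v2, 0) W ?x) = 0" for v w
    unfolding dq bform_simps by (simp_all add: frame)
  interpret c: normal_moving_chart \<kappa> S Z "\<lambda>y. N (\<sigma> y)" "\<lambda>y. f (\<sigma> y)" e0 e1 e2 p l1 l2
  proof unfold_locales
    show "\<kappa> \<in> {0, 1, -1}" "open S" "p \<in> S" by (fact \<kappa> S pS)+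
    show "smooth_on S Z" "smooth_on S (\<lambda>y. N (\<sigma> y))" "smooth_on S (\<lambda>y. f (\<sigma> y))"
      unfolding Z_def[abs_def] by (rule smooth_on_compose[OF smT(1) sm\<sigma> im] smooth_on_compose[OF smT(2) sm\<sigma> im]
        smooth_on_compose[OF smT(3) sm\<sigma> im])+
    fix y assume y: "y \<in> S"
    show "Z y \<in> space_form \<kappa>" "N (\<sigma> y) \<in> tangent_at \<kappa> (Z y)" "?B (N (\<sigma> y)) (N (\<sigma> y)) = 1"
      unfolding Z_def using W N in_S0[OF y] by auto
    show "?B (dd e1 Z y) (N (\<sigma> y)) = 0" "?B (dd e2 Z y) (N (\<sigma> y)) = 0"
      unfolding dZ[OF y] using perp in_S0[OF y] by auto
    show "dd e0 Z y = f (\<sigma> y) *\<^sub>R N (\<sigma> y)" unfolding dZ[OF y] by (rule flow[OF in_S0[OF y]])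
  next
    show "?B (dd e1 Z p) (dd e1 Z p) = 1" "?B (dd e1 Z p) (dd e2 Z p) = 0" "?B (dd e2 Z p) (dd e2 Z p) = 1"
      unfolding dZ[OF pS] \<sigma>p wp by (fact frame)+
    show "?B (dd u (dd v Z) p) (dd w Z p) = 0" if "u \<in> {e1, e2}" "v \<in> {e1, e2}" "w \<in> {e1, e2}" for u v w
      using that norm[of v1 v1] norm[of v1 v2] norm[of v2 v2]
      by (elim insertE emptyE; simp add: ddZ[OF pS] dZ[OF pS] \<sigma>p wp comm)
    show "?B (dd e1 (dd e1 Z) p) (N (\<sigma> p)) = - l1" "?B (dd e1 (dd e2 Z) p) (N (\<sigma> p)) = 0"
      "?B (dd e2 (dd e2 Z) p) (N (\<sigma> p)) = - l2"
      using a12 a11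
      unfolding ddZ[OF pS] \<sigma>p wp bform_simps perp[OF x0] by (simp_all add: a_def)
  qed
  have cg: "c.g e1 e1 y = g (w1 y) (w1 y) (\<sigma> y)" "c.g e1 e2 y = g (w1 y) (w2 y) (\<sigma> y)"
    "c.g e2 e2 y = g (w2 y) (w2 y) (\<sigma> y)" if "y \<in> S" for y
    unfolding c.g_def g_def dZ[OF that] by simp_all
  \<comment> \<open>The quadratic part of \<open>\<sigma>\<close> adds tangent vectors to the second
    derivatives, and these are orthogonal to the normal.\<close>
  have ch: "c.h e1 e1 y = a (w1 y) (w1 y) (\<sigma> y)" "c.h e1 e2 y = a (w1 y) (w2 y) (\<sigma> y)"
    "c.h e2 e2 y = a (w2 y) (w2 y) (\<sigma> y)" if "y \<in> S" for y
    unfolding c.h_def a_def ddZ[OF that] bform_simps perp[OF in_S0[OF that]] by simp_all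
  define G where "G y = pinching (\<sigma> y)" for y
  have smG: "smooth_on S G" unfolding G_def[abs_def]
    by (rule smooth_on_compose[OF smooth_on_subset[OF smooth_pinching TS] sm\<sigma> im])
  have Gp: "G p = pinching ?x" by (simp add: G_def \<sigma>p)
  have range_G: "0 < G y" "G y < 1" if "y \<in> S" for y
    using that pinching_less_1[OF in_S0[OF that]] by (auto simp: G_def S_def T_def)
  obtain V where V: "open V" "u0 \<in> V" "\<And>u. u \<in> V \<Longrightarrow> pinching (u, t0) \<le> pinching ?x"
    using max by (auto simp: eventually_nhds)
  have locmax: "\<forall>\<^sub>F r in nhds 0. G (p + r *\<^sub>R e) \<le> G p" if "e = e1 \<or> e = e2" for e
  proof -
    have "open ((\<lambda>r. fst (\<sigma> (p + r *\<^sub>R e))) -` V)"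
      by (rule open_vimage[OF V(1)]) (intro continuous_intros continuous_on_compose2[OF cont\<sigma>] subset_UNIV)
    then have "\<forall>\<^sub>F r in nhds 0. fst (\<sigma> (p + r *\<^sub>R e)) \<in> V"
      using V(2) by (auto simp: eventually_nhds \<sigma>p)
    then show ?thesis
    proof eventually_elim
      case (elim r)
      have "\<sigma> (p + r *\<^sub>R e) = (fst (\<sigma> (p + r *\<^sub>R e)), t0)"
        using that by (auto simp: \<sigma>_def p_def e1_def e2_def)
      then show ?case using V(3)[OF elim] by (simp add: G_def \<sigma>p)
    qed
  qed
  have "dd e0 G p \<le> 0"
  proof (rule c.dd_e0_pinching_le_0[where H = "\<lambda>y. la (\<sigma> y) + lb (\<sigma> y)" and K = "\<lambda>y. la (\<sigma> y) * lb (\<sigma> y)"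
        and b = "profile F" and b' = "profile' F" and \<alpha> = \<alpha>])
    show "smooth_on S (\<lambda>y. la (\<sigma> y) + lb (\<sigma> y))"
      by (rule smooth_on_compose[OF smooth_on_subset[OF smooth_mean TS] sm\<sigma> im])
    show "smooth_on S (\<lambda>y. la (\<sigma> y) * lb (\<sigma> y))"
      by (rule smooth_on_compose[OF smooth_on_subset[OF smooth_gauss TS] sm\<sigma> im])
    show "smooth_on S G" by (fact smG)
    show "l1 > l2" "l2 > 0" "0 < \<alpha>" "\<alpha> \<le> 1" by (fact l \<alpha>(1,2))+
    \<comment> \<open>In the inequality that follows, the left side is 0 for \<kappa> = 0 and for
      \<alpha> = 1, and at most 0 for \<kappa> = -1, while the right side is positive.\<close>
    have "l1 * l2 > 0" using l by simp
    then show "(1 - \<alpha>) * \<kappa> \<le> (1 + \<alpha>) * (l1 * l2)"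
      using \<kappa> \<alpha> by (auto intro: order_trans[OF _ mult_nonneg_nonneg])
    show "0 \<le> (l1 + l2)\<^sup>2 + 4 * (l1 - l2) * (profile' F (G p) / profile F (G p)) * l2"
      "0 \<le> (l1 + l2)\<^sup>2 - 4 * (l1 - l2) * (profile' F (G p) / profile F (G p)) * l1"
      by (rule profile_elliptic[OF F l]; simp add: Gp Gl)+
    show "isCont (profile' F) (G p)" by (rule isCont_profile'[OF F range_G[OF pS]])
    show "dd e1 G p = 0" "dd e1 (dd e1 G) p \<le> 0" "dd e2 G p = 0" "dd e2 (dd e2 G) p \<le> 0"
      using second_derivative_at_local_max[OF smG S pS locmax] by blast+
    fix y assume y: "y \<in> S"
    note x = in_S0[OF y]
    note rel = bilinear_curvature_relations[OF bilinear_g[OF x] g_sym bilinear_a[OF x] a_sym[OF x]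
        mean[OF x, unfolded \<Delta>_def] gauss[OF x, unfolded \<Delta>_def]]
    show "(la (\<sigma> y) + lb (\<sigma> y)) * (c.g e1 e1 y * c.g e2 e2 y - c.g e1 e2 y * c.g e1 e2 y)
        = c.g e2 e2 y * c.h e1 e1 y - 2 * (c.g e1 e2 y * c.h e1 e2 y) + c.g e1 e1 y * c.h e2 e2 y"
      unfolding cg[OF y] ch[OF y] by (rule rel(1))
    show "la (\<sigma> y) * lb (\<sigma> y) * (c.g e1 e1 y * c.g e2 e2 y - c.g e1 e2 y * c.g e1 e2 y)
        = c.h e1 e1 y * c.h e2 e2 y - c.h e1 e2 y * c.h e1 e2 y"
      unfolding cg[OF y] ch[OF y] by (rule rel(2))
    have ab: "la (\<sigma> y) > 0" "lb (\<sigma> y) > 0" using convex[OF x] by auto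
    then have "G y * (la (\<sigma> y) + lb (\<sigma> y))\<^sup>2 = (la (\<sigma> y) - lb (\<sigma> y))\<^sup>2"
      by (simp add: G_def pinching_def)
    then show "(1 - G y) * ((la (\<sigma> y) + lb (\<sigma> y)) * (la (\<sigma> y) + lb (\<sigma> y))) = 4 * (la (\<sigma> y) * lb (\<sigma> y))"
      by algebra
    show "la (\<sigma> y) + lb (\<sigma> y) > 0 \<and> profile F (G y) > 0"
      using ab profile_pos[OF F range_G[OF y]] by simp
    show "(profile F has_real_derivative profile' F (G y)) (at (G y))"
      by (rule profile_has_derivative[OF F range_G[OF y]])
    show "f (\<sigma> y) = ((la (\<sigma> y) + lb (\<sigma> y)) * profile F (G y)) powr (- \<alpha>)"
      using speed[OF x] F_eq_profile[OF F ab] by (simp add: G_def pinching_def)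
  qed
  moreover have "dd e0 G p = dd (0, 1) pinching ?x"
    unfolding G_def[abs_def] chain[OF smooth_on_subset[OF smooth_pinching TS] pS] d\<sigma> \<sigma>p ..
  ultimately show ?thesis by simp
qed

end

section \<open>Principal curvatures of a parametrised surface\<close>

text \<open>The case \<kappa> = -1 carries the argument: tangency to the hyperboloid gives
  \<open>a * s = u \<bullet> v\<close>, and Cauchy-Schwarz together with
  \<open>a\<^sup>2 = 1 + v \<bullet> v\<close> bounds the first component \<open>s\<close>.\<close>

lemma bform_pos:
  assumes \<kappa>: "\<kappa> \<in> {0, 1, -1}" and z: "z \<in> space_form \<kappa>"
    and w: "\<kappa> * bform \<kappa> w z = 0" "\<kappa> = 0 \<Longrightarrow> fst w = 0" "w \<noteq> 0"
  shows "bform \<kappa> w w > 0"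
proof -
  obtain s u where wsu: "w = (s, u)" by fastforce
  obtain a v where zav: "z = (a, v)" by fastforce
  consider "\<kappa> = 0" | "\<kappa> = 1" | "\<kappa> = -1" using \<kappa> by auto
  then show ?thesis
  proof cases
    case 1
    then show ?thesis using w wsu by (auto simp: bform_def zero_prod_def)
  next
    case 2
    then have "bform \<kappa> w w = w \<bullet> w" by (simp add: bform_def inner_prod_def)
    then show ?thesis using w(3) by simp
  next
    case 3
    have a: "a\<^sup>2 = 1 + v \<bullet> v" "a > 0" using z 3 by (auto simp: space_form_def zav)
    have sa: "a * s = u \<bullet> v" using w(1) 3 by (simp add: bform_def wsu zav mult.commute)
    have u: "u \<noteq> 0"
    proof
      assume "u = 0"
      then have "s = 0" using sa a(2) by simp
      then show False using \<open>u = 0\<close> w(3) wsu by (simp add: zero_prod_def)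
    qed
    have "a\<^sup>2 * s\<^sup>2 = (u \<bullet> v)\<^sup>2" by (simp add: sa[symmetric] power_mult_distrib)
    also have "\<dots> \<le> (u \<bullet> u) * (v \<bullet> v)" by (rule Cauchy_Schwarz_ineq)
    also have "\<dots> = a\<^sup>2 * (u \<bullet> u) - u \<bullet> u" using a(1) by (simp add: algebra_simps)
    also have "\<dots> < a\<^sup>2 * (u \<bullet> u)" using u by simp
    finally have "s\<^sup>2 < u \<bullet> u" using a(2) by simp
    then show ?thesis using 3 by (simp add: bform_def wsu power2_eq_square)
  qed
qed

text \<open>The eigenvalues of a symmetric form relative to a positive definite one are real:
  \<open>x\<^sup>2\<close> times the discriminant is a sum of squares with positive weights.\<close>

lemma symmetric_pencil_discriminant:
  fixes x y z p q r :: real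
  assumes "x > 0" "x * z - y * y > 0"
  shows "4 * (x * z - y * y) * (p * r - q * q) \<le> (z * p - 2 * (y * q) + x * r)\<^sup>2"
proof -
  let ?\<Delta> = "x * z - y * y" and ?n = "z * p - 2 * (y * q) + x * r"
  have "x\<^sup>2 * (?n\<^sup>2 - 4 * ?\<Delta> * (p * r - q * q)) = (x * ?n - 2 * ?\<Delta> * p)\<^sup>2 + 4 * ?\<Delta> * (x * q - y * p)\<^sup>2"
    by algebra
  also have "\<dots> \<ge> 0" using assms by simp
  finally have "0 \<le> ?n\<^sup>2 - 4 * ?\<Delta> * (p * r - q * q)" using assms(1) by (simp add: zero_le_mult_iff)
  then show ?thesis by simp
qed

lemma kernel_iff_det_0:
  fixes M :: "real^2^2"
  shows "(\<exists>v. v \<noteq> 0 \<and> M *v v = 0) \<longleftrightarrow> det M = 0"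
  using matrix_left_invertible_ker[of M] invertible_det_nz[of M] invertible_left_inverse[of M] by blast

text \<open>
  The discriminant is nonnegative, so the eigenvalue set determines the characteristic polynomial
  even when it is a singleton.
\<close>

lemma weingarten_trace_det:
  fixes G A :: "real^2^2"
  assumes sym: "G $ 2 $ 1 = G $ 1 $ 2" "A $ 2 $ 1 = A $ 1 $ 2"
    and pos: "G $ 1 $ 1 > 0" "G $ 1 $ 1 * G $ 2 $ 2 - G $ 1 $ 2 * G $ 1 $ 2 > 0"
    and eig: "{l. \<exists>v. v \<noteq> 0 \<and> (matrix_inv G ** A) *v v = l *\<^sub>R v} = {a, b}"
  shows "(a + b) * (G $ 1 $ 1 * G $ 2 $ 2 - G $ 1 $ 2 * G $ 1 $ 2)
      = G $ 2 $ 2 * A $ 1 $ 1 - 2 * (G $ 1 $ 2 * A $ 1 $ 2) + G $ 1 $ 1 * A $ 2 $ 2"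
    and "a * b * (G $ 1 $ 1 * G $ 2 $ 2 - G $ 1 $ 2 * G $ 1 $ 2)
      = A $ 1 $ 1 * A $ 2 $ 2 - A $ 1 $ 2 * A $ 1 $ 2"
proof -
  define \<Delta> where "\<Delta> = G $ 1 $ 1 * G $ 2 $ 2 - G $ 1 $ 2 * G $ 1 $ 2"
  define n where "n = G $ 2 $ 2 * A $ 1 $ 1 - 2 * (G $ 1 $ 2 * A $ 1 $ 2) + G $ 1 $ 1 * A $ 2 $ 2"
  define d where "d = A $ 1 $ 1 * A $ 2 $ 2 - A $ 1 $ 2 * A $ 1 $ 2"
  have \<Delta>: "\<Delta> > 0" using pos by (simp add: \<Delta>_def)
  have "det G = \<Delta>" by (simp add: det_2 \<Delta>_def sym)
  then have inv: "invertible G" using \<Delta> by (simp add: invertible_det_nz)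
  have Gi: "G ** matrix_inv G = mat 1" "matrix_inv G ** G = mat 1"
    using someI_ex[OF inv[unfolded invertible_def]] unfolding matrix_inv_def by auto
  \<comment> \<open>Passing to the pencil \<open>A - l *\<^sub>R G\<close> removes the inverse
    matrix; its determinant is quadratic in \<open>l\<close> with leading coefficient
    \<open>\<Delta>\<close>.\<close>
  have iff: "(matrix_inv G ** A) *v v = l *\<^sub>R v \<longleftrightarrow> (A - l *\<^sub>R G) *v v = 0" for l v
  proof
    assume "(matrix_inv G ** A) *v v = l *\<^sub>R v"
    then have "G *v ((matrix_inv G ** A) *v v) = l *\<^sub>R (G *v v)" by (simp add: matrix_vector_mult_scaleR)
    then show "(A - l *\<^sub>R G) *v v = 0"
      by (simp add: matrix_vector_mul_assoc matrix_mul_assoc Gi matrix_vector_mult_diff_rdistrib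
          scaleR_matrix_vector_assoc[symmetric])
  next
    assume "(A - l *\<^sub>R G) *v v = 0"
    then have "A *v v = l *\<^sub>R (G *v v)"
      by (simp add: matrix_vector_mult_diff_rdistrib scaleR_matrix_vector_assoc[symmetric])
    then have "matrix_inv G *v (A *v v) = l *\<^sub>R ((matrix_inv G ** G) *v v)"
      by (simp add: matrix_vector_mult_scaleR matrix_vector_mul_assoc)
    then show "(matrix_inv G ** A) *v v = l *\<^sub>R v" by (simp add: Gi matrix_vector_mul_assoc)
  qed
  have det: "det (A - l *\<^sub>R G) = \<Delta> * l\<^sup>2 - n * l + d" for l
    by (simp add: det_2 sym \<Delta>_def n_def d_def) algebra
  have roots: "{a, b} = {l. \<Delta> * l\<^sup>2 - n * l + d = 0}"
    unfolding eig[symmetric] iff kernel_iff_det_0 det ..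
  define s where "s = sqrt (n\<^sup>2 - 4 * \<Delta> * d)"
  have s: "s\<^sup>2 = n\<^sup>2 - 4 * \<Delta> * d"
    unfolding s_def using symmetric_pencil_discriminant[OF pos, of "A $ 1 $ 1" "A $ 2 $ 2" "A $ 1 $ 2"]
    by (simp add: n_def d_def \<Delta>_def)
  have "\<Delta> * l\<^sup>2 - n * l + d = 0 \<longleftrightarrow> l = (n + s) / (2 * \<Delta>) \<or> l = (n - s) / (2 * \<Delta>)" for l
  proof -
    have "4 * \<Delta> * (\<Delta> * l\<^sup>2 - n * l + d) = (2 * \<Delta> * l - n - s) * (2 * \<Delta> * l - n + s)"
      using s by algebra
    then have "\<Delta> * l\<^sup>2 - n * l + d = 0 \<longleftrightarrow> 2 * \<Delta> * l - n - s = 0 \<or> 2 * \<Delta> * l - n + s = 0"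
      using \<Delta> by (metis mult_eq_0_iff less_irrefl zero_neq_numeral)
    then show ?thesis using \<Delta> by (auto simp: field_simps)
  qed
  then have "{a, b} = {(n + s) / (2 * \<Delta>), (n - s) / (2 * \<Delta>)}" unfolding roots by auto
  then have ab: "a + b = (n + s) / (2 * \<Delta>) + (n - s) / (2 * \<Delta>)" "a * b = (n + s) / (2 * \<Delta>) * ((n - s) / (2 * \<Delta>))"
    by (auto simp: doubleton_eq_iff)
  have "(a + b) * \<Delta> = n" using \<Delta> unfolding ab by (simp add: field_simps)
  moreover have "a * b * \<Delta> = d"
  proof -
    have "a * b * \<Delta> = (n\<^sup>2 - s\<^sup>2) / (4 * \<Delta>)"
      using \<Delta> unfolding ab by (simp add: field_simps power2_eq_square)
    then show ?thesis using \<Delta> unfolding s by simp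
  qed
  ultimately show "(a + b) * (G $ 1 $ 1 * G $ 2 $ 2 - G $ 1 $ 2 * G $ 1 $ 2)
      = G $ 2 $ 2 * A $ 1 $ 1 - 2 * (G $ 1 $ 2 * A $ 1 $ 2) + G $ 1 $ 1 * A $ 2 $ 2"
    "a * b * (G $ 1 $ 1 * G $ 2 $ 2 - G $ 1 $ 2 * G $ 1 $ 2)
      = A $ 1 $ 1 * A $ 2 $ 2 - A $ 1 $ 2 * A $ 1 $ 2"
    by (simp_all add: \<Delta>_def n_def d_def)
qed

lemma pd_eq_dd: "pd i f = dd (axis i 1) f"
  by (rule ext) (simp add: pd_def dd_def)

lemma linear_axis_expansion:
  fixes L :: "real^2 \<Rightarrow> 'b::real_vector"
  assumes "linear L"
  shows "L v = v $ 1 *\<^sub>R L (axis 1 1) + v $ 2 *\<^sub>R L (axis 2 1)"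
proof -
  have "v = v $ 1 *\<^sub>R axis 1 1 + v $ 2 *\<^sub>R axis 2 1" by (simp add: vec_eq_iff forall_2 axis_def)
  then have "L v = L (v $ 1 *\<^sub>R axis 1 1 + v $ 2 *\<^sub>R axis 2 1)" by simp
  then show ?thesis by (simp add: linear_add[OF assms] linear_cmul[OF assms])
qed

section \<open>Geometry of a parametrised surface at one point and a fixed time\<close>

locale parametrised_surface =
  fixes \<kappa> :: real and U :: "(real^2) set" and Y :: "real^2 \<Rightarrow> ambient" and u :: "real^2" and n :: ambient
    and a b :: real
  assumes \<kappa>: "\<kappa> \<in> {0, 1, -1}" and U: "open U" "u \<in> U" and Y: "smooth_on U Y"
    and range: "\<And>u. u \<in> U \<Longrightarrow> Y u \<in> space_form \<kappa>"
    and immersion: "inj (frechet_derivative Y (at u))"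
    and n: "n \<in> tangent_at \<kappa> (Y u)" "\<And>i. bform \<kappa> n (pd i Y u) = 0"
    and eig: "{l. \<exists>v. v \<noteq> 0 \<and> weingarten \<kappa> Y n u *v v = l *\<^sub>R v} = {a, b}"
begin

definition g where "g i j = bform \<kappa> (pd i Y u) (pd j Y u)"
definition h where "h i j = - bform \<kappa> (pd i (pd j Y) u) n"

lemma linear_dY: "linear (\<lambda>v. dd v Y u)"
  by (rule linear_dd[OF Y U])

lemma dd_Y_perp: "bform \<kappa> (dd v Y u) n = 0"
  unfolding linear_axis_expansion[OF linear_dY, of v]
  using n(2)[of 1] n(2)[of 2] by (simp add: bform_simps bform_sym[of _ n] pd_eq_dd)

lemma tangent: "\<kappa> * bform \<kappa> (dd v Y u) (Y u) = 0" "\<kappa> = 0 \<Longrightarrow> fst (dd v Y u) = 0"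
proof -
  show "\<kappa> * bform \<kappa> (dd v Y u) (Y u) = 0"
  proof (cases "\<kappa> = 0")
    case False
    have "dd v (\<lambda>u. bform \<kappa> (Y u) (Y u)) u = dd v (\<lambda>u. \<kappa>) u"
      using range \<kappa> False
      by (intro dd_cong[OF U]) (fastforce simp: space_form_def bform_def power2_eq_square)
    then show ?thesis
      by (simp add: dd_bilinear[OF bounded_bilinear_bform U Y Y] dd_const bform_sym)
  qed simp
  show "fst (dd v Y u) = 0" if "\<kappa> = 0"
  proof -
    have "((\<lambda>u. fst (Y u)) has_derivative (\<lambda>v. fst (dd v Y u))) (at u)"
      by (rule bounded_linear.has_derivative[OF bounded_linear_fst smooth_on_has_derivative[OF Y U]])
    then have "fst (dd v Y u) = dd v (\<lambda>u. fst (Y u)) u" by (rule dd_eq[symmetric])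
    also have "\<dots> = dd v (\<lambda>u. 1) u"
      using range that by (intro dd_cong[OF U]) (fastforce simp: space_form_def power2_eq_1_iff)
    finally show ?thesis by (simp add: dd_const)
  qed
qed

lemma metric_pos:
  assumes "v \<noteq> 0"
  shows "bform \<kappa> (dd v Y u) (dd v Y u) > 0"
proof (rule bform_pos[OF \<kappa> range[OF U(2)] tangent])
  have "dd v Y u \<noteq> dd 0 Y u"
    using immersion assms by (simp add: dd_def inj_eq)
  then show "dd v Y u \<noteq> 0" using linear_0[OF linear_dY] by simp
qed

lemma g_sym: "g i j = g j i" by (simp add: g_def bform_sym)

lemma g_11_pos: "g 1 1 > 0"
  unfolding g_def pd_eq_dd by (rule metric_pos) (simp add: axis_eq_0_iff)

lemma g_det_pos: "g 1 1 * g 2 2 - g 1 2 * g 1 2 > 0"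
proof -
  \<comment> \<open>This vector is orthogonal to the first coordinate direction, and its squared
    length is \<open>g 1 1\<close> times the determinant.\<close>
  let ?v = "g 1 2 *\<^sub>R axis 1 1 - g 1 1 *\<^sub>R axis 2 1 :: real^2"
  have "?v $ 2 \<noteq> 0" using g_11_pos by (simp add: axis_def)
  then have "?v \<noteq> 0" by (metis zero_index)
  then have "0 < bform \<kappa> (dd ?v Y u) (dd ?v Y u)" by (rule metric_pos)
  also have "dd ?v Y u = g 1 2 *\<^sub>R pd 1 Y u - g 1 1 *\<^sub>R pd 2 Y u"
    using linear_diff[OF linear_dY] linear_cmul[OF linear_dY] by (simp add: pd_eq_dd)
  also have "bform \<kappa> \<dots> \<dots> = g 1 1 * (g 1 1 * g 2 2 - g 1 2 * g 1 2)"
    by (simp add: bform_simps g_def[symmetric] g_sym[of 2 1] algebra_simps)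
  finally show ?thesis using g_11_pos by (simp add: zero_less_mult_iff)
qed

lemma h_sym: "h i j = h j i"
  by (simp add: h_def pd_eq_dd dd_commute[OF Y U, of "axis i 1"])

text \<open>The tangential projection subtracts \<kappa> times a multiple of the position vector, to
  which the normal is orthogonal unless \<kappa> = 0.\<close>

lemma second_fundamental_eq: "second_fundamental \<kappa> Y n u $ i $ j = h i j"
proof -
  have "\<kappa> * bform \<kappa> (Y u) n = 0"
    using n(1) \<kappa> by (auto simp: tangent_at_def bform_def algebra_simps)
  then show ?thesis
    by (auto simp: second_fundamental_def covariant_deriv_def tangent_proj_def bform_simps h_def)
qed

lemma trace_det:
  "(a + b) * (g 1 1 * g 2 2 - g 1 2 * g 1 2) = g 2 2 * h 1 1 - 2 * (g 1 2 * h 1 2) + g 1 1 * h 2 2"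
  "a * b * (g 1 1 * g 2 2 - g 1 2 * g 1 2) = h 1 1 * h 2 2 - h 1 2 * h 1 2"
proof -
  have ff: "first_fundamental \<kappa> Y u $ i $ j = g i j" for i j
    by (simp add: first_fundamental_def g_def)
  note w = weingarten_trace_det[of "first_fundamental \<kappa> Y u" "second_fundamental \<kappa> Y n u" a b,
      unfolded ff second_fundamental_eq, OF g_sym h_sym g_11_pos g_det_pos eig[unfolded weingarten_def]]
  show "(a + b) * (g 1 1 * g 2 2 - g 1 2 * g 1 2) = g 2 2 * h 1 1 - 2 * (g 1 2 * h 1 2) + g 1 1 * h 2 2"
    "a * b * (g 1 1 * g 2 2 - g 1 2 * g 1 2) = h 1 1 * h 2 2 - h 1 2 * h 1 2"
    by (rule w)+
qed

end

section \<open>The maximum principle on the surface\<close>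

text \<open>The product need not be open, as the time interval contains 0, but its spatial slices
  are; the derivative within the product thus restricts to an ordinary spatial derivative.\<close>

lemma has_derivative_slice:
  assumes "(W has_derivative W') (at (u, t) within U \<times> I)" "open U" "u \<in> U" "t \<in> I"
  shows "((\<lambda>u. W (u, t)) has_derivative (\<lambda>v. W' (v, 0))) (at u)"
proof -
  have 1: "((\<lambda>u. (u, t)) has_derivative (\<lambda>v. (v, 0))) (at u within U)"
    by (intro has_derivative_Pair has_derivative_ident has_derivative_const)
  have 2: "(W has_derivative W') (at (u, t) within (\<lambda>u. (u, t)) ` U)"
    by (rule has_derivative_subset[OF assms(1)]) (use assms(4) in auto)
  from has_derivative_in_compose[OF 1 2] show ?thesis
    unfolding at_within_open[OF assms(3,2)] .
qed

lemma has_derivative_time_slice: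
  assumes "(W has_derivative W') (at (u, t) within U \<times> I)" "u \<in> U"
  shows "((\<lambda>s. W (u, s)) has_derivative (\<lambda>h. W' (0, h))) (at t within I)"
proof -
  have 1: "((\<lambda>s. (u, s)) has_derivative (\<lambda>h. (0, h))) (at t within I)"
    by (intro has_derivative_Pair has_derivative_ident has_derivative_const)
  have 2: "(W has_derivative W') (at (u, t) within (\<lambda>s. (u, s)) ` I)"
    by (rule has_derivative_subset[OF assms(1)]) (use assms(2) in auto)
  from has_derivative_in_compose[OF 1 2] show ?thesis .
qed

lemma smooth_on_slice:
  fixes W :: "(real^2) \<times> real \<Rightarrow> 'b::real_normed_vector"
  assumes "smooth_on (U \<times> I) W" "t \<in> I"
  shows "smooth_on U (\<lambda>u. W (u, t))"
proof (rule smooth_on_compose[OF assms(1)])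
  show "smooth_on U (\<lambda>u. (u, t))"
    by (intro smooth_on_Pair smooth_on_const smooth_on_bounded_linear bounded_linear_ident)
qed (use assms(2) in auto)

lemma time_interval_subset:
  assumes "s \<in> time_interval T" "r \<in> time_interval T"
  shows "{s..r} \<subseteq> time_interval T"
proof
  fix t assume t: "t \<in> {s..r}"
  then have "ereal t \<le> ereal r" by simp
  moreover have "ereal r < T" using assms(2) by (simp add: time_interval_def)
  ultimately have "ereal t < T" by (rule le_less_trans)
  then show "t \<in> time_interval T" using t assms(1) by (simp add: time_interval_def)
qed

locale surface_flow =
  fixes \<kappa> \<alpha> :: real and T :: ereal
    and F :: "real \<times> real \<Rightarrow> real"
    and M :: "'m::t2_space set" and A :: "'m parametrisation set"
    and X \<nu> :: "real \<Rightarrow> 'm \<Rightarrow> ambient"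
    and lam1 lam2 :: "real \<Rightarrow> 'm \<Rightarrow> real"
  assumes \<kappa>: "\<kappa> \<in> {0, 1, -1}"
    and F: "curvature_function F"
    and M: "closed_surface M A"
    and X: "smooth_surface_family \<kappa> M A T X"
    and \<nu>: "\<And>t. t \<in> time_interval T \<Longrightarrow> outer_unit_normal \<kappa> M A (X t) (\<nu> t)"
    and lam: "\<And>t. t \<in> time_interval T \<Longrightarrow> principal_curvatures \<kappa> A (X t) (\<nu> t) (lam1 t) (lam2 t)"
    and convex: "\<And>t. t \<in> time_interval T \<Longrightarrow> strictly_convex M (lam1 t) (lam2 t)"
    and flow: "\<And>x t. x \<in> M \<Longrightarrow> t \<in> time_interval T \<Longrightarrow>
           ((\<lambda>s. X s x) has_vector_derivative
              F (lam1 t x, lam2 t x) powr (- \<alpha>) *\<^sub>R \<nu> t x) (at t within time_interval T)"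
    and \<alpha>: "\<kappa> = 0 \<or> \<kappa> = -1 \<Longrightarrow> 0 < \<alpha> \<and> \<alpha> \<le> 1" "\<kappa> = 1 \<Longrightarrow> \<alpha> = 1"
begin

abbreviation I where "I \<equiv> time_interval T"

definition G where "G x t = (lam1 t x - lam2 t x)\<^sup>2 / (lam1 t x + lam2 t x)\<^sup>2"

lemma lam_pos: "x \<in> M \<Longrightarrow> t \<in> I \<Longrightarrow> lam1 t x > 0 \<and> lam2 t x > 0"
  using convex by (simp add: strictly_convex_def)

lemma G_bounds:
  assumes "x \<in> M" "t \<in> I"
  shows "0 \<le> G x t" "G x t \<le> 1"
proof -
  have "(lam1 t x - lam2 t x)\<^sup>2 \<le> (lam1 t x + lam2 t x)\<^sup>2"
    using lam_pos[OF assms] by (simp add: power2_eq_square algebra_simps)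
  then show "G x t \<le> 1" using lam_pos[OF assms] by (simp add: G_def divide_le_eq)
qed (simp add: G_def)

text \<open>The positive times. The domain \<open>U \<times> J\<close> is open, so smoothness can be
  used there through \<open>dd\<close>; time 0 is reached by continuity of \<open>G\<close>.\<close>

definition J where "J = {t. 0 < t \<and> ereal t < T}"

lemma open_J: "open J"
proof -
  have "J = {0<..} \<inter> ereal -` {..<T}" by (auto simp: J_def)
  then show ?thesis by (simp only: open_Int open_greaterThan open_ereal_vimage open_lessThan)
qed

lemma J_I: "J \<subseteq> I"
  by (auto simp: J_def time_interval_def)

section \<open>The moving surface in a single chart\<close>

context
  fixes U :: "(real^2) set" and \<phi> :: "real^2 \<Rightarrow> 'm"
  assumes chart: "(U, \<phi>) \<in> A"
begin

definition W where "W = (\<lambda>(u, t). X t (\<phi> u))"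

lemma open_U: "open U"
  using M chart by (auto simp: closed_surface_def smooth_atlas_def)

lemma \<phi>_M: "u \<in> U \<Longrightarrow> \<phi> u \<in> M"
  using M chart by (auto simp: closed_surface_def smooth_atlas_def)

lemma smooth_W: "smooth_on (U \<times> I) W"
  using X chart by (auto simp: smooth_surface_family_def W_def)

lemma W_slice: "(\<lambda>u. W (u, t)) = X t \<circ> \<phi>"
  by (auto simp: W_def)

lemma parametrised_surface:
  assumes "u \<in> U" "t \<in> I"
  shows "parametrised_surface \<kappa> U (\<lambda>u. W (u, t)) u (\<nu> t (\<phi> u)) (lam1 t (\<phi> u)) (lam2 t (\<phi> u))"
proof
  show "\<kappa> \<in> {0, 1, -1}" "open U" "u \<in> U" "smooth_on U (\<lambda>u. W (u, t))"
    by (fact \<kappa> open_U assms(1) smooth_on_slice[OF smooth_W assms(2)])+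
  show "W (v, t) \<in> space_form \<kappa>" if "v \<in> U" for v
  proof -
    have "X t ` M \<subseteq> space_form \<kappa>" using X assms(2) by (simp add: smooth_surface_family_def)
    then show ?thesis using \<phi>_M[OF that] by (auto simp: W_def)
  qed
  show "inj (frechet_derivative (\<lambda>u. W (u, t)) (at u))"
  proof -
    have "\<forall>(U, \<phi>)\<in>A. \<forall>u\<in>U. inj (frechet_derivative (X t \<circ> \<phi>) (at u))"
      using X assms(2) by (simp add: smooth_surface_family_def)
    from bspec[OF this chart] assms(1) show ?thesis by (simp add: W_slice)
  qed
  show "\<nu> t (\<phi> u) \<in> tangent_at \<kappa> (W (u, t))"
    using \<nu>[OF assms(2)] \<phi>_M[OF assms(1)] by (simp add: outer_unit_normal_def W_def)
  show "bform \<kappa> (\<nu> t (\<phi> u)) (pd i (\<lambda>u. W (u, t)) u) = 0" for i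
  proof -
    have "\<forall>(U, \<phi>)\<in>A. \<forall>u\<in>U. \<forall>i. bform \<kappa> (\<nu> t (\<phi> u)) (pd i (X t \<circ> \<phi>) u) = 0"
      using \<nu>[OF assms(2)] by (simp add: outer_unit_normal_def)
    from bspec[OF this chart] assms(1) show ?thesis by (simp add: W_slice)
  qed
  show "{l. \<exists>v. v \<noteq> 0 \<and> weingarten \<kappa> (\<lambda>u. W (u, t)) (\<nu> t (\<phi> u)) u *v v = l *\<^sub>R v}
      = {lam1 t (\<phi> u), lam2 t (\<phi> u)}"
    using bspec[OF lam[OF assms(2), unfolded principal_curvatures_def] chart] assms(1)
    by (simp add: W_slice)
qed

lemma speed_pos:
  assumes "u \<in> U" "t \<in> I"
  shows "F (lam1 t (\<phi> u), lam2 t (\<phi> u)) powr (- \<alpha>) > 0"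
proof -
  have "F (lam1 t (\<phi> u), lam2 t (\<phi> u)) > 0"
    using lam_pos[OF \<phi>_M[OF assms(1)] assms(2)] by (intro F_pos[OF F]) auto
  then show ?thesis by simp
qed

lemma unit: "u \<in> U \<Longrightarrow> t \<in> I \<Longrightarrow> bform \<kappa> (\<nu> t (\<phi> u)) (\<nu> t (\<phi> u)) = 1"
  using \<nu> \<phi>_M by (simp add: outer_unit_normal_def)

text \<open>
  Since the time derivative of \<open>X\<close> is a positive multiple of \<open>\<nu>\<close>, it can replace \<open>\<nu>\<close> in
  \<open>G = 1 - 4 det h det g / n\<^sup>2\<close>, which is invariant under scaling of the second fundamental form.
\<close>

lemma continuous_G_chart: "continuous_on (U \<times> I) (\<lambda>(u, t). G (\<phi> u) t)"
proof -
  \<comment> \<open>Derivatives within \<open>U \<times> I\<close> are used in place of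
    \<open>dd\<close>, so that the argument includes time 0.\<close>
  have "Ck_on 2 (U \<times> I) W" using smooth_W by (simp add: smooth_on_def)
  then obtain W' where W': "\<And>x. x \<in> U \<times> I \<Longrightarrow> (W has_derivative W' x) (at x within U \<times> I)"
    and "\<And>v. Ck_on 1 (U \<times> I) (\<lambda>x. W' x v)"
    by (auto simp: numeral_2_eq_2)
  then have "\<forall>v. \<exists>D. (\<forall>x \<in> U \<times> I. ((\<lambda>x. W' x v) has_derivative D x) (at x within U \<times> I)) \<and>
      (\<forall>w. continuous_on (U \<times> I) (\<lambda>x. D x w))"
    by (auto simp: One_nat_def)
  then obtain W'' where W'': "\<And>v x. x \<in> U \<times> I \<Longrightarrow> ((\<lambda>x. W' x v) has_derivative W'' v x) (at x within U \<times> I)"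
    and c'': "\<And>v w. continuous_on (U \<times> I) (\<lambda>x. W'' v x w)"
    by metis
  have c': "continuous_on (U \<times> I) (\<lambda>x. W' x v)" for v
    using W''[of _ v] has_derivative_continuous continuous_on_eq_continuous_within by blast
  define e :: "2 \<Rightarrow> (real^2) \<times> real" where "e i = (axis i 1, 0)" for i
  define g where "g i j x = bform \<kappa> (W' x (e i)) (W' x (e j))" for i j x
  define h where "h i j x = - bform \<kappa> (W'' (e j) x (e i)) (W' x (0, 1))" for i j x
  define \<Delta> where "\<Delta> x = g 1 1 x * g 2 2 x - g 1 2 x * g 1 2 x" for x
  define n where "n x = g 2 2 x * h 1 1 x - 2 * (g 1 2 x * h 1 2 x) + g 1 1 x * h 2 2 x" for x
  define d where "d x = h 1 1 x * h 2 2 x - h 1 2 x * h 1 2 x" for x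
  have key: "G (\<phi> u) t = 1 - 4 * d (u, t) * \<Delta> (u, t) / (n (u, t))\<^sup>2 \<and> n (u, t) \<noteq> 0"
    if u: "u \<in> U" and t: "t \<in> I" for u t
  proof -
    interpret s: parametrised_surface \<kappa> U "\<lambda>u. W (u, t)" u "\<nu> t (\<phi> u)" "lam1 t (\<phi> u)" "lam2 t (\<phi> u)"
      by (rule parametrised_surface[OF u t])
    have x: "(v, t) \<in> U \<times> I" if "v \<in> U" for v using that t by simp
    have p1: "pd i (\<lambda>u. W (u, t)) v = W' (v, t) (e i)" if "v \<in> U" for i v
      unfolding pd_eq_dd e_def by (rule dd_eq[OF has_derivative_slice[OF W'[OF x[OF that]] open_U that t]])
    have p2: "pd i (pd j (\<lambda>u. W (u, t))) u = W'' (e j) (u, t) (e i)" for i j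
    proof -
      have "pd i (pd j (\<lambda>u. W (u, t))) u = dd (axis i 1) (\<lambda>v. W' (v, t) (e j)) u"
        unfolding pd_eq_dd[of i] by (rule dd_cong[OF open_U u p1])
      also have "\<dots> = W'' (e j) (u, t) (e i)"
        unfolding e_def by (rule dd_eq[OF has_derivative_slice[OF W''[OF x[OF u]] open_U u t]])
      finally show ?thesis .
    qed
    define c where "c = F (lam1 t (\<phi> u), lam2 t (\<phi> u)) powr (- \<alpha>)"
    have c: "c > 0" using speed_pos[OF u t] by (simp add: c_def)
    have W't: "W' (u, t) (0, 1) = c *\<^sub>R \<nu> t (\<phi> u)"
    proof -
      \<comment> \<open>Derivatives within the time interval are unique only at accumulation points;
        a time \<open>r\<close> between \<open>t\<close> and \<open>T\<close> shows that
        \<open>t\<close> is one.\<close>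
      have nontriv: "at t within I \<noteq> bot"
      proof -
        have t': "0 \<le> t" "ereal t < T" using t by (auto simp: time_interval_def)
        then obtain r where r: "t < r" "ereal r < T" using ereal_dense2[of "ereal t" T] by auto
        then have "r \<in> I" using t' by (simp add: time_interval_def)
        from time_interval_subset[OF t this] have "at_right t \<le> at t within I"
          using at_le[of "{t..r}" I t] at_within_Icc_at_right[OF r(1)] by simp
        then show ?thesis using trivial_limit_at_right_real[of t] bot.extremum_uniqueI by metis
      qed
      have W't: "((\<lambda>s. W (u, s)) has_derivative (\<lambda>h. W' (u, t) (0, h))) (at t within I)"
        by (rule has_derivative_time_slice[OF W'[OF x[OF u]] u])
      have "W' (u, t) (0, h) = h *\<^sub>R W' (u, t) (0, 1)" for h
      proof -
        have "(0, h) = h *\<^sub>R (0 :: real^2, 1)" by simp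
        then show ?thesis using linear_cmul[OF has_derivative_linear[OF W'[OF x[OF u]]]] by metis
      qed
      then have "(\<lambda>h. W' (u, t) (0, h)) = (\<lambda>h. h *\<^sub>R W' (u, t) (0, 1))" by (rule ext)
      from W't[unfolded this]
      have "((\<lambda>s. X s (\<phi> u)) has_vector_derivative W' (u, t) (0, 1)) (at t within I)"
        by (simp add: has_vector_derivative_def W_def)
      then show ?thesis
        using vector_derivative_unique_within[OF nontriv _ flow[OF \<phi>_M[OF u] t]] by (simp add: c_def)
    qed
    have gg: "g i j (u, t) = s.g i j" for i j
      by (simp add: g_def s.g_def p1[OF u])
    have hh: "h i j (u, t) = c * s.h i j" for i j
      by (simp add: h_def s.h_def p2 W't bform_simps)
    define H where "H = lam1 t (\<phi> u) + lam2 t (\<phi> u)"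
    have H: "H > 0" using lam_pos[OF \<phi>_M[OF u] t] by (simp add: H_def)
    have \<Delta>: "\<Delta> (u, t) > 0" unfolding \<Delta>_def gg by (rule s.g_det_pos)
    have n: "n (u, t) = c * (H * \<Delta> (u, t))"
      unfolding n_def gg hh using s.trace_det(1) unfolding \<Delta>_def gg H_def[symmetric] by algebra
    have d: "d (u, t) = c\<^sup>2 * (lam1 t (\<phi> u) * lam2 t (\<phi> u) * \<Delta> (u, t))"
      unfolding d_def hh using s.trace_det(2) unfolding \<Delta>_def gg by algebra
    have "1 - 4 * d (u, t) * \<Delta> (u, t) / (n (u, t))\<^sup>2 = 1 - 4 * (lam1 t (\<phi> u) * lam2 t (\<phi> u)) / H\<^sup>2"
      unfolding n d using c \<Delta> H by (simp add: power2_eq_square)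
    also have "\<dots> = (H\<^sup>2 - 4 * (lam1 t (\<phi> u) * lam2 t (\<phi> u))) / H\<^sup>2"
      using H by (simp add: diff_divide_distrib)
    also have "H\<^sup>2 - 4 * (lam1 t (\<phi> u) * lam2 t (\<phi> u)) = (lam1 t (\<phi> u) - lam2 t (\<phi> u))\<^sup>2"
      unfolding H_def by algebra
    finally show ?thesis using n c \<Delta> H by (simp add: G_def H_def)
  qed
  have cg: "continuous_on (U \<times> I) (g i j)" and ch: "continuous_on (U \<times> I) (h i j)" for i j
    unfolding g_def[abs_def] h_def[abs_def]
    by (intro bounded_bilinear.continuous_on[OF bounded_bilinear_bform] continuous_on_minus c' c'')+
  have "continuous_on (U \<times> I) (\<lambda>x. 1 - 4 * d x * \<Delta> x / (n x)\<^sup>2)"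
    unfolding d_def \<Delta>_def n_def
    by (intro continuous_intros cg ch) (use key in \<open>auto simp: n_def\<close>)
  then show ?thesis
    by (rule continuous_on_eq) (use key in auto)
qed

text \<open>
  Smoothness of \<open>\<nu>\<close> is not assumed; it holds for positive time because \<open>\<nu>\<close> is the normalised time
  derivative of \<open>X\<close>.
\<close>

lemma chart_flow: "chart_flow \<kappa> W (\<lambda>(u, t). \<nu> t (\<phi> u)) \<alpha> F (U \<times> J)
  (\<lambda>(u, t). F (lam1 t (\<phi> u), lam2 t (\<phi> u)) powr (- \<alpha>)) (\<lambda>(u, t). lam1 t (\<phi> u)) (\<lambda>(u, t). lam2 t (\<phi> u))"
proof -
  define N where "N = (\<lambda>(u, t). \<nu> t (\<phi> u))"
  define f where "f = (\<lambda>(u, t). F (lam1 t (\<phi> u), lam2 t (\<phi> u)) powr (- \<alpha>))"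
  let ?S = "U \<times> J"
  have S: "open ?S" by (rule open_Times[OF open_U open_J])
  have SI: "?S \<subseteq> U \<times> I" using J_I by auto
  have sW: "smooth_on ?S W" by (rule smooth_on_subset[OF smooth_W SI])
  have fpos: "f x > 0" if "x \<in> ?S" for x
  proof -
    obtain u t where x: "x = (u, t)" "u \<in> U" "t \<in> I" using \<open>x \<in> ?S\<close> SI by auto
    show ?thesis using speed_pos[OF x(2,3)] by (simp add: f_def x(1))
  qed
  have unitN: "bform \<kappa> (N x) (N x) = 1" if "x \<in> ?S" for x
    using that unit J_I by (auto simp: N_def)
  have Wt: "dd (0, 1) W x = f x *\<^sub>R N x" if x: "x \<in> ?S" for x
  proof -
    obtain u t where xut: "x = (u, t)" "u \<in> U" "t \<in> J" using x by auto
    have "(W has_derivative (\<lambda>h. dd h W x)) (at (u, t) within U \<times> J)"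
      using has_derivative_at_withinI[OF smooth_on_has_derivative[OF sW S x]] unfolding xut(1) .
    from has_derivative_time_slice[OF this xut(2)]
    have W't: "((\<lambda>s. W (u, s)) has_derivative (\<lambda>h. dd (0, h) W x)) (at t)"
      unfolding at_within_open[OF xut(3) open_J] .
    have "dd (0, h) W x = h *\<^sub>R dd (0, 1) W x" for h
    proof -
      have "(0, h) = h *\<^sub>R (0 :: real^2, 1)" by simp
      then show ?thesis using linear_cmul[OF linear_dd[OF sW S x]] by metis
    qed
    then have "(\<lambda>h. dd (0, h) W x) = (\<lambda>h. h *\<^sub>R dd (0, 1) W x)" by (rule ext)
    from W't[unfolded this] have "((\<lambda>s. X s (\<phi> u)) has_vector_derivative dd (0, 1) W x) (at t)"
      by (simp add: has_vector_derivative_def W_def)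
    moreover have "((\<lambda>s. X s (\<phi> u)) has_vector_derivative f x *\<^sub>R N x) (at t)"
    proof -
      have "at t within I = at t"
        using at_within_interior[of t I] interior_maximal[OF J_I open_J] xut(3) by auto
      then show ?thesis using flow[OF \<phi>_M[OF xut(2)], of t] J_I xut by (auto simp: f_def N_def)
    qed
    ultimately show ?thesis using vector_derivative_unique_at by blast
  qed
  \<comment> \<open>The length of the time derivative gives the speed without recourse to the
    principal curvatures, whose smoothness is not known.\<close>
  have BW: "bform \<kappa> (dd (0, 1) W x) (dd (0, 1) W x) = (f x)\<^sup>2" if "x \<in> ?S" for x
    using unitN[OF that] by (simp add: Wt[OF that] bform_simps power2_eq_square)
  have sB: "smooth_on ?S (\<lambda>x. bform \<kappa> (dd (0, 1) W x) (dd (0, 1) W x))"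
    by (intro smooth_on_bilinear[OF bounded_bilinear_bform] smooth_on_dd sW S)
  have sf: "smooth_on ?S f"
  proof (rule smooth_on_cong)
    show "smooth_on ?S (\<lambda>x. bform \<kappa> (dd (0, 1) W x) (dd (0, 1) W x) powr (1 / 2))"
      by (rule smooth_on_powr[OF sB]) (simp add: BW fpos less_imp_neq[symmetric])
    show "bform \<kappa> (dd (0, 1) W x) (dd (0, 1) W x) powr (1 / 2) = f x" if "x \<in> ?S" for x
      using fpos[OF that] by (simp add: BW[OF that] powr_half_sqrt)
  qed
  have sN: "smooth_on ?S N"
  proof (rule smooth_on_cong)
    show "smooth_on ?S (\<lambda>x. f x powr (-1) *\<^sub>R dd (0, 1) W x)"
      by (intro smooth_on_scaleR smooth_on_powr sf fpos smooth_on_dd sW S)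
    show "f x powr (-1) *\<^sub>R dd (0, 1) W x = N x" if "x \<in> ?S" for x
      using fpos[OF that] by (simp add: Wt[OF that] powr_minus)
  qed
  have d1: "dd (v, 0) W' (u, t) = dd v (\<lambda>u. W' (u, t)) u" if "(u, t) \<in> ?S" "smooth_on ?S W'"
    for v u t and W' :: "(real^2) \<times> real \<Rightarrow> ambient"
    by (rule dd_eq[symmetric], rule has_derivative_slice[of W' _ u t U J])
      (use that open_U in \<open>auto intro!: has_derivative_at_withinI smooth_on_has_derivative[OF that(2) S]\<close>)
  have d2: "dd (v, 0) (dd (w, 0) W) (u, t) = dd v (dd w (\<lambda>u. W (u, t))) u" if x: "(u, t) \<in> ?S" for v w u t
  proof -
    have "dd (v, 0) (dd (w, 0) W) (u, t) = dd v (\<lambda>u. dd (w, 0) W (u, t)) u"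
      by (rule d1[OF x smooth_on_dd[OF sW S]])
    also have "\<dots> = dd v (dd w (\<lambda>u. W (u, t))) u"
      using x by (intro dd_cong[OF open_U] d1 sW) auto
    finally show ?thesis .
  qed
  interpret chart_data \<kappa> W N .
  show ?thesis
    unfolding N_def[symmetric] f_def[symmetric]
  proof unfold_locales
    show "\<kappa> \<in> {0, 1, -1}" "curvature_function F" "open ?S" "smooth_on ?S W" "smooth_on ?S N" "smooth_on ?S f"
      by (fact \<kappa> F S sW sN sf)+
    show "0 < \<alpha>" "\<alpha> \<le> 1" "\<kappa> = 1 \<Longrightarrow> \<alpha> = 1" using \<alpha> \<kappa> by auto
    fix x assume x: "x \<in> ?S"
    obtain u t where xut: "x = (u, t)" "u \<in> U" "t \<in> I" using x SI by auto
    interpret s: parametrised_surface \<kappa> U "\<lambda>u. W (u, t)" u "\<nu> t (\<phi> u)" "lam1 t (\<phi> u)" "lam2 t (\<phi> u)"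
      by (rule parametrised_surface[OF xut(2,3)])
    note d1' = d1[OF x[unfolded xut(1)] sW] and d2' = d2[OF x[unfolded xut(1)]]
    have gg: "g (axis i 1) (axis j 1) x = s.g i j" and aa: "a (axis i 1) (axis j 1) x = s.h i j" for i j
      unfolding g_def s.g_def a_def s.h_def xut(1) d1' d2' pd_eq_dd by (simp_all add: N_def)
    show "W x \<in> space_form \<kappa>" using s.range[OF xut(2)] by (simp add: xut(1))
    show "N x \<in> tangent_at \<kappa> (W x)" using s.n(1) by (simp add: xut(1) N_def)
    show "bform \<kappa> (N x) (N x) = 1" by (rule unitN[OF x])
    show "bform \<kappa> (dd (v, 0) W x) (N x) = 0" for v
      using s.dd_Y_perp by (simp add: xut(1) N_def d1')
    show "dd (0, 1) W x = f x *\<^sub>R N x" by (rule Wt[OF x])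
    show "g v v x > 0" if "v \<noteq> 0" for v
      using s.metric_pos[OF that] by (simp add: g_def xut(1) d1')
    show "\<Delta> x > 0" unfolding \<Delta>_def gg by (rule s.g_det_pos)
    show "((case x of (u, t) \<Rightarrow> lam1 t (\<phi> u)) + (case x of (u, t) \<Rightarrow> lam2 t (\<phi> u))) * \<Delta> x
      = g (axis 2 1) (axis 2 1) x * a (axis 1 1) (axis 1 1) x
        - 2 * (g (axis 1 1) (axis 2 1) x * a (axis 1 1) (axis 2 1) x)
        + g (axis 1 1) (axis 1 1) x * a (axis 2 1) (axis 2 1) x"
      unfolding \<Delta>_def gg aa using s.trace_det(1) by (simp add: xut(1))
    show "(case x of (u, t) \<Rightarrow> lam1 t (\<phi> u)) * (case x of (u, t) \<Rightarrow> lam2 t (\<phi> u)) * \<Delta> x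
      = a (axis 1 1) (axis 1 1) x * a (axis 2 1) (axis 2 1) x
        - a (axis 1 1) (axis 2 1) x * a (axis 1 1) (axis 2 1) x"
      unfolding \<Delta>_def gg aa using s.trace_det(2) by (simp add: xut(1))
    show "(case x of (u, t) \<Rightarrow> lam1 t (\<phi> u)) > 0 \<and> (case x of (u, t) \<Rightarrow> lam2 t (\<phi> u)) > 0"
      using lam_pos[OF \<phi>_M[OF xut(2)] xut(3)] by (simp add: xut(1))
    show "f x = F (case x of (u, t) \<Rightarrow> lam1 t (\<phi> u), case x of (u, t) \<Rightarrow> lam2 t (\<phi> u)) powr (- \<alpha>)"
      by (simp add: f_def xut(1))
  qed
qed

text \<open>A maximum over all of \<open>M\<close> is a local maximum in the chart, where the
  pointwise estimate applies to the time derivative at a fixed point of \<open>M\<close>.\<close>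

lemma spatial_max_derivative:
  assumes u: "u \<in> U" and t: "t \<in> J" and pos: "G (\<phi> u) t > 0"
    and max: "\<And>x. x \<in> M \<Longrightarrow> G x t \<le> G (\<phi> u) t"
  shows "\<exists>D\<le>0. ((\<lambda>t. G (\<phi> u) t) has_real_derivative D) (at t)"
proof -
  interpret c: chart_flow \<kappa> W "\<lambda>(u, t). \<nu> t (\<phi> u)" \<alpha> F "U \<times> J"
    "\<lambda>(u, t). F (lam1 t (\<phi> u), lam2 t (\<phi> u)) powr (- \<alpha>)" "\<lambda>(u, t). lam1 t (\<phi> u)" "\<lambda>(u, t). lam2 t (\<phi> u)"
    by (rule chart_flow)
  have G: "c.pinching (u, t) = G (\<phi> u) t" for u t by (simp add: c.pinching_def G_def)
  have x: "(u, t) \<in> U \<times> J" using u t by simp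
  have "\<forall>\<^sub>F v in nhds u. v \<in> U" by (rule eventually_nhds_in_open[OF open_U u])
  then have "\<forall>\<^sub>F v in nhds u. c.pinching (v, t) \<le> c.pinching (u, t)"
    by eventually_elim (simp add: G max \<phi>_M)
  then have "dd (0, 1) c.pinching (u, t) \<le> 0"
    using c.dd_pinching_le_0[OF x] pos by (simp add: G)
  moreover have "((\<lambda>s. c.pinching (u, s)) has_real_derivative dd (0, 1) c.pinching (u, t)) (at t)"
  proof -
    note sm = c.smooth_pinching and op = open_Times[OF open_U open_J]
    have d: "((\<lambda>s. c.pinching (u, s)) has_derivative (\<lambda>h. dd (0, h) c.pinching (u, t))) (at t)"
      using has_derivative_time_slice[OF has_derivative_at_withinI[OF smooth_on_has_derivative[OF sm op x]] u]
      unfolding at_within_open[OF t open_J] .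
    have "dd (0, h) c.pinching (u, t) = dd (0, 1) c.pinching (u, t) * h" for h
    proof -
      have "(0, h) = h *\<^sub>R (0 :: real^2, 1)" by simp
      then have "dd (0, h) c.pinching (u, t) = h *\<^sub>R dd (0, 1) c.pinching (u, t)"
        using linear_cmul[OF linear_dd[OF sm op x]] by metis
      then show ?thesis by simp
    qed
    then have "(\<lambda>h. dd (0, h) c.pinching (u, t)) = (*) (dd (0, 1) c.pinching (u, t))" by (rule ext)
    from d[unfolded this] show ?thesis by (simp add: has_field_derivative_def)
  qed
  ultimately show ?thesis by (auto simp: G)
qed

end

lemma chart_at:
  assumes "x \<in> M"
  obtains U \<phi> u where "(U, \<phi>) \<in> A" "u \<in> U" "x = \<phi> u"
proof -
  have "(\<Union>(U, \<phi>)\<in>A. \<phi> ` U) = M" using M by (simp add: closed_surface_def smooth_atlas_def)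
  then show ?thesis using assms that by blast
qed

lemma continuous_G: "continuous_on (M \<times> I) (\<lambda>(x, t). G x t)"
  unfolding continuous_on_eq_continuous_within
proof
  fix z assume z: "z \<in> M \<times> I"
  from z have "fst z \<in> M" by auto
  then obtain U \<phi> u where c: "(U, \<phi>) \<in> A" "u \<in> U" "fst z = \<phi> u" by (rule chart_at)
  have "\<forall>(U, \<phi>)\<in>A. open U \<and> openin (top_of_set M) (\<phi> ` U) \<and> (\<exists>\<psi>. homeomorphism U (\<phi> ` U) \<phi> \<psi>)"
    using M by (simp add: closed_surface_def smooth_atlas_def)
  from bspec[OF this c(1)] obtain \<psi> where
    op: "openin (top_of_set M) (\<phi> ` U)" and hom: "homeomorphism U (\<phi> ` U) \<phi> \<psi>" by auto
  obtain O' where O': "open O'" "\<phi> ` U = M \<inter> O'" using op by (auto simp: openin_open)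
  have "continuous_on (\<phi> ` U \<times> I) (\<lambda>x. (\<lambda>(u, t). G (\<phi> u) t) (\<psi> (fst x), snd x))"
  proof (rule continuous_on_compose2[OF continuous_G_chart[OF c(1)]])
    show "continuous_on (\<phi> ` U \<times> I) (\<lambda>x. (\<psi> (fst x), snd x))"
      by (intro continuous_intros continuous_on_compose2[OF homeomorphism_cont2[OF hom]]) auto
    show "(\<lambda>x. (\<psi> (fst x), snd x)) ` (\<phi> ` U \<times> I) \<subseteq> U \<times> I"
      using homeomorphism_image2[OF hom] by auto
  qed
  then have "continuous_on (\<phi> ` U \<times> I) (\<lambda>(x, t). G x t)"
    by (rule continuous_on_eq) (auto simp: homeomorphism_apply1[OF hom])
  then have "continuous (at z within \<phi> ` U \<times> I) (\<lambda>(x, t). G x t)"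
    using z c(2,3) by (force simp: continuous_on_eq_continuous_within mem_Times_iff)
  \<comment> \<open>Chart images are relatively open in \<open>M\<close>, so continuity on them is
    continuity on \<open>M\<close>.\<close>
  moreover have "at z within \<phi> ` U \<times> I = at z within M \<times> I"
  proof (rule at_within_nhd)
    show "z \<in> O' \<times> UNIV" using c(2,3) O'(2) by (auto simp: mem_Times_iff)
    show "open (O' \<times> UNIV)" by (intro open_Times O'(1) open_UNIV)
    show "\<phi> ` U \<times> I \<inter> O' \<times> UNIV - {z} = M \<times> I \<inter> O' \<times> UNIV - {z}" using O'(2) by auto
  qed
  ultimately show "continuous (at z within M \<times> I) (\<lambda>(x, t). G x t)" by simp
qed

text \<open>
  A maximum point of \<open>G - \<epsilon> t\<close> over \<open>M \<times> [s, r]\<close> cannot lie at a time after \<open>s\<close>: there \<open>G\<close> would be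
  positive with time derivative at least \<open>\<epsilon>\<close>.
\<close>

lemma sup_bound:
  assumes s: "s \<in> I" and r: "r \<in> I" "s \<le> r" and \<epsilon>: "\<epsilon> > 0" and x: "x \<in> M"
  shows "\<exists>y\<in>M. G x r \<le> G y s + \<epsilon> * (r - s)"
proof -
  have sI: "{s..r} \<subseteq> I" by (rule time_interval_subset[OF s r(1)])
  have "compact (M \<times> {s..r})" using M by (auto simp: closed_surface_def intro: compact_Times)
  moreover have "M \<times> {s..r} \<noteq> {}" using x r(2) by auto
  moreover have "continuous_on (M \<times> {s..r}) (\<lambda>z. (\<lambda>(x, t). G x t) z - \<epsilon> * snd z)"
    using sI by (intro continuous_intros continuous_on_subset[OF continuous_G]) auto
  ultimately obtain z where z: "z \<in> M \<times> {s..r}"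
    "\<And>w. w \<in> M \<times> {s..r} \<Longrightarrow> (\<lambda>(x, t). G x t) w - \<epsilon> * snd w \<le> (\<lambda>(x, t). G x t) z - \<epsilon> * snd z"
    using continuous_attains_sup[of "M \<times> {s..r}"] by blast
  obtain y t where yt: "z = (y, t)" "y \<in> M" "s \<le> t" "t \<le> r" using z(1) by auto
  have max: "G y' t' - \<epsilon> * t' \<le> G y t - \<epsilon> * t" if "y' \<in> M" "s \<le> t'" "t' \<le> r" for y' t'
    using z(2)[of "(y', t')"] that by (simp add: yt(1))
  have "t = s"
  proof (rule ccontr)
    assume "t \<noteq> s"
    then have ts: "s < t" using yt(3) by simp
    have tI: "t \<in> I" using yt(3,4) sI by auto
    then have tJ: "t \<in> J" using ts s by (auto simp: J_def time_interval_def)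
    have "0 \<le> G y s" using G_bounds yt(2) s by blast
    moreover have "G y s - \<epsilon> * s \<le> G y t - \<epsilon> * t" using max[OF yt(2), of s] r(2) by simp
    moreover have "\<epsilon> * s < \<epsilon> * t" using ts \<epsilon> by simp
    ultimately have pos: "G y t > 0" by linarith
    obtain U \<phi> u where c: "(U, \<phi>) \<in> A" "u \<in> U" "y = \<phi> u" using chart_at[OF yt(2)] .
    have "G x' t \<le> G (\<phi> u) t" if "x' \<in> M" for x' using max[OF that yt(3,4)] by (simp add: c(3))
    then obtain D where D: "D \<le> 0" "((\<lambda>t. G y t) has_real_derivative D) (at t)"
      using spatial_max_derivative[OF c(1,2) tJ] pos c(3) by blast
    have "((\<lambda>t. G y t - \<epsilon> * t) has_real_derivative D - \<epsilon>) (at t)"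
      using D(2) by (auto intro!: derivative_eq_intros)
    \<comment> \<open>The comparison is with earlier times only, so it also covers a maximum at the
      final time \<open>r\<close>.\<close>
    from DERIV_neg_dec_left[OF this] D(1) \<epsilon> obtain d where
      d: "d > 0" "\<And>h. h > 0 \<Longrightarrow> h < d \<Longrightarrow> G y t - \<epsilon> * t < G y (t - h) - \<epsilon> * (t - h)" by auto
    define h where "h = min d (t - s) / 2"
    have "h > 0" "h < d" "h \<le> t - s" using d(1) ts by (auto simp: h_def)
    then show False using d(2)[of h] max[OF yt(2), of "t - h"] yt(4) by fastforce
  qed
  then show ?thesis using max[OF x r(2) order_refl] yt(2) by (auto simp: algebra_simps)
qed

theorem antimono_sup_G: "antimono_on I (\<lambda>t. SUP x\<in>M. G x t)"
proof (rule monotone_onI)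
  fix s r assume s: "s \<in> I" and r: "r \<in> I" and sr: "s \<le> r"
  have M_ne: "M \<noteq> {}" using M by (simp add: closed_surface_def)
  \<comment> \<open>The bound by 1 makes \<open>SUP\<close> a true supremum; on the reals it is
    unspecified for unbounded sets.\<close>
  have bdd: "bdd_above ((\<lambda>x. G x s) ` M)" using G_bounds s by (auto intro!: bdd_aboveI2[of _ _ 1])
  have "(SUP x\<in>M. G x r) \<le> (SUP x\<in>M. G x s) + e" if "e > 0" for e
  proof (rule cSUP_least[OF M_ne])
    fix x assume x: "x \<in> M"
    \<comment> \<open>The summand 1 avoids division by zero when \<open>r = s\<close>.\<close>
    define \<epsilon> where "\<epsilon> = e / (r - s + 1)"
    have \<epsilon>: "\<epsilon> > 0" using that sr by (simp add: \<epsilon>_def)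
    obtain y where y: "y \<in> M" "G x r \<le> G y s + \<epsilon> * (r - s)" using sup_bound[OF s r sr \<epsilon> x] by blast
    have "\<epsilon> * (r - s) \<le> \<epsilon> * (r - s + 1)" using \<epsilon> by simp
    also have "\<dots> = e" using sr by (simp add: \<epsilon>_def)
    finally have "\<epsilon> * (r - s) \<le> e" .
    moreover have "G y s \<le> (SUP x\<in>M. G x s)" by (rule cSUP_upper[OF y(1) bdd])
    ultimately show "G x r \<le> (SUP x\<in>M. G x s) + e" using y(2) by linarith
  qed
  then show "(SUP x\<in>M. G x r) \<le> (SUP x\<in>M. G x s)" by (rule field_le_epsilon)
qed

end

theorem theorem3p1:
  fixes \<kappa> \<alpha> :: real and T :: ereal
    and F :: "real \<times> real \<Rightarrow> real"
    and M :: "'m::t2_space set" and A :: "'m parametrisation set"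
    and X \<nu> :: "real \<Rightarrow> 'm \<Rightarrow> ambient"
    and lam1 lam2 :: "real \<Rightarrow> 'm \<Rightarrow> real"
  assumes "\<kappa> \<in> {0, 1, -1}"
    and "curvature_function F"
    and "closed_surface M A"
    and "0 < T"
    and "smooth_surface_family \<kappa> M A T X"
    and "\<And>t. t \<in> time_interval T \<Longrightarrow> outer_unit_normal \<kappa> M A (X t) (\<nu> t)"
    and "\<And>t. t \<in> time_interval T \<Longrightarrow> principal_curvatures \<kappa> A (X t) (\<nu> t) (lam1 t) (lam2 t)"
    and "\<And>t. t \<in> time_interval T \<Longrightarrow> strictly_convex M (lam1 t) (lam2 t)"
    and "\<And>x t. x \<in> M \<Longrightarrow> t \<in> time_interval T \<Longrightarrow>
           ((\<lambda>s. X s x) has_vector_derivative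
              F (lam1 t x, lam2 t x) powr (- \<alpha>) *\<^sub>R \<nu> t x) (at t within time_interval T)"
    and "\<kappa> = 0 \<or> \<kappa> = -1 \<Longrightarrow> 0 < \<alpha> \<and> \<alpha> \<le> 1"
    and "\<kappa> = 1 \<Longrightarrow> \<alpha> = 1"
  shows "antimono_on (time_interval T)
           (\<lambda>t. SUP x\<in>M. (lam1 t x - lam2 t x)\<^sup>2 / (lam1 t x + lam2 t x)\<^sup>2)"
proof -
  interpret surface_flow \<kappa> \<alpha> T F M A X \<nu> lam1 lam2
    by (rule surface_flow.intro) (fact assms)+
  show ?thesis
    using antimono_sup_G unfolding G_def .
qed

end
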